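(* Let $\mathbf G$ be an indexing category, let $\mathcal X,\mathcal Y\in\mathrm{Prob}\langle\mathbf G\rangle$ be two $\mathbf G$-diagrams of probability spaces, and let $U:=X_\iota$ and $V:=Y_\iota$ be the spaces in $\mathcal X$ and $\mathcal Y$, respectively, indexed by some object $\iota\in\mathbf G$. Then $$\boldsymbol\kappa\big([\mathcal X|U],[\mathcal Y|V]\big)\le(2|\mathbf G|+1)\cdot\boldsymbol\kappa(\mathcal X,\mathcal Y),$$ where $|\mathbf G|$ is the number of objects of $\mathbf G$.
   Context: Finite probability spaces: a finite probability space is a set with a probability measure of finite support. An atom is a point of positive weight; $u\in U$ means that $u$ is an atom of $U$, and $p(u)$ is its weight. A reduction is a measure-preserving map, two maps being identified if they agree on a set of full measure. $\mathrm{Prob}$ is the category of finite probability spaces and reductions. Indexing category: a finite category $\mathbf G$ in which for any two objects $i,j$ there is at most one morphism between them either way, and such that any two objects have a minimal common ancestor. Here $i$ is an ancestor of $j$ if there is a morphism $i\to j$, and a minimal common ancestor of $i,j$ is a common ancestor $\hat\imath$ such that every common ancestor of $i,j$ is an ancestor of $\hat\imath$. Such a category has an initial object. Diagrams: a $\mathbf G$-diagram is a functor $\mathcal X=\{X_i;\chi_{ij}\}:\mathbf G\to\mathrm{Prob}$; a reduction of $\mathbf G$-diagrams is a natural transformation; $\mathrm{Prob}\langle\mathbf G\rangle$ is the category of $\mathbf G$-diagrams. The tensor product $\mathcal X\otimes\mathcal Y$ is taken objectwise (product of probability spaces with product measure, product of maps), and $\mathcal X^n$ is the $n$-fold tensor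 power. Conditioning on an atom: let $X_0=(S_0,\pi_0)$ be the initial space of $\mathcal X$ and $U=X_\iota$, with map $\sigma:S_0\to S_\iota$. For an atom $u\in U$, $\mathcal X|u$ is the $\mathbf G$-diagram with the same underlying sets and maps, whose initial space carries the distribution $\pi_0(\cdot|u)$ supported on $\sigma^{-1}(u)$ with $\pi_0(s|u)=\pi_0(s)/\pi_0(\sigma^{-1}(u))$, and whose other spaces carry the push-forwards of this distribution. Entropy distances: $\mathrm{Ent}_*(\mathcal X)=(\mathrm{Ent}(X_i))_{i\in\mathbf G}\in\mathbb R^{\mathbf G}$ is the tuple of Shannon entropies, and $\|\cdot\|_1$ is the $\ell^1$-norm on $\mathbb R^{\mathbf G}$. For a fan $\mathcal K=(\mathcal X\leftarrow\mathcal Z\to\mathcal Y)$ of reductions of $\mathbf G$-diagrams, $\mathrm{kd}(\mathcal K)=\|\mathrm{Ent}_*\mathcal Z-\mathrm{Ent}_*\mathcal X\|_1+\|\mathrm{Ent}_*\mathcal Z-\mathrm{Ent}_*\mathcal Y\|_1$. The intrinsic entropy distance $\mathbf k(\mathcal X,\mathcal Y)$ is the infimum of $\mathrm{kd}(\mathcal K)$ over all such fans. The asymptotic entropy distance between $\mathbf G$-diagrams is $\boldsymbol\kappa(\mathcal X,\mathcal Y)=\lim_{n\to\infty}\frac1n\mathbf k(\mathcal X^n,\mathcal Y^n)$. Tropical conditioning: $[\mathcal X|U]$ is the tropical diagram $\int_{u\in U}\overrightarrow{(\mathcal X|u)}\,dp(u)$, i.e. the convex combination $\sum_{u\in U}p(u)\cdot\overrightarrow{(\mathcal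 X|u)}$, where $\overrightarrow{\mathcal A}$ is the tropical diagram represented by the sequence $(\mathcal A^n)_{n\in\mathbb N_0}$. Concretely, $[\mathcal X|U]$ is represented by the sequence of $\mathbf G$-diagrams $n\mapsto\bigotimes_{u\in U}(\mathcal X|u)^{\lfloor n\,p(u)\rfloor}$. The asymptotic entropy distance $\boldsymbol\kappa$ between tropical diagrams represented by such sequences $(\mathcal A(n))$ and $(\mathcal B(n))$ is $\lim_{n\to\infty}\frac1n\mathbf k(\mathcal A(n),\mathcal B(n))$. *)

theory Defs
  imports "HOL-Probability.Probability"
begin

section \<open>Indexing categories\<close>

record ('o, 'm) cat =
  Ob :: "'o set"
  Ar :: "'m set"
  Dom :: "'m \<Rightarrow> 'o"
  Cod :: "'m \<Rightarrow> 'o"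
  Idn :: "'o \<Rightarrow> 'm"
  Cmp :: "'m \<Rightarrow> 'm \<Rightarrow> 'm"  \<comment> \<open>\<open>Cmp G g f\<close> is \<open>g\<close> after \<open>f\<close>\<close>

definition hom_set :: "('o, 'm) cat \<Rightarrow> 'o \<Rightarrow> 'o \<Rightarrow> 'm set" where
  "hom_set G i j = {f \<in> Ar G. Dom G f = i \<and> Cod G f = j}"

definition ancestor :: "('o, 'm) cat \<Rightarrow> 'o \<Rightarrow> 'o \<Rightarrow> bool" where
  "ancestor G i j \<longleftrightarrow> hom_set G i j \<noteq> {}"

definition minimal_common_ancestor :: "('o, 'm) cat \<Rightarrow> 'o \<Rightarrow> 'o \<Rightarrow> 'o \<Rightarrow> bool" where
  "minimal_common_ancestor G i j h \<longleftrightarrow>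
     h \<in> Ob G \<and> ancestor G h i \<and> ancestor G h j \<and>
     (\<forall>k\<in>Ob G. ancestor G k i \<longrightarrow> ancestor G k j \<longrightarrow> ancestor G k h)"

locale small_category =
  fixes G :: "('o, 'm) cat"
  assumes Dom_Ob: "f \<in> Ar G \<Longrightarrow> Dom G f \<in> Ob G"
    and Cod_Ob: "f \<in> Ar G \<Longrightarrow> Cod G f \<in> Ob G"
    and Idn_hom: "i \<in> Ob G \<Longrightarrow> Idn G i \<in> hom_set G i i"
    and Cmp_hom: "f \<in> hom_set G i j \<Longrightarrow> g \<in> hom_set G j k \<Longrightarrow> Cmp G g f \<in> hom_set G i k"
    and Cmp_Idn_right: "f \<in> hom_set G i j \<Longrightarrow> Cmp G f (Idn G i) = f"
    and Cmp_Idn_left: "f \<in> hom_set G i j \<Longrightarrow> Cmp G (Idn G j) f = f"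
    and Cmp_assoc: "f \<in> hom_set G i j \<Longrightarrow> g \<in> hom_set G j k \<Longrightarrow> h \<in> hom_set G k l \<Longrightarrow>
        Cmp G h (Cmp G g f) = Cmp G (Cmp G h g) f"

locale indexing_category = small_category G for G :: "('o, 'm) cat" +
  assumes finite_Ob: "finite (Ob G)"
    and finite_Ar: "finite (Ar G)"
    and at_most_one_either_way:
      "i \<in> Ob G \<Longrightarrow> j \<in> Ob G \<Longrightarrow> f \<in> hom_set G i j \<union> hom_set G j i \<Longrightarrow>
       g \<in> hom_set G i j \<union> hom_set G j i \<Longrightarrow> f = g"
    and ex_minimal_common_ancestor:
      "i \<in> Ob G \<Longrightarrow> j \<in> Ob G \<Longrightarrow> \<exists>h. minimal_common_ancestor G i j h"

definition is_initial :: "('o, 'm) cat \<Rightarrow> 'o \<Rightarrow> bool" where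
  "is_initial G i \<longleftrightarrow> i \<in> Ob G \<and> (\<forall>j\<in>Ob G. \<exists>!f. f \<in> hom_set G i j)"

definition initial_obj :: "('o, 'm) cat \<Rightarrow> 'o" where
  "initial_obj G = (THE i. is_initial G i)"

text \<open>The unique morphism between two objects of an indexing category, when there is one.\<close>

definition arrow :: "('o, 'm) cat \<Rightarrow> 'o \<Rightarrow> 'o \<Rightarrow> 'm" where
  "arrow G i j = (THE f. f \<in> hom_set G i j)"

context indexing_category
begin

lemma antisym_ancestor:
  assumes "i \<in> Ob G" "j \<in> Ob G" "ancestor G i j" "ancestor G j i"
  shows "i = j"
proof -
  obtain f g where fg: "f \<in> hom_set G i j" "g \<in> hom_set G j i"
    using assms(3,4) by (auto simp: ancestor_def)
  have "f = g"
    by (rule at_most_one_either_way[OF assms(1,2)]) (simp_all add: fg)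
  moreover have "Dom G f = i" "Dom G g = j"
    using fg unfolding hom_set_def by blast+
  ultimately show ?thesis by metis
qed

lemma ancestor_trans: "ancestor G i j \<Longrightarrow> ancestor G j k \<Longrightarrow> ancestor G i k"
  unfolding ancestor_def using Cmp_hom by (metis ex_in_conv)

lemma ex_common_ancestor:
  assumes "finite A" "A \<noteq> {}" "A \<subseteq> Ob G"
  shows "\<exists>h\<in>Ob G. \<forall>a\<in>A. ancestor G h a"
  using assms
proof (induction rule: finite_ne_induct)
  case (singleton x)
  then have "ancestor G x x"
    using Idn_hom[of x] by (auto simp: ancestor_def)
  with singleton show ?case by blast
next
  case (insert x A)
  then obtain h where h: "h \<in> Ob G" "\<forall>a\<in>A. ancestor G h a" by auto
  obtain m where "minimal_common_ancestor G x h m"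
    using ex_minimal_common_ancestor[of x h] insert.prems h(1) by auto
  then have m: "m \<in> Ob G" "ancestor G m x" "ancestor G m h"
    by (simp_all add: minimal_common_ancestor_def)
  have "ancestor G m a" if "a \<in> A" for a
    using ancestor_trans[OF m(3), of a] h(2) that by simp
  with m show ?case by auto
qed

lemma ex1_initial:
  assumes "Ob G \<noteq> {}"
  shows "\<exists>!i. is_initial G i"
proof -
  obtain h where h: "h \<in> Ob G" "\<forall>a\<in>Ob G. ancestor G h a"
    using ex_common_ancestor[OF finite_Ob assms order_refl] by (elim bexE)
  have "\<exists>!f. f \<in> hom_set G h j" if j: "j \<in> Ob G" for j
  proof -
    obtain f where f: "f \<in> hom_set G h j"
      using h j unfolding ancestor_def by blast
    moreover have "g = f" if "g \<in> hom_set G h j" for g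
      by (rule at_most_one_either_way[OF h(1) j]) (simp_all add: f that)
    ultimately show ?thesis by (rule ex1I)
  qed
  with h have ini: "is_initial G h" by (simp add: is_initial_def)
  show ?thesis
  proof (rule ex1I[where P = "is_initial G", OF ini])
    fix i assume "is_initial G i"
    then have iO: "i \<in> Ob G" and "\<exists>!f. f \<in> hom_set G i h"
      using h(1) by (simp_all add: is_initial_def)
    then have "ancestor G i h"
      unfolding ancestor_def by blast
    with iO h show "i = h"
      using antisym_ancestor[of i h] by blast
  qed
qed

lemma initial_obj: "Ob G \<noteq> {} \<Longrightarrow> is_initial G (initial_obj G)"
  unfolding initial_obj_def by (rule theI'[OF ex1_initial])

lemma arrow_eq:
  assumes "f \<in> hom_set G i j"
  shows "arrow G i j = f"
  unfolding arrow_def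
proof (rule the_equality[where P = "\<lambda>f. f \<in> hom_set G i j", OF assms])
  fix g assume g: "g \<in> hom_set G i j"
  have "i \<in> Ob G" "j \<in> Ob G"
    using assms Dom_Ob Cod_Ob unfolding hom_set_def by blast+
  then show "g = f"
    by (rule at_most_one_either_way) (simp_all add: assms g)
qed

end


section \<open>Diagrams of finite probability spaces\<close>

text \<open>
  A finite probability space is a finitely supported \<open>pmf\<close>; its atoms are the points of
  \<open>set_pmf\<close>. All spaces of one diagram live on one type \<open>'a\<close>, which is no restriction since only
  the supports matter. Maps are given by representatives, so all equations between maps,
  including functoriality, are required almost everywhere only.
\<close>

record ('o, 'm, 'a) diagram =
  Sp :: "'o \<Rightarrow> 'a pmf"
  Mp :: "'m \<Rightarrow> 'a \<Rightarrow> 'a"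

definition is_diagram :: "('o, 'm) cat \<Rightarrow> ('o, 'm, 'a) diagram \<Rightarrow> bool" where
  "is_diagram G X \<longleftrightarrow>
     (\<forall>i\<in>Ob G. finite (set_pmf (Sp X i))) \<and>
     (\<forall>f\<in>Ar G. map_pmf (Mp X f) (Sp X (Dom G f)) = Sp X (Cod G f)) \<and>
     (\<forall>i\<in>Ob G. AE x in Sp X i. Mp X (Idn G i) x = x) \<and>
     (\<forall>i j k f g. f \<in> hom_set G i j \<longrightarrow> g \<in> hom_set G j k \<longrightarrow>
        (AE x in Sp X i. Mp X (Cmp G g f) x = Mp X g (Mp X f x)))"

definition is_reduction ::
  "('o, 'm) cat \<Rightarrow> ('o, 'm, 'a) diagram \<Rightarrow> ('o, 'm, 'b) diagram \<Rightarrow> ('o \<Rightarrow> 'a \<Rightarrow> 'b) \<Rightarrow> bool" where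
  "is_reduction G X Y r \<longleftrightarrow>
     (\<forall>i\<in>Ob G. map_pmf (r i) (Sp X i) = Sp Y i) \<and>
     (\<forall>f\<in>Ar G. AE x in Sp X (Dom G f).
        r (Cod G f) (Mp X f x) = Mp Y f (r (Dom G f) x))"

text \<open>
  Points of the product over \<open>J\<close> are functions with the value \<open>undefined\<close> outside \<open>J\<close>, in agreement
  with \<open>restrict\<close>. The set \<open>J\<close> has to be finite.
\<close>

definition tensor :: "'j set \<Rightarrow> ('j \<Rightarrow> ('o, 'm, 'a) diagram) \<Rightarrow> ('o, 'm, 'j \<Rightarrow> 'a) diagram" where
  "tensor J D =
     \<lparr> Sp = (\<lambda>i. Pi_pmf J undefined (\<lambda>j. Sp (D j) i)),
       Mp = (\<lambda>f x. restrict (\<lambda>j. Mp (D j) f (x j)) J) \<rparr>"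

definition tensor_power :: "('o, 'm, 'a) diagram \<Rightarrow> nat \<Rightarrow> ('o, 'm, nat \<Rightarrow> 'a) diagram" where
  "tensor_power X n = tensor {..<n} (\<lambda>_. X)"

definition cond_initial ::
  "('o, 'm) cat \<Rightarrow> ('o, 'm, 'a) diagram \<Rightarrow> 'o \<Rightarrow> 'a \<Rightarrow> 'a pmf" where
  "cond_initial G X \<iota> u =
     cond_pmf (Sp X (initial_obj G)) (Mp X (arrow G (initial_obj G) \<iota>) -` {u})"

text \<open>
  Conditioning on an atom \<open>u\<close> of \<open>Sp X \<iota>\<close>. At the initial object itself the push-forward is
  along an identity, so the space there is \<open>cond_initial G X \<iota> u\<close>.
\<close>

definition cond_diagram ::
  "('o, 'm) cat \<Rightarrow> ('o, 'm, 'a) diagram \<Rightarrow> 'o \<Rightarrow> 'a \<Rightarrow> ('o, 'm, 'a) diagram" where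
  "cond_diagram G X \<iota> u =
     \<lparr> Sp = (\<lambda>j. map_pmf (Mp X (arrow G (initial_obj G) j)) (cond_initial G X \<iota> u)),
       Mp = Mp X \<rparr>"


section \<open>Entropy distances\<close>

definition Ent :: "'a pmf \<Rightarrow> real" where
  "Ent p = - (\<Sum>x\<in>set_pmf p. pmf p x * ln (pmf p x))"

definition is_fan ::
  "('o, 'm) cat \<Rightarrow> ('o, 'm, 'a) diagram \<Rightarrow> ('o, 'm, 'b) diagram \<Rightarrow> ('o, 'm, 'c) diagram \<Rightarrow>
   ('o \<Rightarrow> 'c \<Rightarrow> 'a) \<Rightarrow> ('o \<Rightarrow> 'c \<Rightarrow> 'b) \<Rightarrow> bool" where
  "is_fan G X Y Z r s \<longleftrightarrow> is_diagram G Z \<and> is_reduction G Z X r \<and> is_reduction G Z Y s"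

definition kd ::
  "('o, 'm) cat \<Rightarrow> ('o, 'm, 'a) diagram \<Rightarrow> ('o, 'm, 'b) diagram \<Rightarrow> ('o, 'm, 'c) diagram \<Rightarrow> real" where
  "kd G X Y Z =
     (\<Sum>i\<in>Ob G. \<bar>Ent (Sp Z i) - Ent (Sp X i)\<bar>) + (\<Sum>i\<in>Ob G. \<bar>Ent (Sp Z i) - Ent (Sp Y i)\<bar>)"

text \<open>
  The infimum runs over fans whose top diagram lives on \<open>nat\<close>. Every diagram of finite
  probability spaces is isomorphic to such a diagram, so this is the infimum over all fans;
  see lemma \<open>fan_on_nat\<close> below.
\<close>

definition entropy_dist ::
  "('o, 'm) cat \<Rightarrow> ('o, 'm, 'a) diagram \<Rightarrow> ('o, 'm, 'b) diagram \<Rightarrow> real" where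
  "entropy_dist G X Y = Inf {kd G X Y Z | (Z :: ('o, 'm, nat) diagram) r s. is_fan G X Y Z r s}"

lemma Ent_map_inj: "inj_on e (set_pmf p) \<Longrightarrow> Ent (map_pmf e p) = Ent p"
  unfolding Ent_def set_map_pmf by (subst sum.reindex) (auto simp: pmf_map_inj)

lemma (in small_category) fan_on_nat:
  fixes Z :: "('o, 'm, 'c) diagram"
  assumes fin: "finite (Ob G)" and fan: "is_fan G X Y Z r s"
  shows "\<exists>(Z' :: ('o, 'm, nat) diagram) r' s'. is_fan G X Y Z' r' s' \<and> kd G X Y Z' = kd G X Y Z"
proof -
  define S where "S = (\<Union>i\<in>Ob G. set_pmf (Sp Z i))"
  have Z: "is_diagram G Z" "is_reduction G Z X r" "is_reduction G Z Y s"
    using fan by (auto simp: is_fan_def)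
  have finZ: "finite (set_pmf (Sp Z i))" if "i \<in> Ob G" for i
    using Z(1) that unfolding is_diagram_def by blast
  have mapZ: "map_pmf (Mp Z f) (Sp Z (Dom G f)) = Sp Z (Cod G f)" if "f \<in> Ar G" for f
    using Z(1) that unfolding is_diagram_def by blast
  have idZ: "AE x in Sp Z i. Mp Z (Idn G i) x = x" if "i \<in> Ob G" for i
    using Z(1) that unfolding is_diagram_def by blast
  have "finite S"
    using fin finZ by (auto simp: S_def)
  then obtain e :: "'c \<Rightarrow> nat" where e: "inj_on e S"
    using finite_imp_inj_to_nat_seg by blast
  define d where "d = inv_into S e"
  have de: "d (e x) = x" if "x \<in> S" for x
    using e that by (simp add: d_def)
  have sub: "x \<in> S" if "x \<in> set_pmf (Sp Z i)" "i \<in> Ob G" for x i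
    using that by (auto simp: S_def)
  have mp: "Mp Z f x \<in> S" if "f \<in> Ar G" "x \<in> set_pmf (Sp Z (Dom G f))" for f x
  proof -
    have "set_pmf (Sp Z (Cod G f)) = Mp Z f ` set_pmf (Sp Z (Dom G f))"
      unfolding mapZ[OF that(1), symmetric] by (rule set_map_pmf)
    with that show ?thesis
      using sub[OF _ Cod_Ob] by auto
  qed
  define Z' :: "('o, 'm, nat) diagram" where
    "Z' = \<lparr> Sp = (\<lambda>i. map_pmf e (Sp Z i)), Mp = (\<lambda>f x. e (Mp Z f (d x))) \<rparr>"
  have diag: "is_diagram G Z'"
    unfolding is_diagram_def
  proof (intro conjI ballI allI impI)
    fix i assume "i \<in> Ob G"
    then show "finite (set_pmf (Sp Z' i))"
      using finZ by (simp add: Z'_def)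
    show "AE x in Sp Z' i. Mp Z' (Idn G i) x = x"
      using idZ[OF \<open>i \<in> Ob G\<close>] \<open>i \<in> Ob G\<close> by (auto simp: Z'_def AE_measure_pmf_iff de sub)
  next
    fix f assume f: "f \<in> Ar G"
    have "map_pmf (Mp Z' f) (Sp Z' (Dom G f)) = map_pmf (\<lambda>x. e (Mp Z f x)) (Sp Z (Dom G f))"
      using sub[OF _ Dom_Ob[OF f]]
      by (auto simp: Z'_def map_pmf_comp de intro!: map_pmf_cong)
    also have "\<dots> = map_pmf e (map_pmf (Mp Z f) (Sp Z (Dom G f)))"
      by (simp add: map_pmf_comp)
    also have "\<dots> = Sp Z' (Cod G f)"
      by (simp add: mapZ[OF f] Z'_def)
    finally show "map_pmf (Mp Z' f) (Sp Z' (Dom G f)) = Sp Z' (Cod G f)" .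
  next
    fix i j k f g assume fg: "f \<in> hom_set G i j" "g \<in> hom_set G j k"
    then have "f \<in> Ar G" "Dom G f = i" "i \<in> Ob G"
      by (auto simp: hom_set_def Dom_Ob)
    moreover have "AE x in Sp Z i. Mp Z (Cmp G g f) x = Mp Z g (Mp Z f x)"
      using Z(1) fg unfolding is_diagram_def by blast
    ultimately show "AE x in Sp Z' i. Mp Z' (Cmp G g f) x = Mp Z' g (Mp Z' f x)"
      by (auto simp: Z'_def AE_measure_pmf_iff de sub mp)
  qed
  have red: "is_reduction G Z' W (\<lambda>i x. t i (d x))" if t: "is_reduction G Z W t"
    for W :: "('o, 'm, 'w) diagram" and t
    unfolding is_reduction_def
  proof (intro conjI ballI)
    fix i assume i: "i \<in> Ob G"
    have "map_pmf (\<lambda>x. t i (d x)) (Sp Z' i) = map_pmf (\<lambda>x. t i (d (e x))) (Sp Z i)"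
      by (simp add: Z'_def map_pmf_comp)
    also have "\<dots> = map_pmf (t i) (Sp Z i)"
      by (rule map_pmf_cong) (auto simp: de sub i)
    also have "\<dots> = Sp W i"
      using t i by (simp add: is_reduction_def)
    finally show "map_pmf (\<lambda>x. t i (d x)) (Sp Z' i) = Sp W i" .
  next
    fix f assume f: "f \<in> Ar G"
    then have "AE x in Sp Z (Dom G f). t (Cod G f) (Mp Z f x) = Mp W f (t (Dom G f) x)"
      using t by (simp add: is_reduction_def)
    then show "AE x in Sp Z' (Dom G f). t (Cod G f) (d (Mp Z' f x)) = Mp W f (t (Dom G f) (d x))"
      using f sub[OF _ Dom_Ob[OF f]] by (auto simp: Z'_def AE_measure_pmf_iff de mp)
  qed
  have "is_fan G X Y Z' (\<lambda>i x. r i (d x)) (\<lambda>i x. s i (d x))"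
    using diag red[OF Z(2)] red[OF Z(3)] by (simp add: is_fan_def)
  moreover have "Ent (Sp Z' i) = Ent (Sp Z i)" if "i \<in> Ob G" for i
    unfolding Z'_def using that by (auto intro!: Ent_map_inj inj_on_subset[OF e] simp: sub)
  then have "kd G X Y Z' = kd G X Y Z"
    by (simp add: kd_def)
  ultimately show ?thesis by blast
qed

text \<open>
  The limit exists for the sequences used here: their distances are subadditive in \<open>n\<close>, up to a
  bounded defect caused by the floors in \<open>trop_cond\<close>. The term at \<open>n = 0\<close> is irrelevant.
\<close>

definition asymp_dist ::
  "('o, 'm) cat \<Rightarrow> (nat \<Rightarrow> ('o, 'm, 'a) diagram) \<Rightarrow> (nat \<Rightarrow> ('o, 'm, 'b) diagram) \<Rightarrow> real" where
  "asymp_dist G A B = lim (\<lambda>n. entropy_dist G (A n) (B n) / real n)"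

definition asymp_entropy_dist ::
  "('o, 'm) cat \<Rightarrow> ('o, 'm, 'a) diagram \<Rightarrow> ('o, 'm, 'b) diagram \<Rightarrow> real" where
  "asymp_entropy_dist G X Y = asymp_dist G (tensor_power X) (tensor_power Y)"

text \<open>
  The sequence representing the tropical diagram \<open>[X|U]\<close>, where \<open>U = Sp X \<iota>\<close>: its \<open>n\<close>-th term is
  the tensor product over the atoms \<open>u\<close> of \<open>U\<close> of the \<open>\<lfloor>n p(u)\<rfloor>\<close>-th powers of \<open>X|u\<close>.
\<close>

definition trop_cond ::
  "('o, 'm) cat \<Rightarrow> ('o, 'm, 'a) diagram \<Rightarrow> 'o \<Rightarrow> nat \<Rightarrow> ('o, 'm, 'a \<Rightarrow> nat \<Rightarrow> 'a) diagram" where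
  "trop_cond G X \<iota> n =
     tensor (set_pmf (Sp X \<iota>))
       (\<lambda>u. tensor_power (cond_diagram G X \<iota> u) (nat \<lfloor>real n * pmf (Sp X \<iota>) u\<rfloor>))"

end

theory Submission
  imports Defs "HOL-Real_Asymp.Real_Asymp"
begin

text \<open>
  Let \<open>Z\<close> be the top of a fan over \<open>X\<close> and \<open>Y\<close>, let \<open>W = Z\<^sub>\<iota>\<close>, and take the sequences of atoms
  \<open>u\<^sub>j\<close> of \<open>U\<close> and \<open>v\<^sub>j\<close> of \<open>V\<close> that label the factors of the \<open>n\<close>-th terms of \<open>[X|U]\<close> and \<open>[Y|V]\<close>.
  Lift each label to a random atom of \<open>W\<close>, independently and with the conditional law. Given the lifts
  \<open>s\<close> and \<open>t\<close>, both terms become tensor products of images of the \<open>Z|w\<close>, and since \<open>s\<close> and \<open>t\<close>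
  both contain \<open>w\<close> about \<open>n p(w)\<close> times, they are reductions of a common tensor product of about
  \<open>n p(w)\<close> copies of each \<open>Z|w\<close>, with a mean error of order \<open>\<surd>n\<close>. Mixing these fans over \<open>s\<close> and \<open>t\<close>
  costs twice the entropy \<open>n (H(W|U) + H(W|V)) \<le> n kd\<close> of the lifts at each object, and the fans themselves
  cost at most \<open>n kd\<close>, because \<open>H(Z\<^sub>i|W) - H(X\<^sub>i|U) \<le> H(Z\<^sub>i) - H(X\<^sub>i)\<close> by data processing. This
  gives \<open>(2|G| + 1) kd\<close> per factor. The asymptotic bound results from fans over \<open>X\<^sup>N\<close> and \<open>Y\<^sup>N\<close>, as
  \<open>[X\<^sup>N|U\<^sup>N]\<close> is \<open>N [X|U]\<close> up to bounded errors from the floors.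
\<close>

section \<open>Entropy\<close>

text \<open>The obstacle is that a fan does not restrict to conditioned diagrams. For an atom
  \<open>w\<close> above \<open>u\<close>, the image of \<open>Z|w\<close> in \<open>X\<close> has
  in general another law than \<open>X|u\<close>; only its average over the atoms above
  \<open>u\<close> is \<open>X|u\<close>. Hence the terms must be treated as mixtures, and the top
  of the resulting fan has to remember the mixing variable at every object. This is the source of
  \<open>|G|\<close>, and the factor 2 appears because the distance compares the top with both feet.
  Each realisation of the lifts needs an exact pair of reductions, so the common product carries the
  maximum of the two counts of every \<open>w\<close>. An error of order \<open>sqrt n\<close> in
  the mean suffices, since it is multiplied by fixed entropies and divided by \<open>n\<close>.
  Floors never cause more than a number of surplus factors independent of \<open>n\<close>, and
  surplus factors are coupled independently at the price of their entropy. The argument compares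
  total entropies throughout, so instead of isomorphisms of diagrams it uses reductions that
  preserve total entropy.\<close>

lemma Ent_expectation:
  "finite (set_pmf p) \<Longrightarrow> Ent p = - measure_pmf.expectation p (\<lambda>x. ln (pmf p x))"
  unfolding Ent_def by (subst integral_measure_pmf_real[of "set_pmf p"]) (auto simp: mult.commute)

lemma Ent_map_expectation:
  assumes "finite (set_pmf p)"
  shows "Ent (map_pmf f p) = - measure_pmf.expectation p (\<lambda>x. ln (pmf (map_pmf f p) (f x)))"
  using assms by (subst Ent_expectation) auto

lemma expectation_mono_finite:
  fixes f g :: "'a \<Rightarrow> real"
  assumes "finite (set_pmf p)" "\<And>x. x \<in> set_pmf p \<Longrightarrow> f x \<le> g x"
  shows "measure_pmf.expectation p f \<le> measure_pmf.expectation p g"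
  using assms by (intro integral_mono_AE integrable_measure_pmf_finite) (auto simp: AE_measure_pmf_iff)

lemma expectation_cong_pmf:
  fixes f g :: "'a \<Rightarrow> real"
  assumes "\<And>x. x \<in> set_pmf p \<Longrightarrow> f x = g x"
  shows "measure_pmf.expectation p f = measure_pmf.expectation p g"
  using assms by (intro integral_cong_AE) (auto simp: AE_measure_pmf_iff)

lemma expectation_bind_finite:
  fixes h :: "'b \<Rightarrow> real"
  assumes "finite (set_pmf p)" "\<And>x. x \<in> set_pmf p \<Longrightarrow> finite (set_pmf (f x))"
  shows "measure_pmf.expectation (bind_pmf p f) h =
         (\<Sum>a\<in>set_pmf p. pmf p a * measure_pmf.expectation (f a) h)"
  using pmf_expectation_bind[of "set_pmf p" f p h] assms by simp

lemma pmf_le_pmf_map: "pmf p x \<le> pmf (map_pmf f p) (f x)"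
  by (subst pmf_map, subst measure_pmf_single[symmetric]) (auto intro: measure_pmf.finite_measure_mono)

lemma Ent_nonneg: "0 \<le> Ent p"
  unfolding Ent_def
  by (simp, intro sum_nonpos mult_nonneg_nonpos) (auto simp: pmf_le_1 pmf_positive)

text \<open>Both entropies are expectations over the same \<open>p\<close>, so it suffices that a
  fibre weighs at least as much as any of its points.\<close>

lemma Ent_map_le:
  assumes "finite (set_pmf p)"
  shows "Ent (map_pmf f p) \<le> Ent p"
  unfolding Ent_map_expectation[OF assms] Ent_expectation[OF assms] neg_le_iff_le
  by (rule expectation_mono_finite[OF assms])
    (smt (verit) ln_mono pmf_le_pmf_map pmf_positive)

text \<open>The chain rule for entropy. Since \<open>s\<close> is stored in the pair, the weights
  are plain products and no two branches overlap.\<close>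

lemma Ent_bind_pair:
  assumes fin: "finite (set_pmf p)" "\<And>s. s \<in> set_pmf p \<Longrightarrow> finite (set_pmf (q s))"
  shows "Ent (bind_pmf p (\<lambda>s. map_pmf (Pair s) (q s))) =
         Ent p + (\<Sum>s\<in>set_pmf p. pmf p s * Ent (q s))"
proof -
  let ?b = "bind_pmf p (\<lambda>s. map_pmf (Pair s) (q s))"
  have pmf_b: "pmf ?b (s, z) = pmf p s * pmf (q s) z" for s z
  proof -
    have "pmf (map_pmf (Pair t) (q t)) (s, z) = indicator {s} t * pmf (q s) z" for t
      by (cases "s = t")
        (auto simp: pmf_map_inj' inj_on_def pmf_eq_0_set_pmf)
    then have "pmf ?b (s, z) = measure_pmf.expectation p (\<lambda>t. indicator {s} t * pmf (q s) z)"
      by (simp add: pmf_bind)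
    also have "\<dots> = pmf p s * pmf (q s) z"
      by (simp add: measure_pmf_single)
    finally show ?thesis .
  qed
  have "Ent ?b = - measure_pmf.expectation ?b (\<lambda>x. ln (pmf ?b x))"
    by (rule Ent_expectation) (use fin in auto)
  also have "\<dots> = - (\<Sum>s\<in>set_pmf p. pmf p s * measure_pmf.expectation (q s) (\<lambda>z. ln (pmf ?b (s, z))))"
    by (subst expectation_bind_finite) (use fin in auto)
  also have "\<dots> = - (\<Sum>s\<in>set_pmf p. pmf p s * (ln (pmf p s) - Ent (q s)))"
  proof (intro arg_cong[where f = uminus] sum.cong refl arg_cong2[where f = "(*)"])
    fix s assume s: "s \<in> set_pmf p"
    have "measure_pmf.expectation (q s) (\<lambda>z. ln (pmf ?b (s, z))) =
          measure_pmf.expectation (q s) (\<lambda>z. ln (pmf p s) + ln (pmf (q s) z))"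
      by (rule expectation_cong_pmf)
        (use s in \<open>auto simp: pmf_b ln_mult pmf_positive pmf_eq_0_set_pmf\<close>)
    also have "\<dots> = ln (pmf p s) + measure_pmf.expectation (q s) (\<lambda>z. ln (pmf (q s) z))"
      using fin(2)[OF s] by (subst Bochner_Integration.integral_add) (auto intro: integrable_measure_pmf_finite)
    also have "\<dots> = ln (pmf p s) - Ent (q s)"
      using fin(2)[OF s] by (simp add: Ent_expectation)
    finally show "measure_pmf.expectation (q s) (\<lambda>z. ln (pmf ?b (s, z))) = ln (pmf p s) - Ent (q s)" .
  qed
  also have "\<dots> = Ent p + (\<Sum>s\<in>set_pmf p. pmf p s * Ent (q s))"
    by (simp add: Ent_def algebra_simps sum_subtractf sum.distrib sum_negf)
  finally show ?thesis .
qed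

lemma Ent_pair_pmf:
  assumes "finite (set_pmf p)" "finite (set_pmf q)"
  shows "Ent (pair_pmf p q) = Ent p + Ent q"
proof -
  have "pair_pmf p q = bind_pmf p (\<lambda>s. map_pmf (Pair s) q)"
    by (simp add: pair_pmf_def map_pmf_def)
  then show ?thesis
    using assms by (simp add: Ent_bind_pair sum_distrib_right[symmetric] sum_pmf_eq_1)
qed

lemma Ent_return_pmf [simp]: "Ent (return_pmf x) = 0"
  by (simp add: Ent_def)

lemma finite_set_Pi_pmf:
  assumes "finite J" "\<And>j. j \<in> J \<Longrightarrow> finite (set_pmf (p j))"
  shows "finite (set_pmf (Pi_pmf J d p))"
  using assms by (simp add: set_Pi_pmf finite_PiE_dflt)

lemma Ent_Pi_pmf:
  assumes "finite J" "\<And>j. j \<in> J \<Longrightarrow> finite (set_pmf (p j))"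
  shows "Ent (Pi_pmf J d p) = (\<Sum>j\<in>J. Ent (p j))"
  using assms
proof (induction J rule: finite_induct)
  case (insert j J)
  \<comment> \<open>On the support \<open>f\<close> takes the default \<open>d\<close> at
    \<open>j\<close>, so the update at \<open>j\<close> overwrites no information.\<close>
  have "inj_on (\<lambda>(y, f). f(j := y)) (set_pmf (pair_pmf (p j) (Pi_pmf J d p)))"
    using insert.hyps by (auto simp: inj_on_def set_Pi_pmf PiE_dflt_def fun_eq_iff)
  then show ?case
    using insert by (simp add: Pi_pmf_insert Ent_map_inj Ent_pair_pmf finite_set_Pi_pmf)
qed simp

text \<open>The data processing inequality for relative entropy, from \<open>ln y \<ge> 1 - 1 / y\<close>.\<close>

lemma relative_entropy_map_le:
  assumes fin: "finite (set_pmf q)" and sub: "set_pmf p \<subseteq> set_pmf q"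
  shows "measure_pmf.expectation (map_pmf f p) (\<lambda>y. ln (pmf (map_pmf f p) y / pmf (map_pmf f q) y))
       \<le> measure_pmf.expectation p (\<lambda>x. ln (pmf p x / pmf q x))"
proof -
  let ?p = "map_pmf f p" and ?q = "map_pmf f q"
  have finp: "finite (set_pmf p)" using fin sub finite_subset by blast
  let ?r = "\<lambda>x. pmf ?p (f x) / pmf ?q (f x)"
  \<comment> \<open>The difference of the two relative entropies is at least 1 minus the expectation
    of \<open>(q/p) * ?r\<close>, so what remains is to bound that expectation by 1.\<close>
  have "measure_pmf.expectation p (\<lambda>x. 1 - pmf q x / pmf p x * ?r x) \<le>
        measure_pmf.expectation p (\<lambda>x. ln (pmf p x / pmf q x) - ln (?r x))"
  proof (rule expectation_mono_finite[OF finp])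
    fix x assume x: "x \<in> set_pmf p"
    have pos: "pmf p x > 0" "pmf q x > 0" "pmf ?p (f x) > 0" "pmf ?q (f x) > 0"
      using x sub by (auto simp: pmf_positive_iff)
    let ?y = "pmf q x / pmf p x * ?r x"
    have "ln ?y \<le> ?y - 1"
      by (rule ln_le_minus_one) (use pos in simp)
    moreover have "ln ?y = - ln (pmf p x / pmf q x) + ln (?r x)"
      using pos by (simp add: ln_mult ln_div)
    ultimately show "1 - ?y \<le> ln (pmf p x / pmf q x) - ln (?r x)" by linarith
  qed
  moreover have "measure_pmf.expectation p (\<lambda>x. pmf q x / pmf p x * ?r x) \<le> 1"
  proof -
    have "measure_pmf.expectation p (\<lambda>x. pmf q x / pmf p x * ?r x) =
          (\<Sum>x\<in>set_pmf p. pmf q x / pmf p x * ?r x * pmf p x)"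
      by (rule integral_measure_pmf_real[OF finp]) auto
    also have "\<dots> = (\<Sum>x\<in>set_pmf p. ?r x * pmf q x)"
      by (intro sum.cong) (auto simp: pmf_eq_0_set_pmf)
    also have "\<dots> \<le> (\<Sum>x\<in>set_pmf q. ?r x * pmf q x)"
      using fin sub by (intro sum_mono2) auto
    \<comment> \<open>The weight \<open>?r\<close> depends on \<open>f x\<close> only. Under the
      image of \<open>q\<close> its denominator cancels and leaves mass of the image of
      \<open>p\<close>.\<close>
    also have "\<dots> = measure_pmf.expectation ?q (\<lambda>y. pmf ?p y / pmf ?q y)"
      unfolding integral_map_pmf by (rule integral_measure_pmf_real[OF fin, symmetric]) auto
    also have "\<dots> = (\<Sum>y\<in>set_pmf ?q. pmf ?p y / pmf ?q y * pmf ?q y)"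
      by (rule integral_measure_pmf_real) (use fin in auto)
    also have "\<dots> = (\<Sum>y\<in>set_pmf ?q. pmf ?p y)"
      by (intro sum.cong refl) (metis nonzero_eq_divide_eq pmf_eq_0_set_pmf)
    also have "\<dots> \<le> 1"
      using fin by (simp add: sum_pmf_eq_1 image_mono sub)
    finally show ?thesis .
  qed
  ultimately show ?thesis
    using finp by (simp add: integrable_measure_pmf_finite)
qed

section \<open>Mutual information and conditional entropy\<close>

definition mutual_info :: "'c pmf \<Rightarrow> ('c \<Rightarrow> 'a) \<Rightarrow> ('c \<Rightarrow> 'b) \<Rightarrow> real" where
  "mutual_info p f g =
     Ent (map_pmf f p) + Ent (map_pmf g p) - Ent (map_pmf (\<lambda>x. (f x, g x)) p)"

lemma mutual_info_relative_entropy: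
  fixes f :: "'c \<Rightarrow> 'a" and g :: "'c \<Rightarrow> 'b"
  assumes fin: "finite (set_pmf p)"
  defines "j \<equiv> map_pmf (\<lambda>x. (f x, g x)) p" and "q \<equiv> pair_pmf (map_pmf f p) (map_pmf g p)"
  shows "mutual_info p f g = measure_pmf.expectation j (\<lambda>y. ln (pmf j y / pmf q y))"
proof -
  have "measure_pmf.expectation j (\<lambda>y. ln (pmf j y / pmf q y)) =
    measure_pmf.expectation p (\<lambda>x. ln (pmf j (f x, g x)) -
      (ln (pmf (map_pmf f p) (f x)) + ln (pmf (map_pmf g p) (g x))))"
    unfolding j_def integral_map_pmf
    by (rule expectation_cong_pmf)
      (auto simp: q_def pmf_pair ln_div ln_mult pmf_positive_iff pmf_eq_0_set_pmf)
  also have "\<dots> = mutual_info p f g"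
    using fin by (simp add: mutual_info_def Ent_map_expectation j_def integrable_measure_pmf_finite)
  finally show ?thesis ..
qed

text \<open>The map \<open>map_prod h k\<close> pushes forward both the joint law and the product of
  the marginals, so data processing for relative entropy applies.\<close>

lemma mutual_info_comp_le:
  assumes fin: "finite (set_pmf p)"
  shows "mutual_info p (\<lambda>x. h (f x)) (\<lambda>x. k (g x)) \<le> mutual_info p f g"
proof -
  let ?j = "map_pmf (\<lambda>x. (f x, g x)) p" and ?q = "pair_pmf (map_pmf f p) (map_pmf g p)"
  have "map_pmf (map_prod h k) ?q = pair_pmf (map_pmf (\<lambda>x. h (f x)) p) (map_pmf (\<lambda>x. k (g x)) p)"
    using map_pair[of h k "map_pmf f p" "map_pmf g p"] by (simp add: map_prod_def map_pmf_comp)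
  moreover have "map_pmf (map_prod h k) ?j = map_pmf (\<lambda>x. (h (f x), k (g x))) p"
    by (simp add: map_pmf_comp)
  ultimately show ?thesis
    using relative_entropy_map_le[of ?q ?j "map_prod h k"] fin
    by (auto simp: mutual_info_relative_entropy)
qed

lemma bind_cond_pmf_vimage:
  "bind_pmf (map_pmf b p) (\<lambda>w. cond_pmf p (b -` {w})) = p"
proof -
  have "bind_pmf (map_pmf b p) (\<lambda>w. cond_pmf p {y. b y = w}) = p"
    by (rule bind_cond_pmf_cancel) (auto simp: vimage_def intro!: arg_cong[where f = "measure _"])
  then show ?thesis by (simp add: vimage_def)
qed

text \<open>Conditional entropy \<open>H(a|b)\<close>, written as an average over fibres because
  this is the form in which conditioned diagrams produce it.\<close>

definition cond_ent :: "'c pmf \<Rightarrow> ('c \<Rightarrow> 'a) \<Rightarrow> ('c \<Rightarrow> 'b) \<Rightarrow> real" where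
  "cond_ent p a b =
     (\<Sum>w\<in>set_pmf (map_pmf b p). pmf (map_pmf b p) w * Ent (map_pmf a (cond_pmf p (b -` {w}))))"

text \<open>The chain rule with \<open>b\<close> as the mixing variable; swapping the components is
  injective and keeps the entropy.\<close>

lemma cond_ent_eq:
  assumes "finite (set_pmf p)"
  shows "cond_ent p a b = Ent (map_pmf (\<lambda>x. (a x, b x)) p) - Ent (map_pmf b p)"
proof -
  have ne: "set_pmf p \<inter> b -` {w} \<noteq> {}" if "w \<in> set_pmf (map_pmf b p)" for w
    using that by auto
  have "map_pmf (\<lambda>x. (b x, a x)) p =
        bind_pmf (map_pmf b p) (\<lambda>w. map_pmf (\<lambda>x. (b x, a x)) (cond_pmf p (b -` {w})))"
    by (subst bind_cond_pmf_vimage[of b p, symmetric]) (simp only: map_bind_pmf)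
  also have "\<dots> = bind_pmf (map_pmf b p) (\<lambda>w. map_pmf (Pair w) (map_pmf a (cond_pmf p (b -` {w}))))"
    unfolding map_pmf_comp by (intro bind_pmf_cong map_pmf_cong refl) (auto simp: ne)
  finally have "Ent (map_pmf (\<lambda>x. (b x, a x)) p) = Ent (map_pmf b p) + cond_ent p a b"
    unfolding cond_ent_def
    by (simp only:, subst Ent_bind_pair) (use assms ne in auto)
  moreover have "Ent (map_pmf (\<lambda>x. (a x, b x)) p) = Ent (map_pmf prod.swap (map_pmf (\<lambda>x. (b x, a x)) p))"
    by (simp add: map_pmf_comp)
  ultimately show ?thesis
    by (simp add: Ent_map_inj)
qed

text \<open>This is \<open>I(h(a); k(b)) \<le> I(a; b)\<close> rewritten in terms of conditional entropies.\<close>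

lemma cond_ent_diff_le:
  assumes "finite (set_pmf p)"
  shows "cond_ent p a b - cond_ent p (\<lambda>x. h (a x)) (\<lambda>x. k (b x)) \<le>
         Ent (map_pmf a p) - Ent (map_pmf (\<lambda>x. h (a x)) p)"
  using mutual_info_comp_le[OF assms, of h a k b] assms by (simp add: mutual_info_def cond_ent_eq)

text \<open>Adjoining \<open>k (b x)\<close>, a function of \<open>b x\<close>, to
  \<open>b x\<close> adds no entropy. It serves for the quotient \<open>U\<close> of
  \<open>W\<close>.\<close>

lemma cond_ent_refine:
  assumes "finite (set_pmf p)"
  shows "cond_ent p b (\<lambda>x. k (b x)) = Ent (map_pmf b p) - Ent (map_pmf (\<lambda>x. k (b x)) p)"
proof -
  have "map_pmf (\<lambda>x. (b x, k (b x))) p = map_pmf (\<lambda>y. (y, k y)) (map_pmf b p)"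
    by (simp add: map_pmf_comp)
  moreover have "Ent (map_pmf (\<lambda>y. (y, k y)) (map_pmf b p)) = Ent (map_pmf b p)"
    by (rule Ent_map_inj) (auto simp: inj_on_def)
  ultimately show ?thesis
    using assms by (simp add: cond_ent_eq)
qed

section \<open>Reductions between tensor products\<close>

text \<open>Functions of disjoint blocks of independent coordinates are independent. The blocks need
  not cover \<open>K\<close>; unread coordinates are integrated out. Every push-forward between
  tensor products below rests on this.\<close>

lemma Pi_pmf_blocks:
  assumes "finite J" "finite K" "\<And>j. j \<in> J \<Longrightarrow> B j \<subseteq> K" "disjoint_family_on B J"
    and dep: "\<And>j x y. j \<in> J \<Longrightarrow> (\<And>k. k \<in> B j \<Longrightarrow> x k = y k) \<Longrightarrow> g j x = g j y"
    and law: "\<And>j. j \<in> J \<Longrightarrow> map_pmf (g j) (Pi_pmf (B j) d p) = q j"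
  shows "map_pmf (\<lambda>x j. if j \<in> J then g j x else d') (Pi_pmf K d p) = Pi_pmf J d' q"
  using assms
proof (induction J arbitrary: K rule: finite_induct)
  case (insert i J)
  let ?R = "K - B i"
  have K: "B i \<subseteq> K" "finite K" using insert.prems(1,2) by auto
  then have fin: "finite (B i)" "finite ?R" by (auto intro: finite_subset)
  have dis: "B j \<inter> B i = {}" if "j \<in> J" for j
    using insert.prems(3) insert.hyps(2) that by (auto simp: disjoint_family_on_def)
  have IH: "map_pmf (\<lambda>x j. if j \<in> J then g j x else d') (Pi_pmf ?R d p) = Pi_pmf J d' q"
  proof (rule insert.IH)
    show "B j \<subseteq> ?R" if "j \<in> J" for j using insert.prems(2)[of j] dis[OF that] that by auto
    show "disjoint_family_on B J" using insert.prems(3) by (auto simp: disjoint_family_on_def)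
    show "g j x = g j y" if "j \<in> J" "\<And>k. k \<in> B j \<Longrightarrow> x k = y k" for j x y
      by (rule insert.prems(4)) (use that in auto)
    show "map_pmf (g j) (Pi_pmf (B j) d p) = q j" if "j \<in> J" for j
      by (rule insert.prems(5)) (use that in auto)
  qed (rule fin)
  have eq: "(\<lambda>j. if j \<in> insert i J then g j (\<lambda>k. if k \<in> B i then fst z k else snd z k) else d') =
      (\<lambda>j. if j \<in> J then g j (snd z) else d')(i := g i (fst z))" for z
  proof (rule ext)
    fix j
    have "g j (\<lambda>k. if k \<in> B i then fst z k else snd z k) = g j (snd z)" if "j \<in> J"
      using that dis[OF that] by (intro insert.prems(4)) auto
    moreover have "g i (\<lambda>k. if k \<in> B i then fst z k else snd z k) = g i (fst z)"
      by (intro insert.prems(4)) auto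
    ultimately show "(if j \<in> insert i J then g j (\<lambda>k. if k \<in> B i then fst z k else snd z k) else d') =
      ((\<lambda>j. if j \<in> J then g j (snd z) else d')(i := g i (fst z))) j"
      using insert.hyps by auto
  qed
  have "Pi_pmf K d p = map_pmf (\<lambda>z k. if k \<in> B i then fst z k else snd z k)
          (pair_pmf (Pi_pmf (B i) d p) (Pi_pmf ?R d p))"
    using Pi_pmf_union[OF fin, of d p] K by (simp add: Un_absorb1 split_def)
  then have "map_pmf (\<lambda>x j. if j \<in> insert i J then g j x else d') (Pi_pmf K d p) =
      map_pmf (\<lambda>z. (\<lambda>j. if j \<in> J then g j (snd z) else d')(i := g i (fst z)))
          (pair_pmf (Pi_pmf (B i) d p) (Pi_pmf ?R d p))"
    by (simp only: map_pmf_comp eq)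
  also have "\<dots> = map_pmf (\<lambda>(y, h). h(i := y)) (map_pmf
      (\<lambda>(a, b). (g i a, \<lambda>j. if j \<in> J then g j b else d')) (pair_pmf (Pi_pmf (B i) d p) (Pi_pmf ?R d p)))"
    by (simp add: map_pmf_comp split_def)
  also have "\<dots> = map_pmf (\<lambda>(y, h). h(i := y)) (pair_pmf (q i) (Pi_pmf J d' q))"
    unfolding map_pair using IH insert.prems(5)[of i] by simp
  also have "\<dots> = Pi_pmf (insert i J) d' q"
    using insert.hyps by (simp add: Pi_pmf_insert)
  finally show ?case .
qed simp

text \<open>The event is a product, so the normalising constant factors over the coordinates
  together with the density.\<close>

lemma Pi_pmf_cond:
  assumes fin: "finite J" and ne: "\<And>j. j \<in> J \<Longrightarrow> set_pmf (p j) \<inter> S j \<noteq> {}"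
  shows "cond_pmf (Pi_pmf J d p) {x. \<forall>j\<in>J. x j \<in> S j} = Pi_pmf J d (\<lambda>j. cond_pmf (p j) (S j))"
proof (rule pmf_eqI)
  fix x
  let ?P = "Pi_pmf J d p" and ?S = "{x. \<forall>j\<in>J. x j \<in> S j}"
  obtain c where c: "\<And>j. j \<in> J \<Longrightarrow> c j \<in> set_pmf (p j) \<inter> S j"
    using bchoice[of J "\<lambda>j c. c \<in> set_pmf (p j) \<inter> S j"] ne by blast
  then have "(\<lambda>j. if j \<in> J then c j else d) \<in> set_pmf ?P \<inter> ?S"
    using fin by (auto simp: set_Pi_pmf PiE_dflt_def)
  then have nonempty: "set_pmf ?P \<inter> ?S \<noteq> {}" by blast
  have "measure ?P ?S = measure ?P (Pi J S)"
    by (rule arg_cong[where f = "measure _"]) auto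
  then have meas: "measure ?P ?S = (\<Prod>j\<in>J. measure (p j) (S j))"
    using measure_Pi_pmf_Pi[OF fin, of d p S] by simp
  show "pmf (cond_pmf ?P ?S) x = pmf (Pi_pmf J d (\<lambda>j. cond_pmf (p j) (S j))) x"
  proof (cases "\<forall>j. j \<notin> J \<longrightarrow> x j = d")
    case True
    have "(\<Prod>j\<in>J. pmf (cond_pmf (p j) (S j)) (x j)) =
      (\<Prod>j\<in>J. if x j \<in> S j then pmf (p j) (x j) / measure (p j) (S j) else 0)"
      by (intro prod.cong refl) (simp add: pmf_cond ne)
    also have "\<dots> = (if x \<in> ?S then (\<Prod>j\<in>J. pmf (p j) (x j)) / (\<Prod>j\<in>J. measure (p j) (S j)) else 0)"
      using fin by (auto simp: prod_dividef intro!: prod.cong)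
    finally show ?thesis
      using True fin by (simp add: pmf_cond[OF nonempty] meas pmf_Pi)
  next
    case False
    then show ?thesis
      using fin by (auto simp: pmf_cond[OF nonempty] pmf_Pi)
  qed
qed

section \<open>Diagrams and reductions under tensor products\<close>

lemma is_diagramD:
  assumes "is_diagram G X"
  shows "i \<in> Ob G \<Longrightarrow> finite (set_pmf (Sp X i))"
    and "f \<in> Ar G \<Longrightarrow> map_pmf (Mp X f) (Sp X (Dom G f)) = Sp X (Cod G f)"
    and "i \<in> Ob G \<Longrightarrow> x \<in> set_pmf (Sp X i) \<Longrightarrow> Mp X (Idn G i) x = x"
    and "f \<in> hom_set G i j \<Longrightarrow> g \<in> hom_set G j k \<Longrightarrow> x \<in> set_pmf (Sp X i) \<Longrightarrow>
      Mp X (Cmp G g f) x = Mp X g (Mp X f x)"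
  using assms unfolding is_diagram_def AE_measure_pmf_iff by blast+

lemma is_reductionD:
  assumes "is_reduction G X Y r"
  shows "i \<in> Ob G \<Longrightarrow> map_pmf (r i) (Sp X i) = Sp Y i"
    and "f \<in> Ar G \<Longrightarrow> x \<in> set_pmf (Sp X (Dom G f)) \<Longrightarrow> r (Cod G f) (Mp X f x) = Mp Y f (r (Dom G f) x)"
  using assms unfolding is_reduction_def AE_measure_pmf_iff by blast+

lemma tensor_sel [simp]:
  "Sp (tensor J D) i = Pi_pmf J undefined (\<lambda>j. Sp (D j) i)"
  "Mp (tensor J D) f x = restrict (\<lambda>j. Mp (D j) f (x j)) J"
  by (simp_all add: tensor_def)

context small_category
begin

lemma reduction_id: "is_reduction G X X (\<lambda>i x. x)"
  by (simp add: is_reduction_def)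

lemma reduction_comp:
  assumes r: "is_reduction G X Y r" and s: "is_reduction G Y Z s"
  shows "is_reduction G X Z (\<lambda>i x. s i (r i x))"
  unfolding is_reduction_def AE_measure_pmf_iff
proof (intro conjI ballI)
  fix i assume i: "i \<in> Ob G"
  have "map_pmf (\<lambda>x. s i (r i x)) (Sp X i) = map_pmf (s i) (map_pmf (r i) (Sp X i))"
    by (simp add: map_pmf_comp)
  then show "map_pmf (\<lambda>x. s i (r i x)) (Sp X i) = Sp Z i"
    using is_reductionD(1)[OF r i] is_reductionD(1)[OF s i] by simp
next
  fix f x assume f: "f \<in> Ar G" "x \<in> set_pmf (Sp X (Dom G f))"
  then have "r (Dom G f) x \<in> set_pmf (Sp Y (Dom G f))"
    using is_reductionD(1)[OF r Dom_Ob[OF f(1)]] by (metis imageI set_map_pmf)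
  then show "s (Cod G f) (r (Cod G f) (Mp X f x)) = Mp Z f (s (Dom G f) (r (Dom G f) x))"
    using is_reductionD(2)[OF r f] is_reductionD(2)[OF s f(1)] by simp
qed

lemma diagram_tensor:
  assumes fin: "finite J" and D: "\<And>j. j \<in> J \<Longrightarrow> is_diagram G (D j)"
  shows "is_diagram G (tensor J D)"
  unfolding is_diagram_def AE_measure_pmf_iff
proof (intro conjI ballI allI impI)
  fix i assume i: "i \<in> Ob G"
  show "finite (set_pmf (Sp (tensor J D) i))"
    using fin D i by (auto intro!: finite_set_Pi_pmf is_diagramD(1))
  fix x assume x: "x \<in> set_pmf (Sp (tensor J D) i)"
  show "Mp (tensor J D) (Idn G i) x = x"
    using x fin D i by (auto simp: set_Pi_pmf PiE_dflt_def restrict_def fun_eq_iff is_diagramD(3))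
next
  fix f assume f: "f \<in> Ar G"
  have "map_pmf (\<lambda>x j. if j \<in> J then Mp (D j) f (x j) else undefined)
       (Pi_pmf J undefined (\<lambda>j. Sp (D j) (Dom G f))) = Pi_pmf J undefined (\<lambda>j. Sp (D j) (Cod G f))"
  proof (rule Pi_pmf_blocks[where B = "\<lambda>j. {j}"])
    fix j assume j: "j \<in> J"
    have "map_pmf (\<lambda>x. Mp (D j) f (x j)) (Pi_pmf {j} undefined (\<lambda>j. Sp (D j) (Dom G f))) =
      map_pmf (Mp (D j) f) (map_pmf (\<lambda>x. x j) (Pi_pmf {j} undefined (\<lambda>j. Sp (D j) (Dom G f))))"
      by (simp only: map_pmf_comp)
    also have "\<dots> = Sp (D j) (Cod G f)"
      using D[OF j] f by (simp add: Pi_pmf_component is_diagramD(2))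
    finally show "map_pmf (\<lambda>x. Mp (D j) f (x j)) (Pi_pmf {j} undefined (\<lambda>j. Sp (D j) (Dom G f))) =
      Sp (D j) (Cod G f)" .
  qed (use fin in \<open>auto simp: disjoint_family_on_def\<close>)
  then show "map_pmf (Mp (tensor J D) f) (Sp (tensor J D) (Dom G f)) = Sp (tensor J D) (Cod G f)"
    by (simp add: tensor_def restrict_def cong: if_cong)
next
  fix i j k f g x
  assume f: "f \<in> hom_set G i j" "g \<in> hom_set G j k" and x: "x \<in> set_pmf (Sp (tensor J D) i)"
  show "Mp (tensor J D) (Cmp G g f) x = Mp (tensor J D) g (Mp (tensor J D) f x)"
    using x fin D
    by (auto simp: set_Pi_pmf PiE_dflt_def restrict_def fun_eq_iff intro!: is_diagramD(4)[OF _ f])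
qed

text \<open>Each target factor reads its own block of source factors; disjointness keeps the target
  factors independent, and source factors in no block are dropped.\<close>

lemma reduction_tensor_blocks:
  assumes fin: "finite J" "finite K" and B: "\<And>j. j \<in> J \<Longrightarrow> B j \<subseteq> K" "disjoint_family_on B J"
    and dep: "\<And>j i x y. j \<in> J \<Longrightarrow> (\<And>k. k \<in> B j \<Longrightarrow> x k = y k) \<Longrightarrow> g j i x = g j i y"
    and red: "\<And>j. j \<in> J \<Longrightarrow> is_reduction G (tensor (B j) D) (A j) (g j)"
  shows "is_reduction G (tensor K D) (tensor J A) (\<lambda>i x. restrict (\<lambda>j. g j i x) J)"
  unfolding is_reduction_def AE_measure_pmf_iff
proof (intro conjI ballI)
  fix i assume i: "i \<in> Ob G"
  have "map_pmf (\<lambda>x j. if j \<in> J then g j i x else undefined) (Pi_pmf K undefined (\<lambda>k. Sp (D k) i)) =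
      Pi_pmf J undefined (\<lambda>j. Sp (A j) i)"
    by (rule Pi_pmf_blocks[OF fin B dep]) (use is_reductionD(1)[OF red i] in auto)
  then show "map_pmf (\<lambda>x. restrict (\<lambda>j. g j i x) J) (Sp (tensor K D) i) = Sp (tensor J A) i"
    by (simp add: restrict_def cong: if_cong)
next
  fix f x assume f: "f \<in> Ar G" and x: "x \<in> set_pmf (Sp (tensor K D) (Dom G f))"
  have "g j (Cod G f) (restrict (\<lambda>k. Mp (D k) f (x k)) K) = Mp (A j) f (g j (Dom G f) x)" if j: "j \<in> J" for j
  proof -
    \<comment> \<open>The reduction attached to \<open>j\<close> commutes with the maps only on the
      support of the tensor over \<open>B j\<close>, so \<open>x\<close> is cut down to that block;
      \<open>dep\<close> makes the cut invisible to \<open>g j\<close>.\<close>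
    let ?x = "restrict x (B j)"
    have x': "?x \<in> set_pmf (Sp (tensor (B j) D) (Dom G f))"
      using x fin B(1)[OF j] finite_subset[OF B(1)[OF j] fin(2)]
      by (auto simp: set_Pi_pmf PiE_dflt_def)
    have "g j (Cod G f) (restrict (\<lambda>k. Mp (D k) f (x k)) K) = g j (Cod G f) (Mp (tensor (B j) D) f ?x)"
      by (rule dep[OF j]) (use B(1)[OF j] in auto)
    also have "\<dots> = Mp (A j) f (g j (Dom G f) ?x)"
      by (rule is_reductionD(2)[OF red[OF j] f x'])
    also have "g j (Dom G f) ?x = g j (Dom G f) x"
      by (rule dep[OF j]) auto
    finally show ?thesis .
  qed
  then show "restrict (\<lambda>j. g j (Cod G f) (Mp (tensor K D) f x)) J =
        Mp (tensor J A) f (restrict (\<lambda>j. g j (Dom G f) x) J)"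
    by (auto simp: restrict_def fun_eq_iff)
qed

lemma reduction_tensor_singleton:
  assumes r: "is_reduction G (D k) A r"
  shows "is_reduction G (tensor {k} D) A (\<lambda>i x. r i (x k))"
  unfolding is_reduction_def AE_measure_pmf_iff
proof (intro conjI ballI)
  fix i assume i: "i \<in> Ob G"
  have "map_pmf (\<lambda>x. r i (x k)) (Sp (tensor {k} D) i) =
        map_pmf (r i) (map_pmf (\<lambda>x. x k) (Pi_pmf {k} undefined (\<lambda>j. Sp (D j) i)))"
    by (simp add: map_pmf_comp)
  then show "map_pmf (\<lambda>x. r i (x k)) (Sp (tensor {k} D) i) = Sp A i"
    using is_reductionD(1)[OF r i] by (simp add: Pi_pmf_component)
next
  fix f x assume "f \<in> Ar G" "x \<in> set_pmf (Sp (tensor {k} D) (Dom G f))"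
  then show "r (Cod G f) (Mp (tensor {k} D) f x k) = Mp A f (r (Dom G f) (x k))"
    using is_reductionD(2)[OF r] by (auto simp: set_Pi_pmf PiE_dflt_def)
qed

text \<open>The case of singleton blocks: factor \<open>j\<close> of the target reads factor
  \<open>\<pi> j\<close> of the source.\<close>

lemma reduction_tensor_inj:
  assumes fin: "finite J" "finite K" and inj: "inj_on \<pi> J" "\<pi> ` J \<subseteq> K"
    and red: "\<And>j. j \<in> J \<Longrightarrow> is_reduction G (D (\<pi> j)) (A j) (r j)"
  shows "is_reduction G (tensor K D) (tensor J A) (\<lambda>i x. restrict (\<lambda>j. r j i (x (\<pi> j))) J)"
  by (rule reduction_tensor_blocks[OF fin, where B = "\<lambda>j. {\<pi> j}"])
    (use inj in \<open>auto simp: disjoint_family_on_def inj_on_def intro!: reduction_tensor_singleton red\<close>)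

lemma reduction_tensor_curry:
  assumes fin: "finite J" "\<And>j. j \<in> J \<Longrightarrow> finite (K j)"
  shows "is_reduction G (tensor (Sigma J K) (\<lambda>z. D (fst z) (snd z))) (tensor J (\<lambda>j. tensor (K j) (D j)))
           (\<lambda>i x. restrict (\<lambda>j. restrict (\<lambda>k. x (j, k)) (K j)) J)"
proof (rule reduction_tensor_blocks[where B = "\<lambda>j. {j} \<times> K j"])
  fix j assume j: "j \<in> J"
  show "is_reduction G (tensor ({j} \<times> K j) (\<lambda>z. D (fst z) (snd z))) (tensor (K j) (D j))
         (\<lambda>i x. restrict (\<lambda>k. x (j, k)) (K j))"
    by (rule reduction_tensor_inj[where \<pi> = "Pair j" and r = "\<lambda>k i y. y"])
      (use fin j in \<open>auto simp: inj_on_def reduction_id\<close>)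
qed (use fin in \<open>auto simp: disjoint_family_on_def\<close>)

text \<open>Uncurrying undoes currying on the support, so its push-forward is read off from the law
  of the curried tensor.\<close>

lemma reduction_tensor_uncurry:
  assumes fin: "finite J" "\<And>j. j \<in> J \<Longrightarrow> finite (K j)"
  shows "is_reduction G (tensor J (\<lambda>j. tensor (K j) (D j))) (tensor (Sigma J K) (\<lambda>z. D (fst z) (snd z)))
           (\<lambda>i x. restrict (\<lambda>z. x (fst z) (snd z)) (Sigma J K))"
  unfolding is_reduction_def AE_measure_pmf_iff
proof (intro conjI ballI)
  let ?u = "\<lambda>x. restrict (\<lambda>z. x (fst z) (snd z)) (Sigma J K)"
  let ?c = "\<lambda>x. restrict (\<lambda>j. restrict (\<lambda>k. x (j, k)) (K j)) J"
  let ?F = "tensor (Sigma J K) (\<lambda>z. D (fst z) (snd z))" and ?N = "tensor J (\<lambda>j. tensor (K j) (D j))"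
  fix i assume i: "i \<in> Ob G"
  have "map_pmf ?u (Sp ?N i) = map_pmf ?u (map_pmf ?c (Sp ?F i))"
    using is_reductionD(1)[OF reduction_tensor_curry[OF fin, where D = D] i] by simp
  also have "\<dots> = map_pmf (\<lambda>x. x) (Sp ?F i)"
    unfolding map_pmf_comp using fin
    by (intro map_pmf_cong refl) (auto simp: set_Pi_pmf PiE_dflt_def fun_eq_iff restrict_def)
  finally show "map_pmf ?u (Sp ?N i) = Sp ?F i" by simp
next
  fix f x
  show "restrict (\<lambda>z. Mp (tensor J (\<lambda>j. tensor (K j) (D j))) f x (fst z) (snd z)) (Sigma J K) =
    Mp (tensor (Sigma J K) (\<lambda>z. D (fst z) (snd z))) f (restrict (\<lambda>z. x (fst z) (snd z)) (Sigma J K))"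
    by (auto simp: restrict_def fun_eq_iff)
qed

end

section \<open>Entropy distance\<close>

definition total_ent :: "('o, 'm) cat \<Rightarrow> ('o, 'm, 'a) diagram \<Rightarrow> real" where
  "total_ent G X = (\<Sum>i\<in>Ob G. Ent (Sp X i))"

lemma total_ent_nonneg: "0 \<le> total_ent G X"
  by (simp add: total_ent_def sum_nonneg Ent_nonneg)

lemma total_ent_reduction_le:
  assumes "is_diagram G Z" "is_reduction G Z X r"
  shows "total_ent G X \<le> total_ent G Z"
  unfolding total_ent_def
  by (rule sum_mono) (metis Ent_map_le assms is_diagramD(1) is_reductionD(1))

text \<open>Entropy does not increase along a reduction, so the absolute values disappear and only
  total entropies matter from here on.\<close>

lemma kd_fan:
  assumes "is_fan G X Y Z r s"
  shows "kd G X Y Z = 2 * total_ent G Z - total_ent G X - total_ent G Y"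
proof -
  have "Ent (Sp X i) \<le> Ent (Sp Z i)" "Ent (Sp Y i) \<le> Ent (Sp Z i)" if "i \<in> Ob G" for i
    using assms that unfolding is_fan_def by (metis Ent_map_le is_diagramD(1) is_reductionD(1))+
  then have "kd G X Y Z = (\<Sum>i\<in>Ob G. Ent (Sp Z i) - Ent (Sp X i)) + (\<Sum>i\<in>Ob G. Ent (Sp Z i) - Ent (Sp Y i))"
    unfolding kd_def by (intro arg_cong2[where f = "(+)"] sum.cong) auto
  then show ?thesis
    by (simp add: total_ent_def sum_subtractf)
qed

lemma total_ent_tensor:
  assumes "finite J" "\<And>j. j \<in> J \<Longrightarrow> is_diagram G (D j)"
  shows "total_ent G (tensor J D) = (\<Sum>j\<in>J. total_ent G (D j))"
proof -
  have "total_ent G (tensor J D) = (\<Sum>i\<in>Ob G. \<Sum>j\<in>J. Ent (Sp (D j) i))"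
    unfolding total_ent_def
    by (intro sum.cong refl) (use assms in \<open>auto intro!: Ent_Pi_pmf is_diagramD(1)\<close>)
  then show ?thesis
    by (simp add: total_ent_def sum.swap[of _ J])
qed

lemma total_ent_tensor_Un:
  assumes "finite J" "finite K" "J \<inter> K = {}" "\<And>j. j \<in> J \<union> K \<Longrightarrow> is_diagram G (D j)"
  shows "total_ent G (tensor (J \<union> K) D) = total_ent G (tensor J D) + total_ent G (tensor K D)"
proof -
  have "total_ent G (tensor (J \<union> K) D) = (\<Sum>j\<in>J \<union> K. total_ent G (D j))"
    by (rule total_ent_tensor) (use assms in auto)
  then show ?thesis
    using assms by (simp add: total_ent_tensor sum.union_disjoint)
qed

text \<open>A separate binary product on pairs, since \<open>tensor\<close> only combines diagrams
  that share one carrier type.\<close>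

definition prod_diagram ::
  "('o, 'm, 'a) diagram \<Rightarrow> ('o, 'm, 'b) diagram \<Rightarrow> ('o, 'm, 'a \<times> 'b) diagram" where
  "prod_diagram X Y = \<lparr> Sp = (\<lambda>i. pair_pmf (Sp X i) (Sp Y i)), Mp = (\<lambda>f. map_prod (Mp X f) (Mp Y f)) \<rparr>"

lemma prod_diagram_sel [simp]:
  "Sp (prod_diagram X Y) i = pair_pmf (Sp X i) (Sp Y i)"
  "Mp (prod_diagram X Y) f = map_prod (Mp X f) (Mp Y f)"
  by (simp_all add: prod_diagram_def)

lemma map_prod_pair_pmf: "map_pmf (map_prod f g) (pair_pmf p q) = pair_pmf (map_pmf f p) (map_pmf g q)"
  using map_pair[of f g p q] by (simp add: map_prod_def)

lemma diagram_prod: "is_diagram G X \<Longrightarrow> is_diagram G Y \<Longrightarrow> is_diagram G (prod_diagram X Y)"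
  unfolding is_diagram_def AE_measure_pmf_iff
  by (intro conjI ballI allI impI) (auto simp: map_prod_pair_pmf)

lemma total_ent_prod:
  "is_diagram G X \<Longrightarrow> is_diagram G Y \<Longrightarrow>
   total_ent G (prod_diagram X Y) = total_ent G X + total_ent G Y"
  by (simp add: total_ent_def Ent_pair_pmf is_diagramD(1) sum.distrib)

lemma reduction_fst: "is_reduction G (prod_diagram X Y) X (\<lambda>i. fst)"
  by (auto simp: is_reduction_def map_fst_pair_pmf AE_measure_pmf_iff)

lemma reduction_snd: "is_reduction G (prod_diagram X Y) Y (\<lambda>i. snd)"
  by (auto simp: is_reduction_def map_snd_pair_pmf AE_measure_pmf_iff)

lemma reduction_prod_tensor:
  assumes fin: "finite J" "finite K" "J \<inter> K = {}"
    and r: "is_reduction G Z (tensor J D) r" and s: "is_reduction G W (tensor K D) s"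
  shows "is_reduction G (prod_diagram Z W) (tensor (J \<union> K) D)
           (\<lambda>i z j. if j \<in> J then r i (fst z) j else s i (snd z) j)"
  unfolding is_reduction_def AE_measure_pmf_iff
proof (intro conjI ballI)
  fix i assume i: "i \<in> Ob G"
  have "map_pmf (\<lambda>z j. if j \<in> J then r i (fst z) j else s i (snd z) j) (pair_pmf (Sp Z i) (Sp W i)) =
    map_pmf (\<lambda>(f, g) j. if j \<in> J then f j else g j) (map_pmf (map_prod (r i) (s i)) (pair_pmf (Sp Z i) (Sp W i)))"
    unfolding map_pmf_comp by (intro map_pmf_cong refl) auto
  also have "\<dots> = Sp (tensor (J \<union> K) D) i"
    using is_reductionD(1)[OF r i] is_reductionD(1)[OF s i]
    by (simp add: map_prod_pair_pmf Pi_pmf_union[OF fin])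
  finally show "map_pmf (\<lambda>z j. if j \<in> J then r i (fst z) j else s i (snd z) j) (Sp (prod_diagram Z W) i) =
    Sp (tensor (J \<union> K) D) i" by simp
next
  fix f z assume f: "f \<in> Ar G" and z: "z \<in> set_pmf (Sp (prod_diagram Z W) (Dom G f))"
  have "r (Cod G f) (Mp Z f (fst z)) = Mp (tensor J D) f (r (Dom G f) (fst z))"
    "s (Cod G f) (Mp W f (snd z)) = Mp (tensor K D) f (s (Dom G f) (snd z))"
    using z is_reductionD(2)[OF r f, of "fst z"] is_reductionD(2)[OF s f, of "snd z"] by auto
  then show "(\<lambda>j. if j \<in> J then r (Cod G f) (fst (Mp (prod_diagram Z W) f z)) j
                  else s (Cod G f) (snd (Mp (prod_diagram Z W) f z)) j) =
    Mp (tensor (J \<union> K) D) f (\<lambda>j. if j \<in> J then r (Dom G f) (fst z) j else s (Dom G f) (snd z) j)"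
    by (auto simp: fun_eq_iff restrict_def)
qed

section \<open>Upper bounds for the intrinsic entropy distance\<close>

context indexing_category
begin

lemma fan_prod: "is_diagram G X \<Longrightarrow> is_diagram G Y \<Longrightarrow>
  is_fan G X Y (prod_diagram X Y) (\<lambda>i. fst) (\<lambda>i. snd)"
  by (simp add: is_fan_def diagram_prod reduction_fst reduction_snd)

lemma bdd_below_kd: "bdd_below {kd G X Y Z | (Z :: ('o, 'm, nat) diagram) r s. is_fan G X Y Z r s}"
  by (rule bdd_belowI[of _ 0]) (auto simp: kd_def intro!: add_nonneg_nonneg sum_nonneg)

text \<open>The top may live on any type although the infimum ranges over tops on
  \<open>nat\<close>: \<open>fan_on_nat\<close> moves it there at equal cost.\<close>

lemma entropy_dist_le:
  assumes fan: "is_fan G X Y Z r s"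
  shows "entropy_dist G X Y \<le> 2 * total_ent G Z - total_ent G X - total_ent G Y"
proof -
  obtain Z' :: "('o, 'm, nat) diagram" and r' s' where
    Z': "is_fan G X Y Z' r' s'" "kd G X Y Z' = kd G X Y Z"
    using fan_on_nat[OF finite_Ob fan] by blast
  have "entropy_dist G X Y \<le> kd G X Y Z'"
    unfolding entropy_dist_def by (rule cInf_lower[OF _ bdd_below_kd]) (use Z' in blast)
  then show ?thesis
    using Z' kd_fan[OF fan] by simp
qed

lemma kd_set_nonempty:
  assumes "is_diagram G X" "is_diagram G Y"
  shows "{kd G X Y Z | (Z :: ('o, 'm, nat) diagram) r s. is_fan G X Y Z r s} \<noteq> {}"
  using fan_on_nat[OF finite_Ob fan_prod[OF assms]] by blast

lemma entropy_dist_nonneg: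
  assumes "is_diagram G X" "is_diagram G Y"
  shows "0 \<le> entropy_dist G X Y"
  unfolding entropy_dist_def
  by (rule cInf_greatest[OF kd_set_nonempty[OF assms]])
    (auto simp: kd_def intro!: add_nonneg_nonneg sum_nonneg)

lemma entropy_dist_approx:
  fixes X :: "('o, 'm, 'a) diagram" and Y :: "('o, 'm, 'b) diagram"
  assumes "is_diagram G X" "is_diagram G Y" "0 < e"
  obtains Z :: "('o, 'm, nat) diagram" and r s where "is_fan G X Y Z r s"
    "2 * total_ent G Z - total_ent G X - total_ent G Y < entropy_dist G X Y + e"
proof -
  have "\<exists>x\<in>{kd G X Y Z | (Z :: ('o, 'm, nat) diagram) r s. is_fan G X Y Z r s}. x < entropy_dist G X Y + e"
    unfolding entropy_dist_def
    by (rule cInf_lessD[OF kd_set_nonempty[OF assms(1,2)], unfolded bex_simps]) (use assms in auto)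
  then show ?thesis
    using that by (auto simp: kd_fan)
qed

lemma entropy_dist_le_total_ent:
  assumes "is_diagram G X" "is_diagram G Y"
  shows "entropy_dist G X Y \<le> total_ent G X + total_ent G Y"
  using entropy_dist_le[OF fan_prod[OF assms]] total_ent_prod[OF assms] by simp

text \<open>A fan over \<open>X\<close> and \<open>Y\<close> composes to a fan over
  \<open>X'\<close> and \<open>Y'\<close>, and equal total entropies keep its cost. This replaces
  invariance under isomorphism and asks for maps in one direction only.\<close>

lemma entropy_dist_reduction:
  assumes X: "is_diagram G X" "is_reduction G X X' r" and Y: "is_diagram G Y" "is_reduction G Y Y' s"
    and eq: "total_ent G X' = total_ent G X" "total_ent G Y' = total_ent G Y"
  shows "entropy_dist G X' Y' \<le> entropy_dist G X Y"
proof (rule field_le_epsilon)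
  fix e :: real assume "0 < e"
  then obtain Z :: "('o, 'm, nat) diagram" and p q where Z: "is_fan G X Y Z p q"
    "2 * total_ent G Z - total_ent G X - total_ent G Y < entropy_dist G X Y + e"
    using entropy_dist_approx[OF X(1) Y(1)] by blast
  have "is_fan G X' Y' Z (\<lambda>i x. r i (p i x)) (\<lambda>i x. s i (q i x))"
    using Z(1) X Y by (auto simp: is_fan_def intro: reduction_comp)
  from entropy_dist_le[OF this] Z(2) eq show "entropy_dist G X' Y' \<le> entropy_dist G X Y + e" by simp
qed

text \<open>Subadditivity: the product of two nearly optimal fans is a fan between the combined
  tensors, and total entropies add.\<close>

lemma entropy_dist_tensor_Un:
  assumes fin: "finite J" "finite K" "J \<inter> K = {}" "finite J'" "finite K'" "J' \<inter> K' = {}"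
    and A: "\<And>j. j \<in> J \<union> K \<Longrightarrow> is_diagram G (A j)" and B: "\<And>j. j \<in> J' \<union> K' \<Longrightarrow> is_diagram G (B j)"
  shows "entropy_dist G (tensor (J \<union> K) A) (tensor (J' \<union> K') B) \<le>
         entropy_dist G (tensor J A) (tensor J' B) + entropy_dist G (tensor K A) (tensor K' B)"
proof (rule field_le_epsilon)
  fix e :: real assume e: "0 < e"
  have diag: "is_diagram G (tensor J A)" "is_diagram G (tensor J' B)"
    "is_diagram G (tensor K A)" "is_diagram G (tensor K' B)"
    using fin A B by (auto intro!: diagram_tensor)
  obtain Z :: "('o, 'm, nat) diagram" and p q where Z: "is_fan G (tensor J A) (tensor J' B) Z p q"
    "2 * total_ent G Z - total_ent G (tensor J A) - total_ent G (tensor J' B) <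
     entropy_dist G (tensor J A) (tensor J' B) + e / 2"
    using entropy_dist_approx[OF diag(1,2), of "e / 2"] e by auto
  obtain W :: "('o, 'm, nat) diagram" and r s where W: "is_fan G (tensor K A) (tensor K' B) W r s"
    "2 * total_ent G W - total_ent G (tensor K A) - total_ent G (tensor K' B) <
     entropy_dist G (tensor K A) (tensor K' B) + e / 2"
    using entropy_dist_approx[OF diag(3,4), of "e / 2"] e by auto
  have ZW: "is_diagram G Z" "is_diagram G W" using Z W by (auto simp: is_fan_def)
  have "is_fan G (tensor (J \<union> K) A) (tensor (J' \<union> K') B) (prod_diagram Z W)
     (\<lambda>i z j. if j \<in> J then p i (fst z) j else r i (snd z) j)
     (\<lambda>i z j. if j \<in> J' then q i (fst z) j else s i (snd z) j)"
    using Z W fin ZW unfolding is_fan_def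
    by (auto intro!: reduction_prod_tensor diagram_prod)
  from entropy_dist_le[OF this]
  have "entropy_dist G (tensor (J \<union> K) A) (tensor (J' \<union> K') B) \<le> 2 * (total_ent G Z + total_ent G W)
    - (total_ent G (tensor J A) + total_ent G (tensor K A))
    - (total_ent G (tensor J' B) + total_ent G (tensor K' B))"
    using ZW total_ent_tensor_Un[OF fin(1-3), of G A] total_ent_tensor_Un[OF fin(4-6), of G B] A B
    by (simp add: total_ent_prod)
  with Z(2) W(2) show "entropy_dist G (tensor (J \<union> K) A) (tensor (J' \<union> K') B) \<le>
         entropy_dist G (tensor J A) (tensor J' B) + entropy_dist G (tensor K A) (tensor K' B) + e"
    by (simp add: field_simps)
qed

text \<open>
  Pairing the tops of the fans between the slices with the mixing variable gives the top of a fan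
  between the mixtures.
\<close>

lemma entropy_dist_mixture:
  assumes finm: "finite (set_pmf \<mu>)"
    and fan: "\<And>m. m \<in> set_pmf \<mu> \<Longrightarrow> is_fan G (A m) (B m) (Z m) (r m) (s m)"
    and A: "\<And>i. i \<in> Ob G \<Longrightarrow> Sp X i = bind_pmf \<mu> (\<lambda>m. Sp (A m) i)" "\<And>m. Mp (A m) = Mp X"
    and B: "\<And>i. i \<in> Ob G \<Longrightarrow> Sp Y i = bind_pmf \<mu> (\<lambda>m. Sp (B m) i)" "\<And>m. Mp (B m) = Mp Y"
  shows "entropy_dist G X Y \<le> 2 * real (card (Ob G)) * Ent \<mu> +
    2 * (\<Sum>m\<in>set_pmf \<mu>. pmf \<mu> m * total_ent G (Z m)) - total_ent G X - total_ent G Y"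
proof -
  define T where "T = \<lparr> Sp = (\<lambda>i. bind_pmf \<mu> (\<lambda>m. map_pmf (Pair m) (Sp (Z m) i))),
    Mp = (\<lambda>f z. (fst z, Mp (Z (fst z)) f (snd z))) \<rparr>"
  have T_sel: "Sp T i = bind_pmf \<mu> (\<lambda>m. map_pmf (Pair m) (Sp (Z m) i))"
    "Mp T f z = (fst z, Mp (Z (fst z)) f (snd z))" for i f z
    by (simp_all add: T_def)
  have Z: "is_diagram G (Z m)" "is_reduction G (Z m) (A m) (r m)" "is_reduction G (Z m) (B m) (s m)"
    if "m \<in> set_pmf \<mu>" for m
    using fan[OF that] by (auto simp: is_fan_def)
  have T: "is_diagram G T"
    unfolding is_diagram_def AE_measure_pmf_iff
  proof (intro conjI ballI allI impI)
    fix i assume i: "i \<in> Ob G"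
    show "finite (set_pmf (Sp T i))"
      using finm is_diagramD(1)[OF Z(1) i] by (auto simp: T_sel)
    fix x assume "x \<in> set_pmf (Sp T i)"
    then show "Mp T (Idn G i) x = x"
      using is_diagramD(3)[OF Z(1) i] by (auto simp: T_sel)
  next
    fix f assume f: "f \<in> Ar G"
    have "map_pmf (Mp T f) (Sp T (Dom G f)) =
        bind_pmf \<mu> (\<lambda>m. map_pmf (Pair m) (map_pmf (Mp (Z m) f) (Sp (Z m) (Dom G f))))"
      by (simp add: T_sel map_bind_pmf map_pmf_comp)
    also have "\<dots> = Sp T (Cod G f)"
      unfolding T_sel by (intro bind_pmf_cong refl) (simp add: is_diagramD(2)[OF Z(1) f])
    finally show "map_pmf (Mp T f) (Sp T (Dom G f)) = Sp T (Cod G f)" .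
  next
    fix i j k f g x
    assume fg: "f \<in> hom_set G i j" "g \<in> hom_set G j k" and x: "x \<in> set_pmf (Sp T i)"
    then show "Mp T (Cmp G g f) x = Mp T g (Mp T f x)"
      using is_diagramD(4)[OF Z(1) fg] by (auto simp: T_sel)
  qed
  \<comment> \<open>All slices share the maps of \<open>V\<close>, so once the mixing variable is
    forgotten their separate reductions become one reduction onto \<open>V\<close>.\<close>
  have red: "is_reduction G T V (\<lambda>i z. q (fst z) i (snd z))"
    if V: "\<And>i. i \<in> Ob G \<Longrightarrow> Sp V i = bind_pmf \<mu> (\<lambda>m. Sp (C m) i)" "\<And>m. Mp (C m) = Mp V"
      and C: "\<And>m. m \<in> set_pmf \<mu> \<Longrightarrow> is_reduction G (Z m) (C m) (q m)"
    for V :: "('o, 'm, 'v) diagram" and C q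
    unfolding is_reduction_def AE_measure_pmf_iff
  proof (intro conjI ballI)
    fix i assume i: "i \<in> Ob G"
    have "map_pmf (\<lambda>z. q (fst z) i (snd z)) (Sp T i) = bind_pmf \<mu> (\<lambda>m. map_pmf (q m i) (Sp (Z m) i))"
      by (simp add: T_sel map_bind_pmf map_pmf_comp)
    also have "\<dots> = Sp V i"
      unfolding V(1)[OF i] by (intro bind_pmf_cong refl) (simp add: is_reductionD(1)[OF C i])
    finally show "map_pmf (\<lambda>z. q (fst z) i (snd z)) (Sp T i) = Sp V i" .
  next
    fix f z assume f: "f \<in> Ar G" and z: "z \<in> set_pmf (Sp T (Dom G f))"
    then show "q (fst (Mp T f z)) (Cod G f) (snd (Mp T f z)) = Mp V f (q (fst z) (Dom G f) (snd z))"
      using is_reductionD(2)[OF C f] V(2) by (auto simp: T_sel)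
  qed
  have "is_fan G X Y T (\<lambda>i z. r (fst z) i (snd z)) (\<lambda>i z. s (fst z) i (snd z))"
    unfolding is_fan_def using T red[OF A Z(2)] red[OF B Z(3)] by blast
  note entropy_dist_le[OF this]
  \<comment> \<open>The chain rule charges the entropy of \<open>\<mu>\<close> once at every object,
    hence \<open>card (Ob G)\<close>. It is doubled below because the top enters the distance
    twice.\<close>
  moreover have "total_ent G T = (\<Sum>i\<in>Ob G. Ent \<mu> + (\<Sum>m\<in>set_pmf \<mu>. pmf \<mu> m * Ent (Sp (Z m) i)))"
    unfolding total_ent_def T_sel
    by (intro sum.cong refl Ent_bind_pair finm is_diagramD(1)[OF Z(1)])
  then have "total_ent G T = real (card (Ob G)) * Ent \<mu> +
      (\<Sum>m\<in>set_pmf \<mu>. pmf \<mu> m * total_ent G (Z m))"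
    by (simp add: sum.distrib total_ent_def sum_distrib_left sum.swap[of _ "Ob G"])
  ultimately show ?thesis by simp
qed

end

section \<open>Conditioned diagrams\<close>

lemma cond_pmf_cong:
  assumes "set_pmf p \<inter> A = set_pmf p \<inter> B" "set_pmf p \<inter> A \<noteq> {}"
  shows "cond_pmf p A = cond_pmf p B"
proof (rule pmf_eqI)
  fix x
  have "measure p A = measure p B"
    using measure_Int_set_pmf[of p A] measure_Int_set_pmf[of p B] assms(1) by (simp add: Int_commute)
  moreover have "x \<in> A \<longleftrightarrow> x \<in> B" if "pmf p x \<noteq> 0"
  proof -
    have "x \<in> set_pmf p" using that by (simp add: set_pmf_iff)
    then show ?thesis using assms(1) by blast
  qed
  moreover have "set_pmf p \<inter> B \<noteq> {}" using assms by blast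
  ultimately show "pmf (cond_pmf p A) x = pmf (cond_pmf p B) x"
    using assms(2) by (cases "pmf p x = 0") (simp_all add: pmf_cond)
qed

lemma cond_cond_pmf:
  assumes "B \<subseteq> A" "set_pmf p \<inter> B \<noteq> {}"
  shows "cond_pmf (cond_pmf p A) B = cond_pmf p B"
proof (rule pmf_eqI)
  fix x
  have A: "set_pmf p \<inter> A \<noteq> {}" using assms by blast
  have "measure (cond_pmf p A) B = measure p B / measure p A"
  proof -
    have "emeasure (cond_pmf p A) B = emeasure p (A \<inter> B) / emeasure p A"
      unfolding cond_pmf.rep_eq[OF A] by simp
    also have "\<dots> = ennreal (measure p B / measure p A)"
      using assms(1) measure_pmf.emeasure_eq_measure[of p] measure_measure_pmf_not_zero[OF A]
      by (simp add: Int_absorb1 divide_ennreal zero_less_measure_iff)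
    finally show ?thesis by (simp add: measure_def)
  qed
  moreover have "set_pmf (cond_pmf p A) \<inter> B \<noteq> {}" using assms A by auto
  ultimately show "pmf (cond_pmf (cond_pmf p A) B) x = pmf (cond_pmf p B) x"
    using assms A measure_measure_pmf_not_zero[OF A] by (auto simp: pmf_cond)
qed

text \<open>The law of total probability inside the fibre over \<open>u\<close>: that fibre is a
  union of fibres of \<open>b\<close>, and averaging their laws gives back its own.\<close>

lemma bind_cond_pmf_refine:
  assumes "set_pmf p \<inter> (k \<circ> b) -` {u} \<noteq> {}"
  shows "bind_pmf (cond_pmf (map_pmf b p) (k -` {u})) (\<lambda>w. cond_pmf p (b -` {w})) =
    cond_pmf p ((k \<circ> b) -` {u})"
proof -
  let ?c = "cond_pmf p ((k \<circ> b) -` {u})"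
  have "cond_pmf (map_pmf b p) (k -` {u}) = map_pmf b ?c"
    using assms by (subst cond_map_pmf) (auto simp: vimage_comp)
  moreover have "bind_pmf (map_pmf b ?c) (\<lambda>w. cond_pmf p (b -` {w})) =
      bind_pmf (map_pmf b ?c) (\<lambda>w. cond_pmf ?c (b -` {w}))"
    by (intro bind_pmf_cong refl cond_cond_pmf[symmetric]) (use assms in auto)
  ultimately show ?thesis
    by (simp add: bind_cond_pmf_vimage)
qed

context indexing_category
begin

abbreviation "\<Omega> \<equiv> initial_obj G"
abbreviation "leg X j \<equiv> Mp X (arrow G \<Omega> j)"

lemma arrow_initial: "j \<in> Ob G \<Longrightarrow> arrow G \<Omega> j \<in> hom_set G \<Omega> j"
  using initial_obj arrow_eq unfolding is_initial_def by fastforce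

lemma initial_Ob: "j \<in> Ob G \<Longrightarrow> \<Omega> \<in> Ob G"
  using initial_obj unfolding is_initial_def by blast

lemma map_leg:
  assumes "is_diagram G X" "j \<in> Ob G"
  shows "map_pmf (leg X j) (Sp X \<Omega>) = Sp X j"
  using is_diagramD(2)[OF assms(1), of "arrow G \<Omega> j"] arrow_initial[OF assms(2)] by (auto simp: hom_set_def)

text \<open>The composite of \<open>f\<close> with a leg is again an arrow out of the initial
  object, hence by uniqueness the leg to \<open>Cod G f\<close>.\<close>

lemma Mp_leg:
  assumes "is_diagram G X" "f \<in> Ar G" "x \<in> set_pmf (Sp X \<Omega>)"
  shows "Mp X f (leg X (Dom G f) x) = leg X (Cod G f) x"
proof -
  have "f \<in> hom_set G (Dom G f) (Cod G f)" using assms by (simp add: hom_set_def)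
  moreover from this have "arrow G \<Omega> (Cod G f) = Cmp G f (arrow G \<Omega> (Dom G f))"
    using arrow_initial[OF Dom_Ob[OF assms(2)]] by (intro arrow_eq Cmp_hom)
  ultimately show ?thesis
    using is_diagramD(4)[OF assms(1) arrow_initial[OF Dom_Ob[OF assms(2)]] _ assms(3)] by simp
qed

lemma reduction_leg:
  assumes "is_reduction G X Y r" "j \<in> Ob G" "x \<in> set_pmf (Sp X \<Omega>)"
  shows "r j (leg X j x) = leg Y j (r \<Omega> x)"
  using is_reductionD(2)[OF assms(1), of "arrow G \<Omega> j" x] arrow_initial[OF assms(2)] assms(3)
  by (auto simp: hom_set_def)

lemma cond_nonempty:
  assumes "is_diagram G X" "j \<in> Ob G" "u \<in> set_pmf (Sp X j)"
  shows "set_pmf (Sp X \<Omega>) \<inter> leg X j -` {u} \<noteq> {}"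
  using assms(3) unfolding map_leg[OF assms(1,2), symmetric] by auto

lemma cond_diagram_sel [simp]:
  "Sp (cond_diagram G X \<iota> u) j = map_pmf (leg X j) (cond_pmf (Sp X \<Omega>) (leg X \<iota> -` {u}))"
  "Mp (cond_diagram G X \<iota> u) = Mp X"
  by (simp_all add: cond_diagram_def cond_initial_def)

text \<open>Because supports only shrink, the almost-everywhere equations of \<open>X\<close>
  persist in its conditioned diagrams.\<close>

lemma set_cond_diagram:
  assumes "is_diagram G X" "\<iota> \<in> Ob G" "u \<in> set_pmf (Sp X \<iota>)" "j \<in> Ob G"
  shows "set_pmf (Sp (cond_diagram G X \<iota> u) j) \<subseteq> set_pmf (Sp X j)"
  unfolding map_leg[OF assms(1,4), symmetric] using cond_nonempty[OF assms(1-3)] by auto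

lemma diagram_cond:
  assumes X: "is_diagram G X" "\<iota> \<in> Ob G" "u \<in> set_pmf (Sp X \<iota>)"
  shows "is_diagram G (cond_diagram G X \<iota> u)"
  unfolding is_diagram_def AE_measure_pmf_iff
proof (intro conjI ballI allI impI)
  fix i assume i: "i \<in> Ob G"
  show "finite (set_pmf (Sp (cond_diagram G X \<iota> u) i))"
    using set_cond_diagram[OF X i] is_diagramD(1)[OF X(1) i] finite_subset by blast
  fix x assume "x \<in> set_pmf (Sp (cond_diagram G X \<iota> u) i)"
  then show "Mp (cond_diagram G X \<iota> u) (Idn G i) x = x"
    using set_cond_diagram[OF X i] is_diagramD(3)[OF X(1) i] by auto
next
  fix f assume f: "f \<in> Ar G"
  show "map_pmf (Mp (cond_diagram G X \<iota> u) f) (Sp (cond_diagram G X \<iota> u) (Dom G f)) =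
    Sp (cond_diagram G X \<iota> u) (Cod G f)"
    unfolding cond_diagram_sel map_pmf_comp
    by (intro map_pmf_cong refl Mp_leg X f) (use cond_nonempty[OF X] in auto)
next
  fix i j k f g x
  assume f: "f \<in> hom_set G i j" "g \<in> hom_set G j k" and x: "x \<in> set_pmf (Sp (cond_diagram G X \<iota> u) i)"
  have "i \<in> Ob G" using f Dom_Ob by (auto simp: hom_set_def)
  then show "Mp (cond_diagram G X \<iota> u) (Cmp G g f) x =
      Mp (cond_diagram G X \<iota> u) g (Mp (cond_diagram G X \<iota> u) f x)"
    using is_diagramD(4)[OF X(1) f] set_cond_diagram[OF X] x by auto
qed

text \<open>The law that an atom \<open>w\<close> of the top imposes on \<open>X\<close>. It keeps
  the maps of \<open>X\<close>, so that these diagrams can be averaged over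
  \<open>w\<close>.\<close>

definition cond_image ::
  "('o, 'm, 'c) diagram \<Rightarrow> ('o, 'm, 'a) diagram \<Rightarrow> ('o \<Rightarrow> 'c \<Rightarrow> 'a) \<Rightarrow> 'o \<Rightarrow> 'c \<Rightarrow> ('o, 'm, 'a) diagram" where
  "cond_image Z X r \<iota> w =
     \<lparr> Sp = (\<lambda>i. map_pmf (r i) (Sp (cond_diagram G Z \<iota> w) i)), Mp = Mp X \<rparr>"

lemma cond_image_sel [simp]:
  "Sp (cond_image Z X r \<iota> w) i = map_pmf (r i) (Sp (cond_diagram G Z \<iota> w) i)"
  "Mp (cond_image Z X r \<iota> w) = Mp X"
  by (simp_all add: cond_image_def)

lemma reduction_cond_image:
  assumes Z: "is_diagram G Z" "\<iota> \<in> Ob G" "w \<in> set_pmf (Sp Z \<iota>)" and r: "is_reduction G Z X r"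
  shows "is_reduction G (cond_diagram G Z \<iota> w) (cond_image Z X r \<iota> w) r"
  unfolding is_reduction_def AE_measure_pmf_iff
proof (intro conjI ballI)
  fix f x assume f: "f \<in> Ar G" and "x \<in> set_pmf (Sp (cond_diagram G Z \<iota> w) (Dom G f))"
  then show "r (Cod G f) (Mp (cond_diagram G Z \<iota> w) f x) = Mp (cond_image Z X r \<iota> w) f (r (Dom G f) x)"
    using set_cond_diagram[OF Z Dom_Ob[OF f]] is_reductionD(2)[OF r f] by auto
qed simp

text \<open>Everything is pulled back to the initial space of \<open>Z\<close>. There conditioning
  on \<open>u\<close> is conditioning on a union of fibres of the leg to \<open>\<iota>\<close>,
  which splits over the atoms \<open>w\<close> above \<open>u\<close>.\<close>

lemma cond_diagram_mixture:
  assumes Z: "is_diagram G Z" "is_reduction G Z X r" "\<iota> \<in> Ob G" and X: "is_diagram G X"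
    and u: "u \<in> set_pmf (Sp X \<iota>)" and i: "i \<in> Ob G"
  shows "bind_pmf (cond_pmf (Sp Z \<iota>) (r \<iota> -` {u})) (\<lambda>w. Sp (cond_image Z X r \<iota> w) i) =
         Sp (cond_diagram G X \<iota> u) i"
    and "Sp (cond_diagram G X \<iota> u) i =
         map_pmf (\<lambda>x. r i (leg Z i x)) (cond_pmf (Sp Z \<Omega>) ((\<lambda>x. r \<iota> (leg Z \<iota> x)) -` {u}))"
proof -
  let ?P = "Sp Z \<Omega>" and ?S = "(r \<iota> \<circ> leg Z \<iota>) -` {u}"
  have mapP: "map_pmf (r \<Omega>) ?P = Sp X \<Omega>"
    using is_reductionD(1)[OF Z(2) initial_Ob[OF i]] .
  have "u \<in> set_pmf (map_pmf (r \<iota>) (map_pmf (leg Z \<iota>) ?P))"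
    using u is_reductionD(1)[OF Z(2,3)] map_leg[OF Z(1,3)] by simp
  then have ne: "set_pmf ?P \<inter> ?S \<noteq> {}" by auto
  \<comment> \<open>Naturality of \<open>r\<close> holds almost everywhere, so the two descriptions
    of the event agree on the support only.\<close>
  have eqS: "set_pmf ?P \<inter> r \<Omega> -` leg X \<iota> -` {u} = set_pmf ?P \<inter> ?S"
    using reduction_leg[OF Z(2,3)] by auto
  have "cond_pmf (Sp X \<Omega>) (leg X \<iota> -` {u}) = map_pmf (r \<Omega>) (cond_pmf ?P (r \<Omega> -` leg X \<iota> -` {u}))"
    unfolding mapP[symmetric] by (rule cond_map_pmf) (use ne eqS in auto)
  also have "\<dots> = map_pmf (r \<Omega>) (cond_pmf ?P ?S)"
    using cond_pmf_cong[OF eqS] ne eqS by simp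
  finally have "Sp (cond_diagram G X \<iota> u) i = map_pmf (\<lambda>x. leg X i (r \<Omega> x)) (cond_pmf ?P ?S)"
    by (simp add: map_pmf_comp)
  also have "\<dots> = map_pmf (\<lambda>x. r i (leg Z i x)) (cond_pmf ?P ?S)"
    by (intro map_pmf_cong refl) (use ne reduction_leg[OF Z(2) i] in auto)
  finally have *: "Sp (cond_diagram G X \<iota> u) i = map_pmf (\<lambda>x. r i (leg Z i x)) (cond_pmf ?P ?S)" .
  then show "Sp (cond_diagram G X \<iota> u) i =
         map_pmf (\<lambda>x. r i (leg Z i x)) (cond_pmf (Sp Z \<Omega>) ((\<lambda>x. r \<iota> (leg Z \<iota> x)) -` {u}))"
    by (simp add: o_def)
  have "bind_pmf (cond_pmf (Sp Z \<iota>) (r \<iota> -` {u})) (\<lambda>w. Sp (cond_image Z X r \<iota> w) i) =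
    map_pmf (\<lambda>x. r i (leg Z i x))
      (bind_pmf (cond_pmf (Sp Z \<iota>) (r \<iota> -` {u})) (\<lambda>w. cond_pmf ?P (leg Z \<iota> -` {w})))"
    by (simp add: map_bind_pmf map_pmf_comp)
  also have "\<dots> = map_pmf (\<lambda>x. r i (leg Z i x)) (cond_pmf ?P ?S)"
    using bind_cond_pmf_refine[OF ne] map_leg[OF Z(1,3)] by simp
  finally show "bind_pmf (cond_pmf (Sp Z \<iota>) (r \<iota> -` {u})) (\<lambda>w. Sp (cond_image Z X r \<iota> w) i) =
         Sp (cond_diagram G X \<iota> u) i"
    using * by simp
qed

lemma diagram_power: "is_diagram G X \<Longrightarrow> is_diagram G (tensor_power X n)"
  by (simp add: tensor_power_def diagram_tensor)

text \<open>An atom of the power space is a tuple of atoms, so one conditions independent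
  coordinates on a product event and \<open>Pi_pmf_cond\<close> applies.\<close>

lemma cond_diagram_power:
  assumes X: "is_diagram G X" "\<iota> \<in> Ob G" and v: "v \<in> set_pmf (Sp (tensor_power X n) \<iota>)"
  shows "Sp (cond_diagram G (tensor_power X n) \<iota> v) i =
           Sp (tensor {..<n} (\<lambda>l. cond_diagram G X \<iota> (v l))) i" (is ?Sp)
    and "Mp (cond_diagram G (tensor_power X n) \<iota> v) =
           Mp (tensor {..<n} (\<lambda>l. cond_diagram G X \<iota> (v l)))"
    and "l < n \<Longrightarrow> v l \<in> set_pmf (Sp X \<iota>)"
proof -
  let ?J = "{..<n}" and ?C = "\<lambda>l. cond_pmf (Sp X \<Omega>) (leg X \<iota> -` {v l})"
  have v': "v l \<in> set_pmf (Sp X \<iota>)" if "l < n" for l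
    using v that by (auto simp: tensor_power_def set_Pi_pmf PiE_dflt_def)
  then show "l < n \<Longrightarrow> v l \<in> set_pmf (Sp X \<iota>)" .
  have out: "v l = undefined" if "\<not> l < n" for l
    using v that by (auto simp: tensor_power_def set_Pi_pmf PiE_dflt_def)
  have legs: "leg (tensor_power X n) j x = restrict (\<lambda>l. leg X j (x l)) ?J" for j x
    by (simp add: tensor_power_def)
  have ne: "set_pmf (Sp X \<Omega>) \<inter> leg X \<iota> -` {v l} \<noteq> {}" if "l \<in> ?J" for l
    using cond_nonempty[OF X v'] that by simp
  \<comment> \<open>Outside \<open>?J\<close> both the leg and the atom \<open>v\<close> take the
    value \<open>undefined\<close>, so the event constrains only the coordinates in
    \<open>?J\<close>.\<close>
  have "leg (tensor_power X n) \<iota> -` {v} = {x. \<forall>l\<in>?J. x l \<in> leg X \<iota> -` {v l}}"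
    using out by (auto simp: legs fun_eq_iff restrict_def)
  then have "Sp (cond_diagram G (tensor_power X n) \<iota> v) i =
      map_pmf (\<lambda>x l. if l \<in> ?J then leg X i (x l) else undefined) (Pi_pmf ?J undefined ?C)"
    using Pi_pmf_cond[of ?J "\<lambda>_. Sp X \<Omega>" "\<lambda>l. leg X \<iota> -` {v l}" undefined] ne
    by (simp add: tensor_power_def tensor_def restrict_def)
  also have "\<dots> = Pi_pmf ?J undefined (\<lambda>l. map_pmf (leg X i) (?C l))"
  proof (rule Pi_pmf_blocks[where B = "\<lambda>l. {l}"])
    fix l assume "l \<in> ?J"
    have "map_pmf (\<lambda>x. leg X i (x l)) (Pi_pmf {l} undefined ?C) =
        map_pmf (leg X i) (map_pmf (\<lambda>x. x l) (Pi_pmf {l} undefined ?C))"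
      by (simp only: map_pmf_comp)
    then show "map_pmf (\<lambda>x. leg X i (x l)) (Pi_pmf {l} undefined ?C) = map_pmf (leg X i) (?C l)"
      by (simp add: Pi_pmf_component)
  qed (auto simp: disjoint_family_on_def)
  finally show ?Sp by simp
  show "Mp (cond_diagram G (tensor_power X n) \<iota> v) = Mp (tensor {..<n} (\<lambda>l. cond_diagram G X \<iota> (v l)))"
    by (simp add: fun_eq_iff tensor_power_def)
qed

end

section \<open>Tensor products of conditioned diagrams\<close>

text \<open>Each label \<open>w\<close> owns the slots \<open>{w} \<times> {..<m w}\<close>. Items
  with different labels cannot collide, so an injection for each label is enough.\<close>

lemma ex_labelled_injection:
  assumes "finite J" "l ` J \<subseteq> S" "\<And>w. w \<in> S \<Longrightarrow> card {j \<in> J. l j = w} \<le> m w"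
  shows "\<exists>\<pi>. inj_on \<pi> J \<and> \<pi> ` J \<subseteq> Sigma S (\<lambda>w. {..<m w}) \<and> (\<forall>j\<in>J. fst (\<pi> j) = l j)"
proof -
  have "\<forall>w\<in>S. \<exists>h. inj_on h {j \<in> J. l j = w} \<and> h ` {j \<in> J. l j = w} \<subseteq> {..<m w}"
  proof
    fix w assume "w \<in> S"
    then show "\<exists>h. inj_on h {j \<in> J. l j = w} \<and> h ` {j \<in> J. l j = w} \<subseteq> {..<m w}"
      using card_le_inj[of "{j \<in> J. l j = w}" "{..<m w}"] assms by auto
  qed
  then obtain h where h: "\<And>w. w \<in> S \<Longrightarrow> inj_on (h w) {j \<in> J. l j = w}"
    "\<And>w. w \<in> S \<Longrightarrow> h w ` {j \<in> J. l j = w} \<subseteq> {..<m w}"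
    by metis
  show ?thesis
  proof (intro exI[of _ "\<lambda>j. (l j, h (l j) j)"] conjI)
    show "inj_on (\<lambda>j. (l j, h (l j) j)) J"
      using h(1) assms(2) by (auto simp: inj_on_def)
    show "(\<lambda>j. (l j, h (l j) j)) ` J \<subseteq> Sigma S (\<lambda>w. {..<m w})"
      using h(2) assms(2) by (force simp: image_subset_iff)
  qed auto
qed

text \<open>A flat form of \<open>trop_cond\<close> with free multiplicities, because counts other
  than the floors occur: those of random lifts and those coming from powers.\<close>

definition cond_tensor ::
  "('o, 'm) cat \<Rightarrow> ('o, 'm, 'a) diagram \<Rightarrow> 'o \<Rightarrow> ('a \<Rightarrow> nat) \<Rightarrow> ('o, 'm, 'a \<times> nat \<Rightarrow> 'a) diagram" where
  "cond_tensor G X \<iota> c =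
     tensor (Sigma (set_pmf (Sp X \<iota>)) (\<lambda>u. {..<c u})) (\<lambda>z. cond_diagram G X \<iota> (fst z))"

context indexing_category
begin

lemma diagram_cond_tensor:
  assumes "is_diagram G X" "\<iota> \<in> Ob G"
  shows "is_diagram G (cond_tensor G X \<iota> c)"
  unfolding cond_tensor_def using is_diagramD(1)[OF assms]
  by (intro diagram_tensor) (auto intro!: diagram_cond assms)

lemma total_ent_cond_tensor:
  assumes "is_diagram G X" "\<iota> \<in> Ob G"
  shows "total_ent G (cond_tensor G X \<iota> c) =
    (\<Sum>u\<in>set_pmf (Sp X \<iota>). real (c u) * total_ent G (cond_diagram G X \<iota> u))"
proof -
  have "total_ent G (cond_tensor G X \<iota> c) =
      (\<Sum>z\<in>Sigma (set_pmf (Sp X \<iota>)) (\<lambda>u. {..<c u}). total_ent G (cond_diagram G X \<iota> (fst z)))"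
    unfolding cond_tensor_def using is_diagramD(1)[OF assms]
    by (intro total_ent_tensor) (auto intro!: diagram_cond assms)
  also have "\<dots> = (\<Sum>u\<in>set_pmf (Sp X \<iota>). \<Sum>k<c u. total_ent G (cond_diagram G X \<iota> u))"
    using is_diagramD(1)[OF assms] by (subst sum.Sigma) (auto simp: split_def)
  finally show ?thesis by simp
qed

text \<open>Every factor labelled \<open>u\<close> gets a private copy of the diagram conditioned on
  \<open>u\<close>, and surplus copies are dropped.\<close>

lemma cond_tensor_reduction:
  assumes X: "is_diagram G X" "\<iota> \<in> Ob G"
    and J: "finite J" "l ` J \<subseteq> set_pmf (Sp X \<iota>)"
      "\<And>u. u \<in> set_pmf (Sp X \<iota>) \<Longrightarrow> card {j \<in> J. l j = u} \<le> c u"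
    and red: "\<And>j. j \<in> J \<Longrightarrow> is_reduction G (cond_diagram G X \<iota> (l j)) (A j) (r j)"
  shows "\<exists>s. is_reduction G (cond_tensor G X \<iota> c) (tensor J A) s"
proof -
  obtain \<pi> where \<pi>: "inj_on \<pi> J" "\<pi> ` J \<subseteq> Sigma (set_pmf (Sp X \<iota>)) (\<lambda>w. {..<c w})"
    "\<And>j. j \<in> J \<Longrightarrow> fst (\<pi> j) = l j"
    using ex_labelled_injection[OF J] by blast
  have "is_reduction G (cond_tensor G X \<iota> c) (tensor J A)
     (\<lambda>i x. restrict (\<lambda>j. r j i (x (\<pi> j))) J)"
    unfolding cond_tensor_def using is_diagramD(1)[OF X] J(1) \<pi> red
    by (intro reduction_tensor_inj) auto
  then show ?thesis by blast
qed

lemma reduction_cond_tensor: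
  assumes X: "is_diagram G X" "\<iota> \<in> Ob G" and J: "finite J"
    and c: "\<And>u. u \<in> set_pmf (Sp X \<iota>) \<Longrightarrow> c u \<le> card {j \<in> J. l j = u}"
  shows "\<exists>s. is_reduction G (tensor J (\<lambda>j. cond_diagram G X \<iota> (l j))) (cond_tensor G X \<iota> c) s"
proof -
  have "\<exists>h. \<forall>u\<in>set_pmf (Sp X \<iota>). inj_on (h u) {..<c u} \<and> h u ` {..<c u} \<subseteq> {j \<in> J. l j = u}"
  proof (intro bchoice ballI)
    fix u assume "u \<in> set_pmf (Sp X \<iota>)"
    then show "\<exists>h. inj_on h {..<c u} \<and> h ` {..<c u} \<subseteq> {j \<in> J. l j = u}"
      using card_le_inj[of "{..<c u}" "{j \<in> J. l j = u}"] c J by auto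
  qed
  then obtain h where h: "\<And>u. u \<in> set_pmf (Sp X \<iota>) \<Longrightarrow> inj_on (h u) {..<c u}"
    "\<And>u. u \<in> set_pmf (Sp X \<iota>) \<Longrightarrow> h u ` {..<c u} \<subseteq> {j \<in> J. l j = u}"
    by blast
  let ?\<pi> = "\<lambda>z. h (fst z) (snd z)"
  have h': "h u k \<in> J" "l (h u k) = u" if "u \<in> set_pmf (Sp X \<iota>)" "k < c u" for u k
    using h(2)[OF that(1)] that(2) by auto
  have "is_reduction G (tensor J (\<lambda>j. cond_diagram G X \<iota> (l j))) (cond_tensor G X \<iota> c)
     (\<lambda>i x. restrict (\<lambda>z. x (?\<pi> z)) (Sigma (set_pmf (Sp X \<iota>)) (\<lambda>u. {..<c u})))"
    unfolding cond_tensor_def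
  proof (rule reduction_tensor_inj[where r = "\<lambda>j i x. x"])
    show "inj_on ?\<pi> (Sigma (set_pmf (Sp X \<iota>)) (\<lambda>u. {..<c u}))"
    proof (rule inj_onI, clarsimp)
      fix u k v m assume *: "u \<in> set_pmf (Sp X \<iota>)" "k < c u" "v \<in> set_pmf (Sp X \<iota>)" "m < c v" "h u k = h v m"
      then have "u = v" using h'(2) by metis
      with * h(1) show "u = v \<and> k = m" by (auto simp: inj_on_def)
    qed
  qed (use is_diagramD(1)[OF X] J h' reduction_id in auto)
  then show ?thesis by blast
qed

end

section \<open>Existence of the limits\<close>

text \<open>Adding the defect \<open>C\<close> once makes the sequence truly subadditive, and
  division by \<open>n\<close> removes it again. The limit is the infimum of the quotients, as in
  Fekete's lemma.\<close>

lemma fekete_convergent: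
  fixes a :: "nat \<Rightarrow> real"
  assumes nonneg: "\<And>n. 0 \<le> a n" and C: "0 \<le> C" and sub: "\<And>m n. a (m + n) \<le> a m + a n + C"
  shows "convergent (\<lambda>n. a n / real n)"
proof -
  define b where "b n = a n + C" for n
  have b: "0 \<le> b n" "b (m + n) \<le> b m + b n" for m n
    using nonneg C sub[of m n] by (auto simp: b_def)
  define L where "L = (INF n\<in>{1..}. b n / real n)"
  have bdd: "bdd_below ((\<lambda>n. b n / real n) ` {1..})"
    by (rule bdd_belowI2[of _ 0]) (simp add: b)
  have L_le: "L \<le> b n / real n" if "n \<ge> 1" for n
    unfolding L_def by (rule cINF_lower[OF bdd]) (use that in simp)
  have mult: "b (q * m + s) \<le> real q * b m + b s" for q m s
  proof (induction q)
    case (Suc q)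
    have "b (Suc q * m + s) \<le> b m + b (q * m + s)"
      using b(2)[of m "q * m + s"] by (simp add: add.assoc)
    with Suc show ?case by (simp add: algebra_simps)
  qed simp
  have "(\<lambda>n. b n / real n) \<longlonglongrightarrow> L"
  proof (rule LIMSEQ_I)
    fix e :: real assume e: "0 < e"
    have "\<exists>x\<in>(\<lambda>n. b n / real n) ` {1..}. x < L + e / 2"
      unfolding L_def by (rule cInf_lessD[unfolded bex_simps]) (use e in auto)
    then obtain m where m: "m \<ge> 1" "b m / real m < L + e / 2" by auto
    \<comment> \<open>A common bound for the remainder terms \<open>b (n mod m)\<close>, which are
      all nonnegative.\<close>
    define M where "M = (\<Sum>s<m. b s)"
    have M: "b s \<le> M" if "s < m" for s
      unfolding M_def by (rule member_le_sum) (use that b in auto)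
    obtain n0 :: nat where n0: "M / (e / 2) < real n0"
      using reals_Archimedean2 by blast
    show "\<exists>no. \<forall>n\<ge>no. norm (b n / real n - L) < e"
    proof (intro exI allI impI)
      fix n assume "max n0 1 \<le> n"
      then have n: "n0 \<le> n" "1 \<le> n" by auto
      have "b n \<le> real (n div m) * b m + b (n mod m)"
        using mult[of "n div m" m "n mod m"] by simp
      also have "\<dots> \<le> real (n div m) * b m + M"
        using M[of "n mod m"] m by simp
      also have "real (n div m) * b m = real (n div m * m) * (b m / real m)"
        using m by simp
      also have "\<dots> \<le> real n * (b m / real m)"
        by (intro mult_right_mono) (auto simp: b simp del: of_nat_mult)
      finally have "b n / real n \<le> b m / real m + M / real n"
        using n by (simp add: field_simps)
      moreover have "M / real n < e / 2"
      proof -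
        have "M / (e / 2) < real n" using n0 n by linarith
        then show ?thesis using e n by (simp add: field_simps)
      qed
      ultimately show "norm (b n / real n - L) < e"
        using m(2) L_le[OF n(2)] unfolding real_norm_def by linarith
    qed
  qed
  moreover have "(\<lambda>n. C / real n) \<longlonglongrightarrow> 0"
    by (rule lim_const_over_n)
  ultimately have "(\<lambda>n. b n / real n - C / real n) \<longlonglongrightarrow> L - 0"
    by (rule tendsto_diff)
  then show ?thesis
    by (auto simp: b_def convergent_def diff_divide_distrib[symmetric])
qed

context indexing_category
begin

lemma entropy_dist_power_add:
  assumes X: "is_diagram G X" and Y: "is_diagram G Y"
  shows "entropy_dist G (tensor_power X (m + n)) (tensor_power Y (m + n)) \<le>
    entropy_dist G (tensor_power X m) (tensor_power Y m) + entropy_dist G (tensor_power X n) (tensor_power Y n)"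
proof -
  have split: "{..<m + n} = {..<m} \<union> {m..<m + n}" by auto
  \<comment> \<open>The second group of factors carries the indices \<open>m..<m + n\<close>, so the
    power has to be moved there before the union is split.\<close>
  have shift: "is_reduction G (tensor_power V n) (tensor {m..<m + n} (\<lambda>_. V))
      (\<lambda>i x. restrict (\<lambda>j. x (j - m)) {m..<m + n})" for V :: "('o, 'm, 'v) diagram"
    unfolding tensor_power_def
    by (rule reduction_tensor_inj[where r = "\<lambda>j i x. x"]) (auto simp: inj_on_def reduction_id)
  have ent: "total_ent G (tensor {m..<m + n} (\<lambda>_. V)) = total_ent G (tensor_power V n)"
    if "is_diagram G V" for V :: "('o, 'm, 'v) diagram"
    using that by (simp add: tensor_power_def total_ent_tensor)
  have "entropy_dist G (tensor {m..<m + n} (\<lambda>_. X)) (tensor {m..<m + n} (\<lambda>_. Y)) \<le>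
    entropy_dist G (tensor_power X n) (tensor_power Y n)"
    by (rule entropy_dist_reduction[OF diagram_power[OF X] shift diagram_power[OF Y] shift])
      (simp_all add: ent X Y)
  moreover have "entropy_dist G (tensor_power X (m + n)) (tensor_power Y (m + n)) \<le>
    entropy_dist G (tensor_power X m) (tensor_power Y m) +
    entropy_dist G (tensor {m..<m + n} (\<lambda>_. X)) (tensor {m..<m + n} (\<lambda>_. Y))"
    unfolding tensor_power_def split
    by (rule entropy_dist_tensor_Un) (use X Y in auto)
  ultimately show ?thesis by simp
qed

lemma asymp_entropy_dist_tendsto:
  assumes X: "is_diagram G X" and Y: "is_diagram G Y"
  shows "(\<lambda>n. entropy_dist G (tensor_power X n) (tensor_power Y n) / real n) \<longlonglongrightarrow> asymp_entropy_dist G X Y"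
  unfolding asymp_entropy_dist_def asymp_dist_def convergent_LIMSEQ_iff[symmetric]
  by (rule fekete_convergent[where C = 0])
    (use entropy_dist_power_add[OF assms] entropy_dist_nonneg[OF diagram_power[OF X] diagram_power[OF Y]] in auto)

section \<open>Subadditivity and stability in the multiplicities\<close>

lemma total_ent_labelled:
  assumes X: "is_diagram G X" "\<iota> \<in> Ob G" and J: "finite J" "l ` J \<subseteq> set_pmf (Sp X \<iota>)"
  shows "total_ent G (tensor J (\<lambda>j. cond_diagram G X \<iota> (l j))) =
    (\<Sum>u\<in>set_pmf (Sp X \<iota>). real (card {j \<in> J. l j = u}) * total_ent G (cond_diagram G X \<iota> u))"
proof -
  have "total_ent G (tensor J (\<lambda>j. cond_diagram G X \<iota> (l j))) =
      (\<Sum>j\<in>J. total_ent G (cond_diagram G X \<iota> (l j)))"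
    using J by (intro total_ent_tensor) (auto intro!: diagram_cond X)
  also have "\<dots> = (\<Sum>u\<in>set_pmf (Sp X \<iota>). \<Sum>j\<in>{j \<in> J. l j = u}. total_ent G (cond_diagram G X \<iota> (l j)))"
    by (rule sum.group[symmetric]) (use J is_diagramD(1)[OF X] in auto)
  also have "\<dots> = (\<Sum>u\<in>set_pmf (Sp X \<iota>). real (card {j \<in> J. l j = u}) * total_ent G (cond_diagram G X \<iota> u))"
    by (intro sum.cong refl) simp
  finally show ?thesis .
qed

text \<open>Raising the multiplicities from \<open>c\<close> to \<open>c + d\<close> adds exactly
  the slots in \<open>I\<close>; up to renumbering they form the tensor with multiplicities
  \<open>d\<close>.\<close>

lemma cond_tensor_block:
  fixes X :: "('o, 'm, 'a) diagram" and c d :: "'a \<Rightarrow> nat"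
  assumes X: "is_diagram G X" "\<iota> \<in> Ob G"
  defines "I \<equiv> Sigma (set_pmf (Sp X \<iota>)) (\<lambda>u. {c u..<c u + d u})"
  shows "finite I"
    and "\<exists>s. is_reduction G (cond_tensor G X \<iota> d) (tensor I (\<lambda>z. cond_diagram G X \<iota> (fst z))) s"
    and "total_ent G (tensor I (\<lambda>z. cond_diagram G X \<iota> (fst z))) = total_ent G (cond_tensor G X \<iota> d)"
proof -
  show fin: "finite I" using is_diagramD(1)[OF X] by (auto simp: I_def)
  have lab: "fst ` I \<subseteq> set_pmf (Sp X \<iota>)" by (auto simp: I_def)
  have count: "card {z \<in> I. fst z = u} = d u" if "u \<in> set_pmf (Sp X \<iota>)" for u
  proof -
    have "{z \<in> I. fst z = u} = {u} \<times> {c u..<c u + d u}" using that by (auto simp: I_def)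
    then show ?thesis by (simp add: card_cartesian_product)
  qed
  show "\<exists>s. is_reduction G (cond_tensor G X \<iota> d) (tensor I (\<lambda>z. cond_diagram G X \<iota> (fst z))) s"
    by (rule cond_tensor_reduction[OF X fin lab]) (auto simp: count intro!: reduction_id)
  show "total_ent G (tensor I (\<lambda>z. cond_diagram G X \<iota> (fst z))) = total_ent G (cond_tensor G X \<iota> d)"
    by (simp add: total_ent_labelled[OF X fin lab] total_ent_cond_tensor[OF X] count)
qed

lemma entropy_dist_cond_tensor_add:
  assumes X: "is_diagram G X" "\<iota> \<in> Ob G" and Y: "is_diagram G Y" "\<iota>' \<in> Ob G"
  shows "entropy_dist G (cond_tensor G X \<iota> (\<lambda>u. c u + d u)) (cond_tensor G Y \<iota>' (\<lambda>u. c' u + d' u)) \<le>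
    entropy_dist G (cond_tensor G X \<iota> c) (cond_tensor G Y \<iota>' c') +
    entropy_dist G (cond_tensor G X \<iota> d) (cond_tensor G Y \<iota>' d')"
proof -
  let ?I = "Sigma (set_pmf (Sp X \<iota>)) (\<lambda>u. {c u..<c u + d u})"
  let ?I' = "Sigma (set_pmf (Sp Y \<iota>')) (\<lambda>u. {c' u..<c' u + d' u})"
  have split:
    "Sigma (set_pmf (Sp X \<iota>)) (\<lambda>u. {..<c u + d u}) = Sigma (set_pmf (Sp X \<iota>)) (\<lambda>u. {..<c u}) \<union> ?I"
    "Sigma (set_pmf (Sp Y \<iota>')) (\<lambda>u. {..<c' u + d' u}) = Sigma (set_pmf (Sp Y \<iota>')) (\<lambda>u. {..<c' u}) \<union> ?I'"
    by auto
  obtain s where s: "is_reduction G (cond_tensor G X \<iota> d) (tensor ?I (\<lambda>z. cond_diagram G X \<iota> (fst z))) s"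
    using cond_tensor_block(2)[OF X, of d c] by (elim exE)
  obtain s' where s': "is_reduction G (cond_tensor G Y \<iota>' d') (tensor ?I' (\<lambda>z. cond_diagram G Y \<iota>' (fst z))) s'"
    using cond_tensor_block(2)[OF Y, of d' c'] by (elim exE)
  have "entropy_dist G (tensor ?I (\<lambda>z. cond_diagram G X \<iota> (fst z)))
      (tensor ?I' (\<lambda>z. cond_diagram G Y \<iota>' (fst z))) \<le>
    entropy_dist G (cond_tensor G X \<iota> d) (cond_tensor G Y \<iota>' d')"
    by (rule entropy_dist_reduction[OF diagram_cond_tensor[OF X] s diagram_cond_tensor[OF Y] s'
          cond_tensor_block(3)[OF X] cond_tensor_block(3)[OF Y]])
  moreover have "entropy_dist G (cond_tensor G X \<iota> (\<lambda>u. c u + d u)) (cond_tensor G Y \<iota>' (\<lambda>u. c' u + d' u)) \<le>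
    entropy_dist G (cond_tensor G X \<iota> c) (cond_tensor G Y \<iota>' c') +
    entropy_dist G (tensor ?I (\<lambda>z. cond_diagram G X \<iota> (fst z)))
      (tensor ?I' (\<lambda>z. cond_diagram G Y \<iota>' (fst z)))"
    unfolding cond_tensor_def split
    by (rule entropy_dist_tensor_Un)
      (use is_diagramD(1)[OF X] is_diagramD(1)[OF Y] in \<open>auto intro!: diagram_cond X Y\<close>)
  ultimately show ?thesis by simp
qed

lemma cond_tensor_cong:
  assumes "\<And>u. u \<in> set_pmf (Sp X \<iota>) \<Longrightarrow> c u = d u"
  shows "cond_tensor G X \<iota> c = cond_tensor G X \<iota> d"
  unfolding cond_tensor_def using assms by (metis (no_types, lifting) SigmaE Sigma_cong)

text \<open>The surplus copies are coupled independently, which costs at most their total entropy.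
  The bound does not depend on the size of the counts, so it absorbs all rounding.\<close>

lemma entropy_dist_cond_tensor_le:
  assumes X: "is_diagram G X" "\<iota> \<in> Ob G" and Y: "is_diagram G Y" "\<iota>' \<in> Ob G"
    and c: "\<And>u. u \<in> set_pmf (Sp X \<iota>) \<Longrightarrow> c u \<le> e u \<and> e u \<le> c u + D"
    and c': "\<And>v. v \<in> set_pmf (Sp Y \<iota>') \<Longrightarrow> c' v \<le> e' v \<and> e' v \<le> c' v + D'"
  shows "entropy_dist G (cond_tensor G X \<iota> e) (cond_tensor G Y \<iota>' e') \<le>
    entropy_dist G (cond_tensor G X \<iota> c) (cond_tensor G Y \<iota>' c') +
    (real D * (\<Sum>u\<in>set_pmf (Sp X \<iota>). total_ent G (cond_diagram G X \<iota> u)) +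
     real D' * (\<Sum>v\<in>set_pmf (Sp Y \<iota>'). total_ent G (cond_diagram G Y \<iota>' v)))"
proof -
  define d d' where "d u = e u - c u" and "d' v = e' v - c' v" for u v
  have e: "cond_tensor G X \<iota> e = cond_tensor G X \<iota> (\<lambda>u. c u + d u)"
    by (rule cond_tensor_cong) (use c in \<open>simp add: d_def\<close>)
  have e': "cond_tensor G Y \<iota>' e' = cond_tensor G Y \<iota>' (\<lambda>u. c' u + d' u)"
    by (rule cond_tensor_cong) (use c' in \<open>simp add: d'_def\<close>)
  have "d u \<le> D" if "u \<in> set_pmf (Sp X \<iota>)" for u using c[OF that] by (auto simp: d_def)
  then have "total_ent G (cond_tensor G X \<iota> d) \<le> real D * (\<Sum>u\<in>set_pmf (Sp X \<iota>). total_ent G (cond_diagram G X \<iota> u))"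
    unfolding total_ent_cond_tensor[OF X] sum_distrib_left
    by (intro sum_mono mult_right_mono total_ent_nonneg) auto
  moreover have "d' u \<le> D'" if "u \<in> set_pmf (Sp Y \<iota>')" for u using c'[OF that] by (auto simp: d'_def)
  then have "total_ent G (cond_tensor G Y \<iota>' d') \<le> real D' * (\<Sum>u\<in>set_pmf (Sp Y \<iota>'). total_ent G (cond_diagram G Y \<iota>' u))"
    unfolding total_ent_cond_tensor[OF Y] sum_distrib_left
    by (intro sum_mono mult_right_mono total_ent_nonneg) auto
  ultimately show ?thesis
    unfolding e e'
    using entropy_dist_cond_tensor_add[OF X Y, of c d c' d']
      entropy_dist_le_total_ent[OF diagram_cond_tensor[OF X, of d] diagram_cond_tensor[OF Y, of d']]
    by linarith
qed

end

section \<open>Atom counts and the tropical sequences\<close>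

definition atom_count :: "('o, 'm, 'a) diagram \<Rightarrow> 'o \<Rightarrow> nat \<Rightarrow> 'a \<Rightarrow> nat" where
  "atom_count X \<iota> n u = nat \<lfloor>real n * pmf (Sp X \<iota>) u\<rfloor>"

lemma atom_count_bounds:
  shows "real (atom_count X \<iota> n u) \<le> real n * pmf (Sp X \<iota>) u"
    and "real n * pmf (Sp X \<iota>) u < real (atom_count X \<iota> n u) + 1"
  unfolding atom_count_def by (simp_all add: of_nat_floor)

lemma atom_count_add:
  "atom_count X \<iota> m u + atom_count X \<iota> n u \<le> atom_count X \<iota> (m + n) u"
  "atom_count X \<iota> (m + n) u \<le> atom_count X \<iota> m u + atom_count X \<iota> n u + 1"
proof -
  have "real (m + n) * pmf (Sp X \<iota>) u = real m * pmf (Sp X \<iota>) u + real n * pmf (Sp X \<iota>) u"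
    by (simp add: algebra_simps)
  \<comment> \<open>Strict real inequalities become integer ones, so the slack is one larger here
    than in the claims: 1 for 0 and 2 for 1.\<close>
  then have "real (atom_count X \<iota> m u + atom_count X \<iota> n u) < real (atom_count X \<iota> (m + n) u + 1)"
    "real (atom_count X \<iota> (m + n) u) < real (atom_count X \<iota> m u + atom_count X \<iota> n u + 2)"
    using atom_count_bounds(1)[of X \<iota> m u] atom_count_bounds(1)[of X \<iota> n u]
      atom_count_bounds(1)[of X \<iota> "m + n" u] atom_count_bounds(2)[of m X \<iota> u]
      atom_count_bounds(2)[of n X \<iota> u] atom_count_bounds(2)[of "m + n" X \<iota> u]
    by simp_all
  then show "atom_count X \<iota> m u + atom_count X \<iota> n u \<le> atom_count X \<iota> (m + n) u"
    "atom_count X \<iota> (m + n) u \<le> atom_count X \<iota> m u + atom_count X \<iota> n u + 1"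
    unfolding of_nat_less_iff by simp_all
qed

context indexing_category
begin

lemma diagram_trop_cond:
  assumes "is_diagram G X" "\<iota> \<in> Ob G"
  shows "is_diagram G (trop_cond G X \<iota> n)"
  unfolding trop_cond_def using is_diagramD(1)[OF assms]
  by (intro diagram_tensor diagram_power diagram_cond assms)

lemma reduction_trop_cond:
  assumes "is_diagram G X" "\<iota> \<in> Ob G"
  shows "\<exists>r. is_reduction G (trop_cond G X \<iota> n) (cond_tensor G X \<iota> (atom_count X \<iota> n)) r"
    and "\<exists>r. is_reduction G (cond_tensor G X \<iota> (atom_count X \<iota> n)) (trop_cond G X \<iota> n) r"
proof -
  note fin = is_diagramD(1)[OF assms] finite_lessThan
  show "\<exists>r. is_reduction G (trop_cond G X \<iota> n) (cond_tensor G X \<iota> (atom_count X \<iota> n)) r"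
    unfolding trop_cond_def tensor_power_def cond_tensor_def atom_count_def
    by (rule exI, rule reduction_tensor_uncurry[OF fin, where D = "\<lambda>u _. cond_diagram G X \<iota> u"])
  show "\<exists>r. is_reduction G (cond_tensor G X \<iota> (atom_count X \<iota> n)) (trop_cond G X \<iota> n) r"
    unfolding trop_cond_def tensor_power_def cond_tensor_def atom_count_def
    by (rule exI, rule reduction_tensor_curry[OF fin, where D = "\<lambda>u _. cond_diagram G X \<iota> u"])
qed

text \<open>Nested and flat forms reduce to each other, and total entropy cannot increase either
  way.\<close>

lemma total_ent_trop_cond:
  assumes "is_diagram G X" "\<iota> \<in> Ob G"
  shows "total_ent G (trop_cond G X \<iota> n) = total_ent G (cond_tensor G X \<iota> (atom_count X \<iota> n))"
  using reduction_trop_cond[OF assms, of n] diagram_cond_tensor[OF assms] diagram_trop_cond[OF assms]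
  by (meson antisym total_ent_reduction_le)

lemma entropy_dist_trop_cond:
  assumes X: "is_diagram G X" "\<iota> \<in> Ob G" and Y: "is_diagram G Y" "\<iota>' \<in> Ob G"
  shows "entropy_dist G (trop_cond G X \<iota> n) (trop_cond G Y \<iota>' n) =
    entropy_dist G (cond_tensor G X \<iota> (atom_count X \<iota> n)) (cond_tensor G Y \<iota>' (atom_count Y \<iota>' n))"
proof (rule antisym)
  obtain r s where "is_reduction G (cond_tensor G X \<iota> (atom_count X \<iota> n)) (trop_cond G X \<iota> n) r"
    "is_reduction G (cond_tensor G Y \<iota>' (atom_count Y \<iota>' n)) (trop_cond G Y \<iota>' n) s"
    using reduction_trop_cond(2)[OF X] reduction_trop_cond(2)[OF Y] by blast
  then show "entropy_dist G (trop_cond G X \<iota> n) (trop_cond G Y \<iota>' n) \<le>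
    entropy_dist G (cond_tensor G X \<iota> (atom_count X \<iota> n)) (cond_tensor G Y \<iota>' (atom_count Y \<iota>' n))"
    using X Y by (intro entropy_dist_reduction diagram_cond_tensor total_ent_trop_cond)
next
  obtain r s where "is_reduction G (trop_cond G X \<iota> n) (cond_tensor G X \<iota> (atom_count X \<iota> n)) r"
    "is_reduction G (trop_cond G Y \<iota>' n) (cond_tensor G Y \<iota>' (atom_count Y \<iota>' n)) s"
    using reduction_trop_cond(1)[OF X] reduction_trop_cond(1)[OF Y] by blast
  then show "entropy_dist G (cond_tensor G X \<iota> (atom_count X \<iota> n)) (cond_tensor G Y \<iota>' (atom_count Y \<iota>' n)) \<le>
    entropy_dist G (trop_cond G X \<iota> n) (trop_cond G Y \<iota>' n)"
    using X Y by (intro entropy_dist_reduction diagram_trop_cond total_ent_trop_cond[symmetric])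
qed

text \<open>Passing from \<open>m\<close> and \<open>n\<close> to \<open>m + n\<close> adds at most
  one copy per atom beyond the sum of the floors, so the subadditivity defect is bounded by one copy
  of each conditioned diagram.\<close>

lemma asymp_dist_trop_cond_tendsto:
  assumes X: "is_diagram G X" and Y: "is_diagram G Y" and \<iota>: "\<iota> \<in> Ob G"
  shows "(\<lambda>n. entropy_dist G (trop_cond G X \<iota> n) (trop_cond G Y \<iota> n) / real n) \<longlonglongrightarrow>
    asymp_dist G (trop_cond G X \<iota>) (trop_cond G Y \<iota>)"
  unfolding asymp_dist_def convergent_LIMSEQ_iff[symmetric]
proof (rule fekete_convergent)
  let ?a = "\<lambda>n. entropy_dist G (trop_cond G X \<iota> n) (trop_cond G Y \<iota> n)"
  let ?C = "(\<Sum>u\<in>set_pmf (Sp X \<iota>). total_ent G (cond_diagram G X \<iota> u)) +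
     (\<Sum>v\<in>set_pmf (Sp Y \<iota>). total_ent G (cond_diagram G Y \<iota> v))"
  show "0 \<le> ?a n" for n
    using X Y \<iota> by (intro entropy_dist_nonneg diagram_trop_cond)
  show "0 \<le> ?C" by (intro add_nonneg_nonneg sum_nonneg total_ent_nonneg)
  show "?a (m + n) \<le> ?a m + ?a n + ?C" for m n
  proof -
    have "?a (m + n) \<le> entropy_dist G
        (cond_tensor G X \<iota> (\<lambda>u. atom_count X \<iota> m u + atom_count X \<iota> n u))
        (cond_tensor G Y \<iota> (\<lambda>u. atom_count Y \<iota> m u + atom_count Y \<iota> n u)) +
        (real 1 * (\<Sum>u\<in>set_pmf (Sp X \<iota>). total_ent G (cond_diagram G X \<iota> u)) +
         real 1 * (\<Sum>v\<in>set_pmf (Sp Y \<iota>). total_ent G (cond_diagram G Y \<iota> v)))"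
      unfolding entropy_dist_trop_cond[OF X \<iota> Y \<iota>]
      by (intro entropy_dist_cond_tensor_le X Y \<iota> conjI atom_count_add)
    then show ?thesis
      using entropy_dist_cond_tensor_add[OF X \<iota> Y \<iota>, of "atom_count X \<iota> m" "atom_count X \<iota> n"
          "atom_count Y \<iota> m" "atom_count Y \<iota> n"]
      unfolding entropy_dist_trop_cond[OF X \<iota> Y \<iota>] by simp
  qed
qed

end

section \<open>Conditioning tensor powers\<close>

text \<open>Linearity of expectation: each of the \<open>N\<close> coordinates has law
  \<open>p\<close>.\<close>

lemma sum_pmf_power_card:
  fixes d :: 'a and N :: nat
  assumes fin: "finite (set_pmf p)"
  defines "P \<equiv> Pi_pmf {..<N} d (\<lambda>_. p)"
  shows "(\<Sum>f\<in>set_pmf P. pmf P f * real (card {l \<in> {..<N}. f l = u})) = real N * pmf p u"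
proof -
  have finP: "finite (set_pmf P)" unfolding P_def by (rule finite_set_Pi_pmf) (use fin in auto)
  have card: "real (card {l \<in> {..<N}. f l = u}) = (\<Sum>l<N. indicator {u} (f l))" for f :: "nat \<Rightarrow> 'a"
    by (simp add: indicator_def sum.If_cases Int_def)
  have "(\<Sum>f\<in>set_pmf P. pmf P f * real (card {l \<in> {..<N}. f l = u})) =
      measure_pmf.expectation P (\<lambda>f. \<Sum>l<N. indicator {u} (f l))"
    unfolding card by (subst integral_measure_pmf_real[OF finP]) (auto simp: mult.commute)
  also have "\<dots> = (\<Sum>l<N. measure_pmf.expectation P (\<lambda>f. indicator {u} (f l)))"
    by (rule Bochner_Integration.integral_sum) (use finP in \<open>auto intro: integrable_measure_pmf_finite\<close>)
  also have "\<dots> = (\<Sum>l<N. pmf p u)"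
  proof (rule sum.cong[OF refl])
    fix l assume l: "l \<in> {..<N}"
    have "measure_pmf.expectation P (\<lambda>f. indicator {u} (f l)) =
        measure_pmf.expectation (map_pmf (\<lambda>f. f l) P) (indicator {u} :: _ \<Rightarrow> real)"
      by (rule integral_map_pmf[symmetric])
    also have "map_pmf (\<lambda>f. f l) P = p"
      using l by (simp add: P_def Pi_pmf_component)
    finally show "measure_pmf.expectation P (\<lambda>f. indicator {u} (f l)) = pmf p u"
      by (simp add: measure_pmf_single)
  qed
  finally show ?thesis by simp
qed

context indexing_category
begin

text \<open>How often \<open>X|u\<close> occurs after every factor of the \<open>n\<close>-th term
  for the \<open>N\<close>-th power is expanded into \<open>N\<close> conditioned copies of
  \<open>X\<close>.\<close>

definition power_count :: "('o, 'm, 'a) diagram \<Rightarrow> 'o \<Rightarrow> nat \<Rightarrow> nat \<Rightarrow> 'a \<Rightarrow> nat" where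
  "power_count X \<iota> N n u =
     (\<Sum>f\<in>set_pmf (Sp (tensor_power X N) \<iota>).
        atom_count (tensor_power X N) \<iota> n f * card {l \<in> {..<N}. f l = u})"

text \<open>Without floors both counts would be \<open>n * N\<close> times the weight of
  \<open>u\<close>. Taking floors on the power loses less than one factor per atom, and each factor
  contains at most \<open>N\<close> copies.\<close>

lemma power_count_bounds:
  assumes X: "is_diagram G X" "\<iota> \<in> Ob G"
  shows "power_count X \<iota> N n u \<le> atom_count X \<iota> (n * N) u"
    and "atom_count X \<iota> (n * N) u \<le> power_count X \<iota> N n u + card (set_pmf (Sp (tensor_power X N) \<iota>)) * N"
proof -
  let ?P = "Sp (tensor_power X N) \<iota>"
  let ?k = "\<lambda>f. real (card {l \<in> {..<N}. f l = u})"
  have eq: "(\<Sum>f\<in>set_pmf ?P. real n * pmf ?P f * ?k f) = real (n * N) * pmf (Sp X \<iota>) u"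
    using sum_pmf_power_card[OF is_diagramD(1)[OF X], of N undefined u]
    by (simp add: tensor_power_def sum_distrib_left[symmetric] mult.assoc)
  have k: "?k f \<le> real N" for f :: "nat \<Rightarrow> 'a"
    using card_mono[OF finite_lessThan[of N], of "{l \<in> {..<N}. f l = u}"] by fastforce
  have "real (power_count X \<iota> N n u) \<le> (\<Sum>f\<in>set_pmf ?P. real n * pmf ?P f * ?k f)"
    unfolding power_count_def of_nat_sum of_nat_mult
    by (intro sum_mono mult_right_mono atom_count_bounds) auto
  then have "real (power_count X \<iota> N n u) < real (atom_count X \<iota> (n * N) u + 1)"
    using atom_count_bounds(2)[of "n * N" X \<iota> u] unfolding eq by simp
  then show "power_count X \<iota> N n u \<le> atom_count X \<iota> (n * N) u"
    unfolding of_nat_less_iff by simp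
  have "real (atom_count X \<iota> (n * N) u) \<le> (\<Sum>f\<in>set_pmf ?P. real n * pmf ?P f * ?k f)"
    unfolding eq by (rule atom_count_bounds)
  also have "\<dots> \<le> (\<Sum>f\<in>set_pmf ?P. (real (atom_count (tensor_power X N) \<iota> n f) + 1) * ?k f)"
    by (intro sum_mono mult_right_mono less_imp_le[OF atom_count_bounds(2)]) auto
  also have "\<dots> = real (power_count X \<iota> N n u) + (\<Sum>f\<in>set_pmf ?P. ?k f)"
    by (simp add: power_count_def algebra_simps sum.distrib)
  also have "(\<Sum>f\<in>set_pmf ?P. ?k f) \<le> real (card (set_pmf ?P)) * real N"
    by (rule sum_bounded_above) (rule k)
  finally have "real (atom_count X \<iota> (n * N) u) \<le> real (power_count X \<iota> N n u + card (set_pmf ?P) * N)"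
    by simp
  then show "atom_count X \<iota> (n * N) u \<le> power_count X \<iota> N n u + card (set_pmf ?P) * N"
    unfolding of_nat_le_iff .
qed

lemma cond_tensor_power_reduction:
  fixes X :: "('o, 'm, 'a) diagram" and N n :: nat
  assumes X: "is_diagram G X" "\<iota> \<in> Ob G"
  defines "A \<equiv> cond_tensor G (tensor_power X N) \<iota> (atom_count (tensor_power X N) \<iota> n)"
    and "B \<equiv> cond_tensor G X \<iota> (power_count X \<iota> N n)"
  shows "(\<exists>r. is_reduction G A B r) \<and> total_ent G B = total_ent G A"
proof -
  let ?X = "tensor_power X N" and ?c = "atom_count (tensor_power X N) \<iota> n"
  let ?S = "set_pmf (Sp ?X \<iota>)"
  let ?K = "Sigma ?S (\<lambda>f. {..<?c f})"
  let ?J = "Sigma ?K (\<lambda>_. {..<N})" and ?l = "\<lambda>z. fst (fst z) (snd z)"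
  let ?T = "\<lambda>f. tensor {..<N} (\<lambda>l. cond_diagram G X \<iota> (f l))"
  have finS: "finite ?S" using is_diagramD(1)[OF diagram_power[OF X(1)] X(2)] .
  have fin: "finite ?K" "finite ?J" using finS by auto
  note cp = cond_diagram_power[OF X, of _ N]
  have lab: "?l ` ?J \<subseteq> set_pmf (Sp X \<iota>)" using cp(3) by auto
  have dT: "is_diagram G (?T f)" if "f \<in> ?S" for f
    using cp(3)[OF that] by (intro diagram_tensor diagram_cond X) auto
  \<comment> \<open>By \<open>cond_diagram_power\<close> the two diagrams have the same spaces and
    maps, so the identity is a reduction.\<close>
  have idr: "is_reduction G (cond_diagram G ?X \<iota> f) (?T f) (\<lambda>i x. x)" if "f \<in> ?S" for f
    unfolding is_reduction_def by (simp only: cp(1,2)[OF that]) simp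
  have r1: "is_reduction G A (tensor ?K (\<lambda>z. ?T (fst z))) (\<lambda>i x. restrict (\<lambda>z. x z) ?K)"
    unfolding A_def cond_tensor_def
    by (rule reduction_tensor_inj[where r = "\<lambda>j i x. x"]) (use fin idr in auto)
  have r2: "is_reduction G (tensor ?K (\<lambda>z. ?T (fst z))) (tensor ?J (\<lambda>z. cond_diagram G X \<iota> (?l z)))
      (\<lambda>i x. restrict (\<lambda>z. x (fst z) (snd z)) ?J)"
    using reduction_tensor_uncurry[where J = ?K and K = "\<lambda>_. {..<N}"
        and D = "\<lambda>z l. cond_diagram G X \<iota> (fst z l)"] fin by simp
  have card: "power_count X \<iota> N n u = card {z \<in> ?J. ?l z = u}" for u
  proof -
    have "{z \<in> ?J. ?l z = u} = Sigma ?K (\<lambda>z. {l \<in> {..<N}. fst z l = u})" by auto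
    then have "card {z \<in> ?J. ?l z = u} = (\<Sum>z\<in>?K. card {l \<in> {..<N}. fst z l = u})"
      using fin by (simp add: card_SigmaI)
    also have "\<dots> = (\<Sum>f\<in>?S. \<Sum>k<?c f. card {l \<in> {..<N}. f l = u})"
      using finS by (subst sum.Sigma) (auto simp: split_def)
    finally show ?thesis by (simp add: power_count_def)
  qed
  obtain s where r3: "is_reduction G (tensor ?J (\<lambda>z. cond_diagram G X \<iota> (?l z))) B s"
    using reduction_cond_tensor[OF X fin(2), of "power_count X \<iota> N n" ?l] card unfolding B_def by auto
  have "total_ent G B = total_ent G (tensor ?J (\<lambda>z. cond_diagram G X \<iota> (?l z)))"
    unfolding B_def total_ent_cond_tensor[OF X] total_ent_labelled[OF X fin(2) lab] card ..
  also have "\<dots> = (\<Sum>z\<in>?J. total_ent G (cond_diagram G X \<iota> (?l z)))"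
    using lab by (intro total_ent_tensor fin diagram_cond X) auto
  also have "\<dots> = (\<Sum>z\<in>?K. \<Sum>l<N. total_ent G (cond_diagram G X \<iota> (fst z l)))"
    using fin by (subst sum.Sigma) (auto simp: split_def)
  also have "\<dots> = (\<Sum>z\<in>?K. total_ent G (?T (fst z)))"
    using cp(3) by (intro sum.cong refl total_ent_tensor[symmetric] diagram_cond X) auto
  also have "\<dots> = (\<Sum>z\<in>?K. total_ent G (cond_diagram G ?X \<iota> (fst z)))"
    by (intro sum.cong refl) (auto simp only: total_ent_def cp(1) SigmaE fst_conv)
  also have "\<dots> = total_ent G A"
    unfolding A_def cond_tensor_def
    by (intro total_ent_tensor[symmetric] fin) (auto intro!: diagram_cond diagram_power X)
  finally show ?thesis
    using reduction_comp[OF reduction_comp[OF r1 r2] r3] by blast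
qed

text \<open>The constant may depend on \<open>N\<close> but not on \<open>n\<close>, so it vanishes
  after division by \<open>n\<close>.\<close>

lemma entropy_dist_trop_cond_power:
  assumes X: "is_diagram G X" and Y: "is_diagram G Y" and \<iota>: "\<iota> \<in> Ob G"
  shows "\<exists>C. \<forall>n. entropy_dist G (trop_cond G X \<iota> (n * N)) (trop_cond G Y \<iota> (n * N)) \<le>
    entropy_dist G (trop_cond G (tensor_power X N) \<iota> n) (trop_cond G (tensor_power Y N) \<iota> n) + C"
proof (intro exI allI)
  fix n
  let ?X = "tensor_power X N" and ?Y = "tensor_power Y N"
  note dX = diagram_power[OF X, of N] and dY = diagram_power[OF Y, of N]
  obtain r s where "is_reduction G (cond_tensor G ?X \<iota> (atom_count ?X \<iota> n)) (cond_tensor G X \<iota> (power_count X \<iota> N n)) r"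
    "is_reduction G (cond_tensor G ?Y \<iota> (atom_count ?Y \<iota> n)) (cond_tensor G Y \<iota> (power_count Y \<iota> N n)) s"
    using cond_tensor_power_reduction[OF X \<iota>] cond_tensor_power_reduction[OF Y \<iota>] by blast
  then have "entropy_dist G (cond_tensor G X \<iota> (power_count X \<iota> N n)) (cond_tensor G Y \<iota> (power_count Y \<iota> N n)) \<le>
      entropy_dist G (cond_tensor G ?X \<iota> (atom_count ?X \<iota> n)) (cond_tensor G ?Y \<iota> (atom_count ?Y \<iota> n))"
    using cond_tensor_power_reduction[OF X \<iota>, of N n] cond_tensor_power_reduction[OF Y \<iota>, of N n]
    by (intro entropy_dist_reduction diagram_cond_tensor dX dY \<iota>) auto
  moreover have "entropy_dist G (cond_tensor G X \<iota> (atom_count X \<iota> (n * N)))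
      (cond_tensor G Y \<iota> (atom_count Y \<iota> (n * N))) \<le>
    entropy_dist G (cond_tensor G X \<iota> (power_count X \<iota> N n)) (cond_tensor G Y \<iota> (power_count Y \<iota> N n)) +
    (real (card (set_pmf (Sp ?X \<iota>)) * N) * (\<Sum>u\<in>set_pmf (Sp X \<iota>). total_ent G (cond_diagram G X \<iota> u)) +
     real (card (set_pmf (Sp ?Y \<iota>)) * N) * (\<Sum>v\<in>set_pmf (Sp Y \<iota>). total_ent G (cond_diagram G Y \<iota> v)))"
    by (intro entropy_dist_cond_tensor_le X Y \<iota> conjI power_count_bounds)
  ultimately show "entropy_dist G (trop_cond G X \<iota> (n * N)) (trop_cond G Y \<iota> (n * N)) \<le>
    entropy_dist G (trop_cond G ?X \<iota> n) (trop_cond G ?Y \<iota> n) +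
    (real (card (set_pmf (Sp ?X \<iota>)) * N) * (\<Sum>u\<in>set_pmf (Sp X \<iota>). total_ent G (cond_diagram G X \<iota> u)) +
     real (card (set_pmf (Sp ?Y \<iota>)) * N) * (\<Sum>v\<in>set_pmf (Sp Y \<iota>). total_ent G (cond_diagram G Y \<iota> v)))"
    unfolding entropy_dist_trop_cond[OF X \<iota> Y \<iota>] entropy_dist_trop_cond[OF dX \<iota> dY \<iota>]
    by linarith
qed

end

section \<open>Concentration of counts\<close>

lemma expectation_pair_pmf_finite:
  fixes h :: "'a \<times> 'b \<Rightarrow> real"
  assumes "finite (set_pmf p)" "finite (set_pmf q)"
  shows "measure_pmf.expectation (pair_pmf p q) h =
    measure_pmf.expectation p (\<lambda>x. measure_pmf.expectation q (\<lambda>y. h (x, y)))"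
proof -
  have "pair_pmf p q = bind_pmf p (\<lambda>x. map_pmf (Pair x) q)"
    by (simp add: pair_pmf_def map_pmf_def)
  then show ?thesis
    using assms by (simp add: expectation_bind_finite integral_measure_pmf_real[OF assms(1)] mult.commute)
qed

text \<open>By independence the mixed term in the inductive step is the mean of \<open>g i\<close>
  times that of the remaining sum, and it vanishes because \<open>g i\<close> is centred.\<close>

lemma expectation_square_sum_Pi_pmf:
  fixes g :: "'j \<Rightarrow> 'a \<Rightarrow> real"
  assumes "finite J" "\<And>j. j \<in> J \<Longrightarrow> finite (set_pmf (p j))"
    and "\<And>j. j \<in> J \<Longrightarrow> measure_pmf.expectation (p j) (g j) = 0"
    and "\<And>j x. j \<in> J \<Longrightarrow> \<bar>g j x\<bar> \<le> 1"
  shows "measure_pmf.expectation (Pi_pmf J d p) (\<lambda>s. (\<Sum>j\<in>J. g j (s j))\<^sup>2) \<le> real (card J)"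
  using assms
proof (induction J rule: finite_induct)
  case (insert i J)
  let ?S = "\<lambda>s. \<Sum>j\<in>J. g j (s j)" and ?P = "Pi_pmf J d p"
  have fin: "finite (set_pmf (p i))" "finite (set_pmf ?P)"
    using insert by (auto intro!: finite_set_Pi_pmf)
  note int = integrable_measure_pmf_finite[OF fin(1)] integrable_measure_pmf_finite[OF fin(2)]
  have "measure_pmf.expectation (Pi_pmf (insert i J) d p) (\<lambda>s. (\<Sum>j\<in>insert i J. g j (s j))\<^sup>2) =
    measure_pmf.expectation (pair_pmf (p i) ?P) (\<lambda>z. (\<Sum>j\<in>insert i J. g j (((snd z)(i := fst z)) j))\<^sup>2)"
    using insert.hyps by (simp add: Pi_pmf_insert split_def)
  also have "\<dots> = measure_pmf.expectation (pair_pmf (p i) ?P) (\<lambda>z. (g i (fst z) + ?S (snd z))\<^sup>2)"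
  proof (intro Bochner_Integration.integral_cong refl arg_cong[where f = "\<lambda>x. x\<^sup>2"])
    fix z :: "'a \<times> ('j \<Rightarrow> 'a)"
    have "(\<Sum>j\<in>J. g j (((snd z)(i := fst z)) j)) = ?S (snd z)"
      using insert.hyps by (intro sum.cong) auto
    then show "(\<Sum>j\<in>insert i J. g j (((snd z)(i := fst z)) j)) = g i (fst z) + ?S (snd z)"
      using insert.hyps by simp
  qed
  also have "\<dots> = measure_pmf.expectation (p i) (\<lambda>y. measure_pmf.expectation ?P
      (\<lambda>s. (g i y)\<^sup>2 + (2 * g i y * ?S s + (?S s)\<^sup>2)))"
    by (simp add: expectation_pair_pmf_finite[OF fin] power2_sum algebra_simps)
  also have "\<dots> = measure_pmf.expectation (p i) (\<lambda>y. (g i y)\<^sup>2 + (g i y * (2 * measure_pmf.expectation ?P ?S) +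
      measure_pmf.expectation ?P (\<lambda>s. (?S s)\<^sup>2)))"
    by (simp add: Bochner_Integration.integral_add int)
  also have "\<dots> = measure_pmf.expectation (p i) (\<lambda>y. (g i y)\<^sup>2) + measure_pmf.expectation ?P (\<lambda>s. (?S s)\<^sup>2)"
    using insert.prems(2)[of i] by (simp add: Bochner_Integration.integral_add int)
  also have "measure_pmf.expectation (p i) (\<lambda>y. (g i y)\<^sup>2) \<le> measure_pmf.expectation (p i) (\<lambda>y. 1)"
    using insert.prems(3)[of i] by (intro expectation_mono_finite fin) (simp add: abs_square_le_1)
  also have "measure_pmf.expectation ?P (\<lambda>s. (?S s)\<^sup>2) \<le> real (card J)"
    using insert by auto
  finally show ?case using insert.hyps by simp
qed simp

lemma expectation_count_deviation:
  assumes J: "finite J" "\<And>j. j \<in> J \<Longrightarrow> finite (set_pmf (p j))" and n: "real (card J) \<le> n" "0 < n"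
  shows "measure_pmf.expectation (Pi_pmf J d p)
    (\<lambda>s. \<bar>real (card {j \<in> J. s j = w}) - (\<Sum>j\<in>J. pmf (p j) w)\<bar>) \<le> sqrt n"
proof -
  let ?P = "Pi_pmf J d p" and ?g = "\<lambda>j x. indicator {w} x - pmf (p j) w :: real"
  let ?D = "\<lambda>s. \<Sum>j\<in>J. ?g j (s j)"
  have finP: "finite (set_pmf ?P)" by (rule finite_set_Pi_pmf[OF J])
  have D: "real (card {j \<in> J. s j = w}) - (\<Sum>j\<in>J. pmf (p j) w) = ?D s" for s
    using J by (simp add: sum_subtractf indicator_def sum.If_cases Int_def)
  have "measure_pmf.expectation ?P (\<lambda>s. \<bar>?D s\<bar>) \<le>
      measure_pmf.expectation ?P (\<lambda>s. (?D s)\<^sup>2 / (2 * sqrt n) + sqrt n / 2)"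
  proof (intro expectation_mono_finite[OF finP])
    fix s
    \<comment> \<open>Completing the square trades the first moment for the second. With the weight
      \<open>sqrt n\<close> both halves of the bound come to at most
      \<open>sqrt n / 2\<close>.\<close>
    have "0 \<le> (\<bar>?D s\<bar> - sqrt n)\<^sup>2" by simp
    then have "2 * sqrt n * \<bar>?D s\<bar> \<le> (?D s)\<^sup>2 + n"
      using n by (simp add: power2_diff mult_ac)
    then have "\<bar>?D s\<bar> \<le> ((?D s)\<^sup>2 + n) / (2 * sqrt n)"
      using n by (simp add: pos_le_divide_eq mult_ac)
    also have "\<dots> = (?D s)\<^sup>2 / (2 * sqrt n) + sqrt n / 2"
      using n by (simp add: add_divide_distrib real_div_sqrt)
    finally show "\<bar>?D s\<bar> \<le> (?D s)\<^sup>2 / (2 * sqrt n) + sqrt n / 2" .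
  qed
  also have "\<dots> = measure_pmf.expectation ?P (\<lambda>s. (?D s)\<^sup>2) / (2 * sqrt n) + sqrt n / 2"
    by (simp add: Bochner_Integration.integral_add integrable_measure_pmf_finite[OF finP])
  also have "measure_pmf.expectation ?P (\<lambda>s. (?D s)\<^sup>2) \<le> real (card J)"
  proof (rule expectation_square_sum_Pi_pmf[OF J])
    fix j x assume j: "j \<in> J"
    show "measure_pmf.expectation (p j) (?g j) = 0"
      by (simp add: integrable_measure_pmf_finite[OF J(2)[OF j]] measure_pmf_single)
    show "\<bar>?g j x\<bar> \<le> 1"
      using pmf_le_1[of "p j" w] by (cases "x = w") (simp_all add: abs_le_iff)
  qed
  also have "real (card J) / (2 * sqrt n) + sqrt n / 2 \<le> n / (2 * sqrt n) + sqrt n / 2"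
    using n by (intro add_right_mono divide_right_mono) auto
  also have "\<dots> = sqrt n"
  proof -
    have "n / (2 * sqrt n) = n / sqrt n / 2" by simp
    then show ?thesis using n by (simp only: real_div_sqrt)
  qed
  finally show ?thesis
    unfolding D using n by (simp add: divide_right_mono)
qed

section \<open>The main estimate\<close>

lemma bind_pair_pmf_fst: "bind_pmf (pair_pmf p q) (\<lambda>m. f (fst m)) = bind_pmf p f"
  using bind_map_pmf[of fst "pair_pmf p q" f] by (simp add: map_fst_pair_pmf)

lemma bind_pair_pmf_snd: "bind_pmf (pair_pmf p q) (\<lambda>m. f (snd m)) = bind_pmf q f"
  using bind_map_pmf[of snd "pair_pmf p q" f] by (simp add: map_snd_pair_pmf)

context indexing_category
begin

text \<open>
  The labels \<open>(u, k)\<close> index the factors of the \<open>n\<close>-th term of \<open>[X|U]\<close>. A random lift picks an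
  atom \<open>w\<close> over \<open>u\<close> for each of them.
\<close>

definition lift_law :: "('o, 'm, 'c) diagram \<Rightarrow> ('o \<Rightarrow> 'c \<Rightarrow> 'a) \<Rightarrow> 'o \<Rightarrow> 'a \<Rightarrow> 'c pmf" where
  "lift_law Z r \<iota> u = cond_pmf (Sp Z \<iota>) (r \<iota> -` {u})"

abbreviation label_set :: "('o, 'm, 'a) diagram \<Rightarrow> 'o \<Rightarrow> nat \<Rightarrow> ('a \<times> nat) set" where
  "label_set X \<iota> n \<equiv> Sigma (set_pmf (Sp X \<iota>)) (\<lambda>u. {..<atom_count X \<iota> n u})"

definition random_lift ::
  "('o, 'm, 'c) diagram \<Rightarrow> ('o, 'm, 'a) diagram \<Rightarrow> ('o \<Rightarrow> 'c \<Rightarrow> 'a) \<Rightarrow> 'o \<Rightarrow> nat \<Rightarrow> ('a \<times> nat \<Rightarrow> 'c) pmf" where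
  "random_lift Z X r \<iota> n = Pi_pmf (label_set X \<iota> n) undefined (\<lambda>z. lift_law Z r \<iota> (fst z))"

context
  fixes X :: "('o, 'm, 'a) diagram" and Z :: "('o, 'm, 'c) diagram" and r \<iota>
  assumes X: "is_diagram G X" and Z: "is_diagram G Z" and r: "is_reduction G Z X r" and \<iota>: "\<iota> \<in> Ob G"
begin

lemma finite_label_set: "finite (label_set X \<iota> n)"
  using is_diagramD(1)[OF X \<iota>] by auto

lemma set_lift_law:
  assumes "u \<in> set_pmf (Sp X \<iota>)"
  shows "set_pmf (Sp Z \<iota>) \<inter> r \<iota> -` {u} \<noteq> {}"
    and "set_pmf (lift_law Z r \<iota> u) \<subseteq> set_pmf (Sp Z \<iota>)"
proof -
  show ne: "set_pmf (Sp Z \<iota>) \<inter> r \<iota> -` {u} \<noteq> {}"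
    using assms unfolding is_reductionD(1)[OF r \<iota>, symmetric] by auto
  show "set_pmf (lift_law Z r \<iota> u) \<subseteq> set_pmf (Sp Z \<iota>)"
    using ne by (simp add: lift_law_def)
qed

lemma finite_lift_law: "u \<in> set_pmf (Sp X \<iota>) \<Longrightarrow> finite (set_pmf (lift_law Z r \<iota> u))"
  using set_lift_law(2) is_diagramD(1)[OF Z \<iota>] finite_subset by blast

lemma set_random_lift:
  "s \<in> set_pmf (random_lift Z X r \<iota> n) \<Longrightarrow> z \<in> label_set X \<iota> n \<Longrightarrow> s z \<in> set_pmf (Sp Z \<iota>)"
  using set_lift_law(2) unfolding random_lift_def set_Pi_pmf[OF finite_label_set]
  by (fastforce simp: PiE_dflt_def)

lemma finite_random_lift: "finite (set_pmf (random_lift Z X r \<iota> n))"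
  unfolding random_lift_def
  by (rule finite_set_Pi_pmf[OF finite_label_set]) (auto intro: finite_lift_law)

text \<open>Bayes' rule; it makes the average of the lift laws over \<open>u\<close> the law of
  \<open>W\<close>.\<close>

lemma pmf_lift_law:
  assumes "u \<in> set_pmf (Sp X \<iota>)"
  shows "pmf (Sp X \<iota>) u * pmf (lift_law Z r \<iota> u) w = (if r \<iota> w = u then pmf (Sp Z \<iota>) w else 0)"
proof -
  have "pmf (Sp X \<iota>) u = measure (Sp Z \<iota>) (r \<iota> -` {u})"
    using is_reductionD(1)[OF r \<iota>] by (metis pmf_map)
  then show ?thesis
    using measure_measure_pmf_not_zero[OF set_lift_law(1)[OF assms]]
    by (simp add: lift_law_def pmf_cond[OF set_lift_law(1)[OF assms]])
qed

lemma sum_atom_count_bounds: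
  assumes h: "\<And>u. u \<in> set_pmf (Sp X \<iota>) \<Longrightarrow> 0 \<le> h u"
  shows "(\<Sum>u\<in>set_pmf (Sp X \<iota>). real (atom_count X \<iota> n u) * h u) \<le>
      real n * (\<Sum>u\<in>set_pmf (Sp X \<iota>). pmf (Sp X \<iota>) u * h u)"
    and "real n * (\<Sum>u\<in>set_pmf (Sp X \<iota>). pmf (Sp X \<iota>) u * h u) \<le>
      (\<Sum>u\<in>set_pmf (Sp X \<iota>). real (atom_count X \<iota> n u) * h u) + (\<Sum>u\<in>set_pmf (Sp X \<iota>). h u)"
proof -
  show "(\<Sum>u\<in>set_pmf (Sp X \<iota>). real (atom_count X \<iota> n u) * h u) \<le>
      real n * (\<Sum>u\<in>set_pmf (Sp X \<iota>). pmf (Sp X \<iota>) u * h u)"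
    unfolding sum_distrib_left mult.assoc[symmetric]
    by (intro sum_mono mult_right_mono atom_count_bounds h)
  have "real n * (\<Sum>u\<in>set_pmf (Sp X \<iota>). pmf (Sp X \<iota>) u * h u) \<le>
      (\<Sum>u\<in>set_pmf (Sp X \<iota>). (real (atom_count X \<iota> n u) + 1) * h u)"
    unfolding sum_distrib_left mult.assoc[symmetric]
    by (intro sum_mono mult_right_mono less_imp_le[OF atom_count_bounds(2)] h)
  then show "real n * (\<Sum>u\<in>set_pmf (Sp X \<iota>). pmf (Sp X \<iota>) u * h u) \<le>
      (\<Sum>u\<in>set_pmf (Sp X \<iota>). real (atom_count X \<iota> n u) * h u) + (\<Sum>u\<in>set_pmf (Sp X \<iota>). h u)"
    by (simp add: algebra_simps sum.distrib)
qed

lemma sum_label_set: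
  "(\<Sum>z\<in>label_set X \<iota> n. h (fst z)) = (\<Sum>u\<in>set_pmf (Sp X \<iota>). real (atom_count X \<iota> n u) * h u)"
proof -
  have "(\<Sum>z\<in>label_set X \<iota> n. h (fst z)) = (\<Sum>u\<in>set_pmf (Sp X \<iota>). \<Sum>k<atom_count X \<iota> n u. h u)"
    using is_diagramD(1)[OF X \<iota>] by (subst sum.Sigma) (auto simp: split_def)
  then show ?thesis by simp
qed

text \<open>The count of \<open>w\<close> has mean error at most \<open>sqrt n\<close> around its
  expectation, and the floors move that expectation away from \<open>n\<close> times the weight of
  \<open>w\<close> by at most one per atom of \<open>U\<close>.\<close>

lemma random_lift_count:
  assumes n: "n \<ge> 1" and w: "w \<in> set_pmf (Sp Z \<iota>)"
  shows "measure_pmf.expectation (random_lift Z X r \<iota> n)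
      (\<lambda>s. \<bar>real (card {z \<in> label_set X \<iota> n. s z = w}) - real n * pmf (Sp Z \<iota>) w\<bar>) \<le>
    sqrt (real n) + real (card (set_pmf (Sp X \<iota>)))"
proof -
  let ?S = "set_pmf (Sp X \<iota>)" and ?M = "\<Sum>z\<in>label_set X \<iota> n. pmf (lift_law Z r \<iota> (fst z)) w"
  have finS: "finite ?S" by (rule is_diagramD(1)[OF X \<iota>])
  have "real (card (label_set X \<iota> n)) = (\<Sum>u\<in>?S. real (atom_count X \<iota> n u) * 1)"
    using sum_label_set[of "\<lambda>_. 1"] by simp
  also have "\<dots> \<le> real n * (\<Sum>u\<in>?S. pmf (Sp X \<iota>) u * 1)"
    by (rule sum_atom_count_bounds) simp
  finally have card: "real (card (label_set X \<iota> n)) \<le> real n"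
    using finS by (simp add: sum_pmf_eq_1)
  have "r \<iota> w \<in> ?S"
    using w is_reductionD(1)[OF r \<iota>] by (metis imageI set_map_pmf)
  \<comment> \<open>Only the atom \<open>u = r \<iota> w\<close> below \<open>w\<close>
    contributes.\<close>
  then have mean: "(\<Sum>u\<in>?S. pmf (Sp X \<iota>) u * pmf (lift_law Z r \<iota> u) w) = pmf (Sp Z \<iota>) w"
    using finS by (simp add: pmf_lift_law cong: sum.cong)
  have "(\<Sum>u\<in>?S. pmf (lift_law Z r \<iota> u) w) \<le> (\<Sum>u\<in>?S. 1)"
    by (intro sum_mono pmf_le_1)
  then have "(\<Sum>u\<in>?S. pmf (lift_law Z r \<iota> u) w) \<le> real (card ?S)"
    by simp
  then have M: "\<bar>?M - real n * pmf (Sp Z \<iota>) w\<bar> \<le> real (card ?S)"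
    using sum_atom_count_bounds[of "\<lambda>u. pmf (lift_law Z r \<iota> u) w" n, OF pmf_nonneg]
    unfolding sum_label_set[of "\<lambda>u. pmf (lift_law Z r \<iota> u) w"] mean by linarith
  have "measure_pmf.expectation (random_lift Z X r \<iota> n)
      (\<lambda>s. \<bar>real (card {z \<in> label_set X \<iota> n. s z = w}) - real n * pmf (Sp Z \<iota>) w\<bar>) \<le>
    measure_pmf.expectation (random_lift Z X r \<iota> n)
      (\<lambda>s. \<bar>real (card {z \<in> label_set X \<iota> n. s z = w}) - ?M\<bar> + real (card ?S))"
    using M by (intro expectation_mono_finite finite_random_lift) linarith
  also have "\<dots> = measure_pmf.expectation (random_lift Z X r \<iota> n)
      (\<lambda>s. \<bar>real (card {z \<in> label_set X \<iota> n. s z = w}) - ?M\<bar>) + real (card ?S)"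
    by (simp add: Bochner_Integration.integral_add integrable_measure_pmf_finite[OF finite_random_lift])
  also have "\<dots> \<le> sqrt (real n) + real (card ?S)"
    unfolding random_lift_def using n card
    by (intro add_right_mono expectation_count_deviation finite_label_set) (auto intro: finite_lift_law)
  finally show ?thesis .
qed

text \<open>Entropies of independent lifts add, the floors only lower the number of lifts, and the
  average entropy of a lift is \<open>H(W|U) = H(W) - H(U)\<close>.\<close>

lemma Ent_random_lift:
  "Ent (random_lift Z X r \<iota> n) \<le> real n * (Ent (Sp Z \<iota>) - Ent (Sp X \<iota>))"
proof -
  have finZ: "finite (set_pmf (Sp Z \<iota>))" by (rule is_diagramD(1)[OF Z \<iota>])
  have "Ent (random_lift Z X r \<iota> n) = (\<Sum>z\<in>label_set X \<iota> n. Ent (lift_law Z r \<iota> (fst z)))"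
    unfolding random_lift_def by (rule Ent_Pi_pmf[OF finite_label_set]) (auto intro: finite_lift_law)
  also have "\<dots> \<le> real n * (\<Sum>u\<in>set_pmf (Sp X \<iota>). pmf (Sp X \<iota>) u * Ent (lift_law Z r \<iota> u))"
    unfolding sum_label_set[of "\<lambda>u. Ent (lift_law Z r \<iota> u)"] by (intro sum_atom_count_bounds Ent_nonneg)
  also have "(\<Sum>u\<in>set_pmf (Sp X \<iota>). pmf (Sp X \<iota>) u * Ent (lift_law Z r \<iota> u)) =
      cond_ent (Sp Z \<iota>) (\<lambda>x. x) (\<lambda>x. r \<iota> x)"
    using is_reductionD(1)[OF r \<iota>] by (simp add: cond_ent_def lift_law_def)
  also have "\<dots> = Ent (Sp Z \<iota>) - Ent (Sp X \<iota>)"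
    using cond_ent_refine[OF finZ, of "\<lambda>x. x" "r \<iota>"] is_reductionD(1)[OF r \<iota>] by simp
  finally show ?thesis .
qed

text \<open>All conditional entropies are taken on one sample space, the initial space of
  \<open>Z\<close>, so \<open>cond_ent_diff_le\<close> applies object by object.\<close>

lemma cond_total_ent_diff_le:
  "(\<Sum>w\<in>set_pmf (Sp Z \<iota>). pmf (Sp Z \<iota>) w * total_ent G (cond_diagram G Z \<iota> w)) -
   (\<Sum>u\<in>set_pmf (Sp X \<iota>). pmf (Sp X \<iota>) u * total_ent G (cond_diagram G X \<iota> u)) \<le>
   total_ent G Z - total_ent G X"
proof -
  let ?P = "Sp Z \<Omega>"
  have finP: "finite (set_pmf ?P)" by (rule is_diagramD(1)[OF Z initial_Ob[OF \<iota>]])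
  have X_eq: "map_pmf (\<lambda>x. r i (leg Z i x)) ?P = Sp X i" if "i \<in> Ob G" for i
  proof -
    have "map_pmf (\<lambda>x. r i (leg Z i x)) ?P = map_pmf (r i) (map_pmf (leg Z i) ?P)"
      by (simp add: map_pmf_comp)
    then show ?thesis
      using map_leg[OF Z that] is_reductionD(1)[OF r that] by simp
  qed
  have "(\<Sum>w\<in>set_pmf (Sp Z \<iota>). pmf (Sp Z \<iota>) w * total_ent G (cond_diagram G Z \<iota> w)) =
      (\<Sum>i\<in>Ob G. cond_ent ?P (leg Z i) (leg Z \<iota>))"
    unfolding cond_ent_def map_leg[OF Z \<iota>] total_ent_def sum_distrib_left
    by (subst sum.swap) simp
  moreover have "(\<Sum>u\<in>set_pmf (Sp X \<iota>). pmf (Sp X \<iota>) u * total_ent G (cond_diagram G X \<iota> u)) =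
      (\<Sum>i\<in>Ob G. cond_ent ?P (\<lambda>x. r i (leg Z i x)) (\<lambda>x. r \<iota> (leg Z \<iota> x)))"
    unfolding cond_ent_def X_eq[OF \<iota>] total_ent_def sum_distrib_left
    by (subst sum.swap) (intro sum.cong refl, simp only: cond_diagram_mixture(2)[OF Z r \<iota> X])
  moreover have "(\<Sum>i\<in>Ob G. cond_ent ?P (leg Z i) (leg Z \<iota>)) -
      (\<Sum>i\<in>Ob G. cond_ent ?P (\<lambda>x. r i (leg Z i x)) (\<lambda>x. r \<iota> (leg Z \<iota> x))) \<le>
      (\<Sum>i\<in>Ob G. Ent (Sp Z i) - Ent (Sp X i))"
    unfolding sum_subtractf[symmetric]
  proof (rule sum_mono)
    fix i assume i: "i \<in> Ob G"
    show "cond_ent ?P (leg Z i) (leg Z \<iota>) - cond_ent ?P (\<lambda>x. r i (leg Z i x)) (\<lambda>x. r \<iota> (leg Z \<iota> x)) \<le>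
      Ent (Sp Z i) - Ent (Sp X i)"
      using cond_ent_diff_le[OF finP, of "leg Z i" "leg Z \<iota>" "r i" "r \<iota>"]
      unfolding X_eq[OF i] map_leg[OF Z i] .
  qed
  ultimately show ?thesis
    by (simp add: total_ent_def sum_subtractf)
qed

text \<open>Mixing each factor over its own independent lift is the same as mixing the whole product
  over the joint lift.\<close>

lemma cond_tensor_mixture:
  assumes "i \<in> Ob G"
  shows "Sp (cond_tensor G X \<iota> (atom_count X \<iota> n)) i =
    bind_pmf (random_lift Z X r \<iota> n)
      (\<lambda>s. Sp (tensor (label_set X \<iota> n) (\<lambda>z. cond_image Z X r \<iota> (s z))) i)"
proof -
  have "Sp (cond_tensor G X \<iota> (atom_count X \<iota> n)) i =
      Pi_pmf (label_set X \<iota> n) undefined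
        (\<lambda>z. bind_pmf (lift_law Z r \<iota> (fst z)) (\<lambda>w. Sp (cond_image Z X r \<iota> w) i))"
    unfolding cond_tensor_def tensor_sel lift_law_def
    by (rule Pi_pmf_cong) (auto simp only: cond_diagram_mixture(1)[OF Z r \<iota> X _ assms] SigmaE fst_conv)
  also have "\<dots> = bind_pmf (random_lift Z X r \<iota> n)
      (\<lambda>s. Sp (tensor (label_set X \<iota> n) (\<lambda>z. cond_image Z X r \<iota> (s z))) i)"
    unfolding random_lift_def tensor_sel
    by (rule Pi_pmf_bind[OF finite_label_set])
  finally show ?thesis .
qed

lemma cond_tensor_reduction_lift:
  assumes "s \<in> set_pmf (random_lift Z X r \<iota> n)"
    and "\<And>w. w \<in> set_pmf (Sp Z \<iota>) \<Longrightarrow> card {z \<in> label_set X \<iota> n. s z = w} \<le> m w"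
  shows "\<exists>q. is_reduction G (cond_tensor G Z \<iota> m) (tensor (label_set X \<iota> n) (\<lambda>z. cond_image Z X r \<iota> (s z))) q"
  by (rule cond_tensor_reduction[OF Z \<iota> finite_label_set])
    (use set_random_lift[OF assms(1)] assms(2) in \<open>auto intro!: reduction_cond_image[OF Z \<iota> _ r]\<close>)

end

lemma entropy_dist_trop_cond_le:
  fixes X :: "('o, 'm, 'a) diagram" and Y :: "('o, 'm, 'b) diagram" and Z :: "('o, 'm, 'c) diagram"
  assumes X: "is_diagram G X" and Y: "is_diagram G Y" and fan: "is_fan G X Y Z r s" and \<iota>: "\<iota> \<in> Ob G"
  defines "k \<equiv> 2 * total_ent G Z - total_ent G X - total_ent G Y"
  shows "\<exists>C. \<forall>n\<ge>1. entropy_dist G (trop_cond G X \<iota> n) (trop_cond G Y \<iota> n) \<le>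
    real n * ((2 * real (card (Ob G)) + 1) * k) + C * sqrt (real n)"
proof -
  have Z: "is_diagram G Z" and r: "is_reduction G Z X r" and s: "is_reduction G Z Y s"
    using fan by (auto simp: is_fan_def)
  let ?SX = "set_pmf (Sp X \<iota>)" and ?SY = "set_pmf (Sp Y \<iota>)" and ?SZ = "set_pmf (Sp Z \<iota>)"
  let ?hX = "\<lambda>u. total_ent G (cond_diagram G X \<iota> u)" and ?hY = "\<lambda>v. total_ent G (cond_diagram G Y \<iota> v)"
    and ?hZ = "\<lambda>w. total_ent G (cond_diagram G Z \<iota> w)"
  let ?EX = "\<Sum>u\<in>?SX. pmf (Sp X \<iota>) u * ?hX u" and ?EY = "\<Sum>v\<in>?SY. pmf (Sp Y \<iota>) v * ?hY v"
    and ?EZ = "\<Sum>w\<in>?SZ. pmf (Sp Z \<iota>) w * ?hZ w"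
  let ?N = "real (card (Ob G))"
  \<comment> \<open>The first summand pays for surplus copies of \<open>Z|w\<close>, doubled because
    the top is counted twice. The other two pay for factors of \<open>X\<close> and \<open>Y\<close>
    lost to the floors.\<close>
  define C where "C = 2 * (2 + real (card ?SX) + real (card ?SY)) * (\<Sum>w\<in>?SZ. ?hZ w) +
    (\<Sum>u\<in>?SX. ?hX u) + (\<Sum>v\<in>?SY. ?hY v)"
  have "entropy_dist G (trop_cond G X \<iota> n) (trop_cond G Y \<iota> n) \<le>
      real n * ((2 * ?N + 1) * k) + C * sqrt (real n)" if n: "n \<ge> 1" for n
  proof -
    let ?S = "random_lift Z X r \<iota> n" and ?T = "random_lift Z Y s \<iota> n"
    let ?A = "\<lambda>p. tensor (label_set X \<iota> n) (\<lambda>z. cond_image Z X r \<iota> (fst p z))"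
    let ?B = "\<lambda>p. tensor (label_set Y \<iota> n) (\<lambda>z. cond_image Z Y s \<iota> (snd p z))"
    let ?cX = "\<lambda>p w. card {z \<in> label_set X \<iota> n. fst p z = w}"
    let ?cY = "\<lambda>p w. card {z \<in> label_set Y \<iota> n. snd p z = w}"
    \<comment> \<open>The least number of copies of \<open>Z|w\<close> that serves both sides for
      the given pair of lifts.\<close>
    define m where "m p w = max (?cX p w) (?cY p w)"
      for p :: "('a \<times> nat \<Rightarrow> 'c) \<times> ('b \<times> nat \<Rightarrow> 'c)" and w :: 'c
    let ?\<mu> = "pair_pmf ?S ?T"
    have finS: "finite (set_pmf ?S)" "finite (set_pmf ?T)"
      by (rule finite_random_lift[OF X Z r \<iota>], rule finite_random_lift[OF Y Z s \<iota>])
    then have fin\<mu>: "finite (set_pmf ?\<mu>)" by simp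
    have "\<exists>q q'. is_reduction G (cond_tensor G Z \<iota> (m p)) (?A p) q \<and>
        is_reduction G (cond_tensor G Z \<iota> (m p)) (?B p) q'" if "p \<in> set_pmf ?\<mu>" for p
      using cond_tensor_reduction_lift[OF X Z r \<iota>, of "fst p" n "m p"]
        cond_tensor_reduction_lift[OF Y Z s \<iota>, of "snd p" n "m p"] that
      by (auto simp: m_def)
    then obtain q q' where q: "\<And>p. p \<in> set_pmf ?\<mu> \<Longrightarrow> is_reduction G (cond_tensor G Z \<iota> (m p)) (?A p) (q p)"
      "\<And>p. p \<in> set_pmf ?\<mu> \<Longrightarrow> is_reduction G (cond_tensor G Z \<iota> (m p)) (?B p) (q' p)"
      by metis
    have "entropy_dist G (cond_tensor G X \<iota> (atom_count X \<iota> n)) (cond_tensor G Y \<iota> (atom_count Y \<iota> n)) \<le>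
      2 * ?N * Ent ?\<mu> + 2 * (\<Sum>p\<in>set_pmf ?\<mu>. pmf ?\<mu> p * total_ent G (cond_tensor G Z \<iota> (m p))) -
      total_ent G (cond_tensor G X \<iota> (atom_count X \<iota> n)) - total_ent G (cond_tensor G Y \<iota> (atom_count Y \<iota> n))"
    proof (rule entropy_dist_mixture[OF fin\<mu>])
      show "is_fan G (?A p) (?B p) (cond_tensor G Z \<iota> (m p)) (q p) (q' p)" if "p \<in> set_pmf ?\<mu>" for p
        unfolding is_fan_def using q[OF that] diagram_cond_tensor[OF Z \<iota>] by blast
      show "Sp (cond_tensor G X \<iota> (atom_count X \<iota> n)) i = bind_pmf ?\<mu> (\<lambda>p. Sp (?A p) i)" if "i \<in> Ob G" for i
        unfolding cond_tensor_mixture[OF X Z r \<iota> that]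
        by (rule bind_pair_pmf_fst[symmetric])
      show "Sp (cond_tensor G Y \<iota> (atom_count Y \<iota> n)) i = bind_pmf ?\<mu> (\<lambda>p. Sp (?B p) i)" if "i \<in> Ob G" for i
        unfolding cond_tensor_mixture[OF Y Z s \<iota> that]
        by (rule bind_pair_pmf_snd[symmetric])
      show "Mp (?A p) = Mp (cond_tensor G X \<iota> (atom_count X \<iota> n))"
        "Mp (?B p) = Mp (cond_tensor G Y \<iota> (atom_count Y \<iota> n))" for p
        by (simp_all add: cond_tensor_def fun_eq_iff)
    qed
    moreover have "Ent ?\<mu> \<le> real n * k"
    proof -
      \<comment> \<open>The entropy drop is nonnegative at every object, so the drop at
        \<open>\<iota>\<close> is at most the sum of all of them. This bounds the entropy of the
        lifts by the cost of the fan.\<close>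
      have le: "Ent (Sp Z \<iota>) - Ent (Sp V \<iota>) \<le> total_ent G Z - total_ent G V"
        if "is_reduction G Z V t" for V :: "('o, 'm, 'v) diagram" and t
      proof -
        have nn: "0 \<le> Ent (Sp Z i) - Ent (Sp V i)" if "i \<in> Ob G" for i
          using Ent_map_le[OF is_diagramD(1)[OF Z that], of "t i"] is_reductionD(1)[OF \<open>is_reduction G Z V t\<close> that]
          by simp
        have "Ent (Sp Z \<iota>) - Ent (Sp V \<iota>) \<le> (\<Sum>i\<in>Ob G. Ent (Sp Z i) - Ent (Sp V i))"
          by (rule member_le_sum[OF \<iota>]) (use nn finite_Ob in auto)
        then show ?thesis by (simp add: total_ent_def sum_subtractf)
      qed
      have "Ent ?\<mu> = Ent ?S + Ent ?T" by (rule Ent_pair_pmf[OF finS])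
      also have "\<dots> \<le> real n * (Ent (Sp Z \<iota>) - Ent (Sp X \<iota>)) + real n * (Ent (Sp Z \<iota>) - Ent (Sp Y \<iota>))"
        by (intro add_mono Ent_random_lift X Y Z r s \<iota>)
      also have "\<dots> \<le> real n * (total_ent G Z - total_ent G X) + real n * (total_ent G Z - total_ent G Y)"
        by (intro add_mono mult_left_mono le[OF r] le[OF s]) auto
      finally show ?thesis by (simp add: k_def algebra_simps)
    qed
    then have "2 * ?N * Ent ?\<mu> \<le> 2 * ?N * (real n * k)"
      by (intro mult_left_mono) auto
    moreover have "(\<Sum>p\<in>set_pmf ?\<mu>. pmf ?\<mu> p * total_ent G (cond_tensor G Z \<iota> (m p))) \<le>
      real n * ?EZ + (2 * sqrt (real n) + real (card ?SX) + real (card ?SY)) * (\<Sum>w\<in>?SZ. ?hZ w)"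
    proof -
      have Em: "(\<Sum>p\<in>set_pmf ?\<mu>. pmf ?\<mu> p * real (m p w)) \<le>
          real n * pmf (Sp Z \<iota>) w + (2 * sqrt (real n) + real (card ?SX) + real (card ?SY))"
        if w: "w \<in> ?SZ" for w
      proof -
        let ?dX = "\<lambda>t. \<bar>real (card {z \<in> label_set X \<iota> n. t z = w}) - real n * pmf (Sp Z \<iota>) w\<bar>"
        let ?dY = "\<lambda>t. \<bar>real (card {z \<in> label_set Y \<iota> n. t z = w}) - real n * pmf (Sp Z \<iota>) w\<bar>"
        have "(\<Sum>p\<in>set_pmf ?\<mu>. pmf ?\<mu> p * real (m p w)) = measure_pmf.expectation ?\<mu> (\<lambda>p. real (m p w))"
          by (subst integral_measure_pmf_real[OF fin\<mu>]) (auto simp: mult.commute)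
        \<comment> \<open>The maximum of two counts exceeds their common target by at most the sum
          of the two deviations.\<close>
        also have "\<dots> \<le> measure_pmf.expectation ?\<mu> (\<lambda>p. real n * pmf (Sp Z \<iota>) w + (?dX (fst p) + ?dY (snd p)))"
          by (intro expectation_mono_finite fin\<mu>) (auto simp: m_def max_def)
        also have "\<dots> = real n * pmf (Sp Z \<iota>) w +
            (measure_pmf.expectation ?\<mu> (\<lambda>p. ?dX (fst p)) + measure_pmf.expectation ?\<mu> (\<lambda>p. ?dY (snd p)))"
          by (simp add: Bochner_Integration.integral_add integrable_measure_pmf_finite[OF fin\<mu>])
        also have "measure_pmf.expectation ?\<mu> (\<lambda>p. ?dX (fst p)) = measure_pmf.expectation ?S ?dX"
          using integral_map_pmf[of fst ?\<mu> ?dX] by (simp only: map_fst_pair_pmf)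
        also have "\<dots> \<le> sqrt (real n) + real (card ?SX)"
          by (rule random_lift_count[OF X Z r \<iota> n w])
        also have "measure_pmf.expectation ?\<mu> (\<lambda>p. ?dY (snd p)) = measure_pmf.expectation ?T ?dY"
          using integral_map_pmf[of snd ?\<mu> ?dY] by (simp only: map_snd_pair_pmf)
        also have "\<dots> \<le> sqrt (real n) + real (card ?SY)"
          by (rule random_lift_count[OF Y Z s \<iota> n w])
        finally show ?thesis by simp
      qed
      have "(\<Sum>p\<in>set_pmf ?\<mu>. pmf ?\<mu> p * total_ent G (cond_tensor G Z \<iota> (m p))) =
          (\<Sum>w\<in>?SZ. (\<Sum>p\<in>set_pmf ?\<mu>. pmf ?\<mu> p * real (m p w)) * ?hZ w)"
        unfolding total_ent_cond_tensor[OF Z \<iota>] sum_distrib_left sum_distrib_right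
        by (subst sum.swap) (simp add: mult.assoc)
      also have "\<dots> \<le> (\<Sum>w\<in>?SZ.
          (real n * pmf (Sp Z \<iota>) w + (2 * sqrt (real n) + real (card ?SX) + real (card ?SY))) * ?hZ w)"
        by (intro sum_mono mult_right_mono Em total_ent_nonneg)
      also have "\<dots> = real n * ?EZ + (2 * sqrt (real n) + real (card ?SX) + real (card ?SY)) * (\<Sum>w\<in>?SZ. ?hZ w)"
        by (simp only: distrib_right sum.distrib sum_distrib_left mult.assoc)
      finally show ?thesis .
    qed
    moreover have "real n * ?EX \<le> total_ent G (cond_tensor G X \<iota> (atom_count X \<iota> n)) + (\<Sum>u\<in>?SX. ?hX u)"
      unfolding total_ent_cond_tensor[OF X \<iota>]
      by (intro sum_atom_count_bounds[OF X Z r \<iota>] total_ent_nonneg)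
    moreover have "real n * ?EY \<le> total_ent G (cond_tensor G Y \<iota> (atom_count Y \<iota> n)) + (\<Sum>u\<in>?SY. ?hY u)"
      unfolding total_ent_cond_tensor[OF Y \<iota>]
      by (intro sum_atom_count_bounds[OF Y Z s \<iota>] total_ent_nonneg)
    \<comment> \<open>The cost of the slices themselves: the single \<open>k\<close> beyond the
      \<open>2 * ?N * k\<close> of the mixing.\<close>
    moreover have "real n * (2 * ?EZ - ?EX - ?EY) \<le> real n * k"
      using cond_total_ent_diff_le[OF X Z r \<iota>] cond_total_ent_diff_le[OF Y Z s \<iota>]
      by (intro mult_left_mono) (auto simp: k_def)
    moreover have "2 * ((2 * sqrt (real n) + real (card ?SX) + real (card ?SY)) * (\<Sum>w\<in>?SZ. ?hZ w)) +
        (\<Sum>u\<in>?SX. ?hX u) + (\<Sum>v\<in>?SY. ?hY v) \<le> C * sqrt (real n)"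
    proof -
      have root: "1 \<le> sqrt (real n)" using n by simp
      have scale: "x \<le> x * sqrt (real n)" if "0 \<le> x" for x
        using mult_left_mono[OF root that] by simp
      have "(2 * sqrt (real n) + real (card ?SX) + real (card ?SY)) * (\<Sum>w\<in>?SZ. ?hZ w) \<le>
          ((2 + real (card ?SX) + real (card ?SY)) * sqrt (real n)) * (\<Sum>w\<in>?SZ. ?hZ w)"
        unfolding distrib_right
        by (intro add_mono mult_right_mono scale sum_nonneg total_ent_nonneg order_refl) auto
      moreover have "(\<Sum>u\<in>?SX. ?hX u) \<le> (\<Sum>u\<in>?SX. ?hX u) * sqrt (real n)"
        "(\<Sum>u\<in>?SY. ?hY u) \<le> (\<Sum>u\<in>?SY. ?hY u) * sqrt (real n)"
        by (intro scale sum_nonneg total_ent_nonneg)+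
      ultimately show ?thesis
        by (simp add: C_def algebra_simps)
    qed
    ultimately show ?thesis
      unfolding entropy_dist_trop_cond[OF X \<iota> Y \<iota>] by (simp add: algebra_simps)
  qed
  then show ?thesis by blast
qed

text \<open>Fans over the \<open>N\<close>-th powers control the conditioned sequences at the
  indices \<open>n * N\<close>. Dividing by \<open>n\<close> removes the \<open>sqrt n\<close> and
  constant errors and leaves \<open>N\<close> times the wanted distance.\<close>

lemma asymp_dist_trop_cond_power_le:
  assumes X: "is_diagram G X" and Y: "is_diagram G Y" and \<iota>: "\<iota> \<in> Ob G"
  shows "asymp_dist G (trop_cond G X \<iota>) (trop_cond G Y \<iota>) * real N \<le>
    (2 * real (card (Ob G)) + 1) * entropy_dist G (tensor_power X N) (tensor_power Y N)"
proof (cases "N = 0")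
  case True
  then show ?thesis
    using entropy_dist_nonneg[OF diagram_power[OF X, of N] diagram_power[OF Y, of N]] by simp
next
  case False
  let ?L = "asymp_dist G (trop_cond G X \<iota>) (trop_cond G Y \<iota>)" and ?c = "2 * real (card (Ob G)) + 1"
  let ?X = "tensor_power X N" and ?Y = "tensor_power Y N"
  let ?a = "\<lambda>n. entropy_dist G (trop_cond G X \<iota> n) (trop_cond G Y \<iota> n)"
  note dX = diagram_power[OF X, of N] and dY = diagram_power[OF Y, of N]
  show ?thesis
  proof (rule field_le_epsilon)
    fix e :: real assume "0 < e"
    \<comment> \<open>The fan estimate multiplies the slack by \<open>?c\<close>, so the fan is
      chosen within \<open>e / ?c\<close> of the infimum.\<close>
    then have e: "0 < e / ?c" by simp
    obtain Z :: "('o, 'm, nat) diagram" and r s where Z: "is_fan G ?X ?Y Z r s"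
      "2 * total_ent G Z - total_ent G ?X - total_ent G ?Y < entropy_dist G ?X ?Y + e / ?c"
      using entropy_dist_approx[OF dX dY e] by blast
    let ?k = "2 * total_ent G Z - total_ent G ?X - total_ent G ?Y"
    obtain C where C: "\<And>n. n \<ge> 1 \<Longrightarrow> entropy_dist G (trop_cond G ?X \<iota> n) (trop_cond G ?Y \<iota> n) \<le>
        real n * (?c * ?k) + C * sqrt (real n)"
      using entropy_dist_trop_cond_le[OF dX dY Z(1) \<iota>] by blast
    obtain D where D: "\<And>n. ?a (n * N) \<le> entropy_dist G (trop_cond G ?X \<iota> n) (trop_cond G ?Y \<iota> n) + D"
      using entropy_dist_trop_cond_power[OF X Y \<iota>] by blast
    \<comment> \<open>Only multiples of \<open>N\<close> are reached; since the full sequence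
      converges, they already determine its limit.\<close>
    have "filterlim (\<lambda>n. n * N) at_top at_top"
      using False by (intro filterlim_subseq strict_monoI) simp
    from filterlim_compose[OF asymp_dist_trop_cond_tendsto[OF X Y \<iota>] this]
    have lim_L: "(\<lambda>n. ?a (n * N) / real (n * N) * real N) \<longlonglongrightarrow> ?L * real N"
      by (intro tendsto_mult tendsto_const)
    have lim_k: "(\<lambda>n. ?c * ?k + (C * (sqrt (real n) / real n) + D / real n)) \<longlonglongrightarrow> ?c * ?k + (C * 0 + 0)"
    proof (intro tendsto_add tendsto_mult tendsto_const lim_const_over_n)
      show "(\<lambda>n. sqrt (real n) / real n) \<longlonglongrightarrow> 0" by real_asymp
    qed
    have le: "\<forall>\<^sub>F n in sequentially. ?a (n * N) / real (n * N) * real N \<le>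
        ?c * ?k + (C * (sqrt (real n) / real n) + D / real n)"
      using eventually_ge_at_top[of 1]
    proof eventually_elim
      case (elim n)
      have "?a (n * N) \<le> real n * (?c * ?k) + C * sqrt (real n) + D"
        using C[OF elim] D[of n] by linarith
      then have "?a (n * N) / real n \<le> (real n * (?c * ?k) + C * sqrt (real n) + D) / real n"
        by (rule divide_right_mono) simp
      also have "\<dots> = ?c * ?k + (C * (sqrt (real n) / real n) + D / real n)"
        using elim by (simp add: add_divide_distrib)
      finally show ?case using False by simp
    qed
    have "?L * real N \<le> ?c * ?k + (C * 0 + 0)"
      by (rule tendsto_le[OF sequentially_bot lim_k lim_L le])
    also have "\<dots> \<le> ?c * (entropy_dist G ?X ?Y + e / ?c)"
      using Z(2) by (simp add: mult_left_mono)
    also have "\<dots> = ?c * entropy_dist G ?X ?Y + e"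
      using e by (simp add: distrib_left)
    finally show "?L * real N \<le> ?c * entropy_dist G ?X ?Y + e" .
  qed
qed

end

theorem corollary3p2:
  fixes G :: "('o, 'm) cat"
    and X :: "('o, 'm, 'a) diagram"
    and Y :: "('o, 'm, 'b) diagram"
    and \<iota> :: 'o
  assumes "indexing_category G"
    and "is_diagram G X"
    and "is_diagram G Y"
    and "\<iota> \<in> Ob G"
  shows "asymp_dist G (trop_cond G X \<iota>) (trop_cond G Y \<iota>)
           \<le> (2 * real (card (Ob G)) + 1) * asymp_entropy_dist G X Y"
\<comment> \<open>The left-hand side does not depend on \<open>N\<close>, so the bounds for all
  positive \<open>N\<close> pass to the limit on the right.\<close>
proof (rule tendsto_lowerbound)
  interpret indexing_category G by fact
  show "(\<lambda>N. (2 * real (card (Ob G)) + 1) * (entropy_dist G (tensor_power X N) (tensor_power Y N) / real N))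
      \<longlonglongrightarrow> (2 * real (card (Ob G)) + 1) * asymp_entropy_dist G X Y"
    by (intro tendsto_mult tendsto_const asymp_entropy_dist_tendsto assms)
  show "\<forall>\<^sub>F N in sequentially. asymp_dist G (trop_cond G X \<iota>) (trop_cond G Y \<iota>) \<le>
      (2 * real (card (Ob G)) + 1) * (entropy_dist G (tensor_power X N) (tensor_power Y N) / real N)"
    using eventually_gt_at_top[of 0]
  proof eventually_elim
    case (elim N)
    then show ?case
      using asymp_dist_trop_cond_power_le[OF assms(2-4), of N] by (simp add: pos_le_divide_eq)
  qed
qed simp

end
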